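(* There exist absolute constants $C>0$ and $c>0$ such that the following holds. Let $\{X_i, i\in\mathcal{J}\}$ be a field of random variables with zero means and finite variances, indexed by a set $\mathcal{J}$ with $n=|\mathcal{J}|$ elements; let $W=\sum_{i\in\mathcal{J}}X_i$ and assume $\operatorname{Var}(W)=1$. Assume that the local dependence conditions (LD1) and (LD2) hold with neighborhoods $A_i\subset B_i\subset\mathcal{J}$, and let $\kappa=\max_{i\in\mathcal{J}}|N_i|$ where $N_i=\{j\in\mathcal{J}:B_i\cap B_j\neq\emptyset\}$. Assume there exist $a_n\ge 1$ and $b\ge 1$ such that for all $i\in\mathcal{J}$, $$\mathbb{E}\Big\{\exp\Big(a_n\sum_{j\in B_i}|X_j|\Big)\Big\}\le b.$$ Then $$\left|\frac{\mathbb{P}(W>z)}{1-\Phi(z)}-1\right|\le C\,\delta_n(1+z^3)$$ for $0\le z\le c\,a_n^{1/3}\min\{1,\kappa^{-1/3}(1+\theta_n)^{-2/3}\}$, where $\theta_n=b^{1/2}n^{1/2}a_n^{-1}$ and $\delta_n=\kappa^2a_n^{-1}(1+\theta_n^6)$.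
   Context: $\Phi$ is the standard normal distribution function. For $A\subset\mathcal{J}$, $X_A=\{X_i,i\in A\}$, $A^c=\mathcal{J}\setminus A$, and $|A|$ is the cardinality of $A$. (LD1): for each $i\in\mathcal{J}$ there exists $A_i\subset\mathcal{J}$ such that $X_i$ is independent of $X_{A_i^c}$. (LD2): for each $i\in\mathcal{J}$ there exists $B_i\subset\mathcal{J}$ such that $B_i\supset A_i$ and $X_{A_i}$ is independent of $X_{B_i^c}$. *)

theory Defs
  imports "HOL-Probability.Probability"
begin

abbreviation std_normal_cdf :: "real \<Rightarrow> real" ("\<Phi>") where
  "\<Phi> z \<equiv> cdf std_normal_distribution z"

(* Independence of X_S and X_T, the subfamilies being random elements of R^S and R^T. *)
definition indep_subfamilies ::
  "'a measure \<Rightarrow> ('i \<Rightarrow> 'a \<Rightarrow> real) \<Rightarrow> 'i set \<Rightarrow> 'i set \<Rightarrow> bool" where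
  "indep_subfamilies M X S T \<longleftrightarrow>
     prob_space.indep_var M
       (PiM S (\<lambda>_. borel)) (\<lambda>\<omega>. \<lambda>i\<in>S. X i \<omega>)
       (PiM T (\<lambda>_. borel)) (\<lambda>\<omega>. \<lambda>i\<in>T. X i \<omega>)"

(* The single variable X_i is written as the subfamily over {i}, because indep_var requires
   both random elements to have values in the same type. *)
definition LD1 ::
  "'a measure \<Rightarrow> 'i set \<Rightarrow> ('i \<Rightarrow> 'a \<Rightarrow> real) \<Rightarrow> ('i \<Rightarrow> 'i set) \<Rightarrow> bool" where
  "LD1 M J X A \<longleftrightarrow>
     (\<forall>i\<in>J. A i \<subseteq> J \<and> indep_subfamilies M X {i} (J - A i))"

definition LD2 ::
  "'a measure \<Rightarrow> 'i set \<Rightarrow> ('i \<Rightarrow> 'a \<Rightarrow> real) \<Rightarrow> ('i \<Rightarrow> 'i set) \<Rightarrow> ('i \<Rightarrow> 'i set) \<Rightarrow> bool" where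
  "LD2 M J X A B \<longleftrightarrow>
     (\<forall>i\<in>J. B i \<subseteq> J \<and> A i \<subseteq> B i \<and> indep_subfamilies M X (A i) (J - B i))"

definition nbhd :: "'i set \<Rightarrow> ('i \<Rightarrow> 'i set) \<Rightarrow> 'i \<Rightarrow> 'i set" where
  "nbhd J B i = {j\<in>J. B i \<inter> B j \<noteq> {}}"

definition kappa :: "'i set \<Rightarrow> ('i \<Rightarrow> 'i set) \<Rightarrow> nat" where
  "kappa J B = Max ((\<lambda>i. card (nbhd J B i)) ` J)"

definition theta :: "nat \<Rightarrow> real \<Rightarrow> real \<Rightarrow> real" where
  "theta n a b = b powr (1/2) * real n powr (1/2) / a"

definition delta :: "nat \<Rightarrow> nat \<Rightarrow> real \<Rightarrow> real \<Rightarrow> real" where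
  "delta n \<kappa> a b = (real \<kappa>)\<^sup>2 / a * (1 + theta n a b ^ 6)"

(* The constants C and c satisfy the moderate deviation bound for all fields indexed by finite
   subsets of 'i on all probability spaces over 'a. The type arguments make "absolute constant"
   expressible: a formula cannot quantify over types, so an existential in front of a statement
   about 'a and 'i would allow C and c to depend on these types. Uniformity over types is
   stated through the fixed instance TYPE(nat => real), TYPE(nat), which carries the joint
   law of every finite field of random variables.
   The integrability condition on the exponential is essential, since the Bochner integral of
   a non-integrable function is 0. *)
definition moderate_deviation_bound ::
  "'a itself \<Rightarrow> 'i itself \<Rightarrow> real \<Rightarrow> real \<Rightarrow> bool" where
  "moderate_deviation_bound _ _ C c \<longleftrightarrow>
    (\<forall>(M :: 'a measure) (J :: 'i set) X A B (a :: real) (b :: real) (z :: real).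
      prob_space M \<longrightarrow>
      finite J \<longrightarrow>
      (\<forall>i\<in>J. X i \<in> borel_measurable M \<and>
             integrable M (X i) \<and> prob_space.expectation M (X i) = 0 \<and>
             integrable M (\<lambda>\<omega>. (X i \<omega>)\<^sup>2)) \<longrightarrow>
      prob_space.variance M (\<lambda>\<omega>. \<Sum>i\<in>J. X i \<omega>) = 1 \<longrightarrow>
      LD1 M J X A \<longrightarrow>
      LD2 M J X A B \<longrightarrow>
      a \<ge> 1 \<longrightarrow>
      b \<ge> 1 \<longrightarrow>
      (\<forall>i\<in>J. integrable M (\<lambda>\<omega>. exp (a * (\<Sum>j\<in>B i. \<bar>X j \<omega>\<bar>))) \<and>
             prob_space.expectation M (\<lambda>\<omega>. exp (a * (\<Sum>j\<in>B i. \<bar>X j \<omega>\<bar>))) \<le> b) \<longrightarrow>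
      0 \<le> z \<longrightarrow>
      z \<le> c * a powr (1/3) *
            min 1 (real (kappa J B) powr (-1/3) * (1 + theta (card J) a b) powr (-2/3)) \<longrightarrow>
      \<bar>measure M {\<omega> \<in> space M. (\<Sum>i\<in>J. X i \<omega>) > z} / (1 - \<Phi> z) - 1\<bar>
        \<le> C * delta (card J) (kappa J B) a b * (1 + z ^ 3))"

end

theory Submission
  imports Defs
begin

text \<open>
The proof tilts the law of \<open>W = (\<Sum>i\<in>J. X i)\<close> by \<open>exp (z * W)\<close> and compares the tilted law with a normal
law by Stein's method.

\<^bold>\<open>Tilting.\<close> Write \<open>\<phi> t = E (exp (t * W))\<close>, let Q be the probability with density \<open>exp (z * W) / \<phi> z\<close> and
\<open>V = W - z\<close>. Then \<open>P (W > z) = \<phi> z * exp (- z\<^sup>2) * E\<^sub>Q (exp (- z * V); V > 0)\<close>. If V were standard normal under Q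
and \<open>\<phi> z\<close> were \<open>exp (z\<^sup>2 / 2)\<close>, the right-hand side would be \<open>1 - \<Phi> z\<close>. Put \<open>\<rho> = \<kappa> * (1 + \<theta>\<^sup>2) / a\<close>. It suffices to
show that \<open>ln (\<phi> z)\<close> differs from \<open>z\<^sup>2 / 2\<close> by \<open>O (\<rho> * (1 + z) ^ 3)\<close> (lemma \<open>ln_phi_close\<close>) and that the distribution
function of V under Q differs from \<Phi> by \<open>O (\<rho> * (1 + z)\<^sup>2)\<close> (lemma \<open>tilted_law_kolmogorov\<close>): a lower bound for the
Mills ratio turns both errors into a relative error \<open>O (\<rho> * (1 + z) ^ 3)\<close> (lemma \<open>tail_ratio\<close>), and
\<open>\<rho> \<le> 2 * \<delta>\<close>.

\<^bold>\<open>Decoupling.\<close> The conditions (LD1) and (LD2) make no statement about the dependence between \<open>X\<^sub>B\<close>, for \<open>B = B i\<close>,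
and the rest of the field, so a factor depending on the neighbourhood sum \<open>S i = (\<Sum>j\<in>B i. \<bar>X j\<bar>)\<close> cannot be split off
\<open>exp (t * W)\<close> by independence. Instead, a crude Gaussian bound for the moment generating function, obtained by colouring
the dependency graph with \<kappa> colours (lemma \<open>exp_W_le\<close>), shows that the event \<open>S i > 1 / \<tau>\<close> is negligible under
every tilt \<open>\<bar>t\<bar> \<le> \<tau>\<close> as long as \<open>\<kappa> * \<theta>\<^sup>2 * \<tau> ^ 3\<close> is small compared with a. The range of z in
the theorem ensures this for \<open>z \<ge> 1\<close>; where it fails for smaller z, the theorem is trivial (lemma
\<open>moderate_deviation\<close>). Outside this event the neighbourhood of i contributes a bounded factor to \<open>exp (t * W)\<close>, and a
function of \<open>X\<^sub>A\<close>, \<open>A = A i\<close>, can be decoupled from what remains (lemmas \<open>tE_local_le\<close>, \<open>tE_separated_le\<close>).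

\<^bold>\<open>Concentration.\<close> Under a tilt a sum of centred functions of the \<open>X\<^sub>A\<close> is small in \<open>L\<^sup>2\<close>: its second
moment is bounded by variance-like terms plus half of itself (lemmas \<open>centred_sq_pointwise\<close> and
\<open>tE_centred_sum_sq_le\<close>). Applied to
\<open>T = (\<Sum>i\<in>J. X i * (\<Sum>j\<in>A i. X j))\<close>, whose mean is \<open>Var W = 1\<close>, this gives \<open>\<phi>' t \<approx> t * \<phi> t\<close>, and integration
of this differential inequality gives \<open>ln_phi_close\<close>.

\<^bold>\<open>Stein's method.\<close> Under Q, \<open>E (W * f V)\<close> is close to \<open>E (T * (f' V + z * f V))\<close>. The error is of third order in
the neighbourhood sums, apart from the oscillation of the smoothed indicator that serves as test function. That
oscillation is a product of a local sum, replaced by its mean through concentration, and of a kernel in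
V, whose expectation is again controlled by the Kolmogorov distance; for a smoothing width that is a large
multiple of \<open>(1 + \<theta>\<^sup>2) / a\<close> the resulting inequality is a contraction (lemma \<open>kolmogorov_by_smoothing\<close>).

\<^bold>\<open>Uniformity in the types.\<close> Hypotheses and conclusion depend only on the joint law of the field, which
can be carried by \<open>nat \<Rightarrow> real\<close> after an enumeration of J (lemma \<open>moderate_deviation_bound_transfer\<close>).
\<close>

section \<open>Elementary inequalities and a colouring lemma\<close>

lemma power_le_exp:
  fixes x :: real
  assumes "0 \<le> x"
  shows "x ^ k \<le> fact k * exp x"
proof -
  have "(\<Sum>n\<in>{k}. inverse (fact n) * x ^ n) \<le> (\<Sum>n. inverse (fact n) * x ^ n)"
    by (rule sum_le_suminf) (use assms summable_exp[of x] in auto)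
  also have "\<dots> = exp x"
    by (simp add: exp_def scaleR_conv_of_real)
  finally show ?thesis
    by (simp add: field_simps)
qed

lemma power_le_exp_scaled:
  fixes x l :: real
  assumes "0 \<le> x" "0 < l"
  shows "x ^ k \<le> fact k / l ^ k * exp (l * x)"
proof -
  have "(l * x) ^ k \<le> fact k * exp (l * x)"
    by (rule power_le_exp) (use assms in auto)
  then show ?thesis
    using assms by (simp add: field_simps power_mult_distrib)
qed

lemma abs_exp_minus_one_le:
  fixes x :: real
  shows "\<bar>exp x - 1\<bar> \<le> \<bar>x\<bar> * exp \<bar>x\<bar>"
proof (cases "x \<ge> 0")
  case True
  have "1 + - x \<le> exp (- x)" by (rule exp_ge_add_one_self)
  then have "exp x * (1 - x) \<le> exp x * exp (- x)" by simp
  then have "exp x - 1 \<le> x * exp x" by (simp add: algebra_simps flip: exp_add)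
  moreover have "1 \<le> exp x" using True by simp
  ultimately show ?thesis using True by simp
next
  case False
  have "1 + x \<le> exp x" by (rule exp_ge_add_one_self)
  then have "1 - exp x \<le> \<bar>x\<bar> * 1" using False by linarith
  also have "\<dots> \<le> \<bar>x\<bar> * exp \<bar>x\<bar>" by (intro mult_left_mono) auto
  finally have "1 - exp x \<le> \<bar>x\<bar> * exp \<bar>x\<bar>" .
  moreover have "exp x \<le> 1" using False by simp
  ultimately show ?thesis by linarith
qed

lemma abs_exp_minus_affine_le:
  fixes x :: real
  shows "\<bar>exp x - 1 - x\<bar> \<le> x\<^sup>2 * exp \<bar>x\<bar>"
proof -
  have "\<bar>exp x - 1 - x\<bar> \<le> \<bar>x\<bar> * \<bar>exp x - 1\<bar>"
  proof -
    have "exp x - 1 - x \<ge> 0" using exp_ge_add_one_self[of x] by linarith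
    moreover have "exp x - 1 - x \<le> x * (exp x - 1)"
    proof -
      have "exp x * (1 - x) \<le> exp x * exp (- x)"
        using exp_ge_add_one_self[of "-x"] by (intro mult_left_mono) auto
      then have "exp x - x * exp x \<le> 1" by (simp add: algebra_simps flip: exp_add)
      then show ?thesis by (simp add: algebra_simps)
    qed
    moreover have "x * (exp x - 1) \<le> \<bar>x\<bar> * \<bar>exp x - 1\<bar>"
      by (simp flip: abs_mult)
    ultimately show ?thesis by simp
  qed
  also have "\<dots> \<le> \<bar>x\<bar> * (\<bar>x\<bar> * exp \<bar>x\<bar>)"
    by (intro mult_left_mono abs_exp_minus_one_le) auto
  finally show ?thesis by (simp add: power2_eq_square)
qed

text \<open>Jensen's inequality for \<open>exp\<close> with equal weights. It replaces Hoelder's inequality throughout: the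
exponential of a sum becomes an average of exponentials of single terms, and the exponents grow by the
number of terms only.\<close>
lemma exp_sum_le_average:
  fixes x :: "'i \<Rightarrow> real"
  assumes "finite I" "I \<noteq> {}"
  shows "exp (\<Sum>i\<in>I. x i) \<le> (\<Sum>i\<in>I. exp (real (card I) * x i)) / real (card I)"
proof -
  have c: "real (card I) > 0" using assms by (simp add: card_gt_0_iff)
  have "exp (\<Sum>i\<in>I. (1 / real (card I)) *\<^sub>R (real (card I) * x i))
      \<le> (\<Sum>i\<in>I. (1 / real (card I)) * exp (real (card I) * x i))"
    by (rule convex_on_sum[OF _ _ exp_convex]) (use assms c in auto)
  then show ?thesis
    using c by (simp add: sum_divide_distrib)
qed

text \<open>Elements are coloured one at a time. A new element has at most \<open>k - 1\<close> coloured neighbours, since its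
closed neighbourhood has at most k elements, so one of the k colours is free.\<close>
lemma greedy_colouring:
  assumes "finite J"
    and sym: "\<And>i j. adj i j \<Longrightarrow> adj j i"
    and deg: "\<And>i. i \<in> J \<Longrightarrow> card {j \<in> J. adj i j \<or> j = i} \<le> k"
  shows "\<exists>c::'i \<Rightarrow> nat. (\<forall>i\<in>J. c i < k) \<and> (\<forall>i\<in>J. \<forall>j\<in>J. i \<noteq> j \<longrightarrow> adj i j \<longrightarrow> c i \<noteq> c j)"
proof -
  have "\<exists>c::'i \<Rightarrow> nat. (\<forall>i\<in>I. c i < k) \<and> (\<forall>i\<in>I. \<forall>j\<in>I. i \<noteq> j \<longrightarrow> adj i j \<longrightarrow> c i \<noteq> c j)"
    if "I \<subseteq> J" for I
    using finite_subset[OF that assms(1)] that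
  proof (induction I rule: finite_induct)
    case empty
    then show ?case by simp
  next
    case (insert x F)
    then obtain c :: "'i \<Rightarrow> nat" where c: "\<forall>i\<in>F. c i < k"
        "\<forall>i\<in>F. \<forall>j\<in>F. i \<noteq> j \<longrightarrow> adj i j \<longrightarrow> c i \<noteq> c j"
      by auto
    define N where "N = {j \<in> F. adj x j}"
    have "insert x N \<subseteq> {j \<in> J. adj x j \<or> j = x}" using insert by (auto simp: N_def)
    then have "card (insert x N) \<le> k"
      using deg[of x] insert.prems card_mono[OF _ \<open>insert x N \<subseteq> _\<close>] assms(1) by fastforce
    moreover have "finite N" "x \<notin> N" using insert by (auto simp: N_def)
    ultimately have "card N < k" by simp
    then have "card (c ` N) < card {..<k}"
      using card_image_le[OF \<open>finite N\<close>, of c] by simp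
    then have "\<not> {..<k} \<subseteq> c ` N"
      using card_mono[of "c ` N" "{..<k}"] \<open>finite N\<close> by auto
    then obtain m where m: "m < k" "m \<notin> c ` N" by blast
    have "\<forall>i\<in>insert x F. (c(x := m)) i < k" using c m by auto
    moreover have "\<forall>i\<in>insert x F. \<forall>j\<in>insert x F. i \<noteq> j \<longrightarrow> adj i j \<longrightarrow> (c(x := m)) i \<noteq> (c(x := m)) j"
      using c m sym by (auto simp: N_def)
    ultimately show ?case by blast
  qed
  then show ?thesis by blast
qed

section \<open>The normal law: Mills ratio and the Stein equation\<close>

definition upper_tail :: "real \<Rightarrow> real" where
  "upper_tail w = measure std_normal_distribution {w<..}"

lemma upper_tail_eq_cdf: "upper_tail w = 1 - cdf std_normal_distribution w"
proof -
  interpret real_distribution std_normal_distribution by (rule real_dist_normal_dist)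
  have "measure std_normal_distribution {w<..} = measure std_normal_distribution (space std_normal_distribution - {..w})"
    by (rule arg_cong[where f="measure _"]) auto
  also have "\<dots> = 1 - measure std_normal_distribution {..w}"
    by (subst prob_compl) auto
  finally show ?thesis by (simp add: upper_tail_def cdf_def2)
qed

lemma std_normal_integral:
  fixes g :: "real \<Rightarrow> real"
  assumes "g \<in> borel_measurable borel"
  shows "integral\<^sup>L std_normal_distribution g = (LBINT x. std_normal_density x * g x)"
  using assms by (subst integral_density) auto

lemma upper_tail_integral: "upper_tail w = (LBINT x. std_normal_density x * indicator {w<..} x)"
proof -
  interpret real_distribution std_normal_distribution by (rule real_dist_normal_dist)
  have "upper_tail w = integral\<^sup>L std_normal_distribution (indicator {w<..})"
    unfolding upper_tail_def by simp
  also have "\<dots> = (LBINT x. std_normal_density x * indicator {w<..} x)"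
    by (rule std_normal_integral) simp
  finally show ?thesis .
qed

text \<open>After translation the Mills ratio is the integral of \<open>exp (- w * y)\<close> against the normal density on the positive
half-line. The bounds for it below come from estimates of this integrand.\<close>
lemma upper_tail_shift:
  "upper_tail w = (LBINT y. std_normal_density (w + y) * indicator {0<..} y)"
proof -
  have "upper_tail w = (LBINT x. std_normal_density (w + 1 * x) * indicator {w<..} (w + 1 * x))"
    unfolding upper_tail_integral by (subst lborel_integral_real_affine[where c=1 and t=w]) auto
  also have "\<dots> = (LBINT y. std_normal_density (w + y) * indicator {0<..} y)"
    by (intro Bochner_Integration.integral_cong) (auto simp: indicator_def)
  finally show ?thesis .
qed

lemma lower_tail_eq_upper_tail:
  "(LBINT x. std_normal_density x * indicator {..w} x) = upper_tail (- w)"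
proof -
  have "(LBINT x. std_normal_density x * indicator {..w} x)
      = (LBINT x. std_normal_density (0 + (-1) * x) * indicator {..w} (0 + (-1) * x))"
    by (subst lborel_integral_real_affine[where c="-1" and t=0]) auto
  also have "\<dots> = (LBINT x. std_normal_density x * indicator {-w<..} x)"
    by (intro integral_cong_AE)
       (use AE_lborel_singleton[of "-w"] in \<open>auto simp: indicator_def std_normal_density_def elim!: eventually_mono\<close>)
  finally show ?thesis by (simp add: upper_tail_integral)
qed

lemma integrable_std_normal_shift: "integrable lborel (\<lambda>y. std_normal_density (w + y) * indicator {0<..} (y::real))"
proof -
  have "integrable lborel (\<lambda>y. std_normal_density (w + 1 * y))"
    by (rule lborel_integrable_real_affine) auto
  then show ?thesis
    by (intro integrable_real_mult_indicator) auto
qed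

lemma std_normal_density_shift:
  "std_normal_density (w + y) = exp (- w\<^sup>2 / 2) * (exp (- (w * y)) * std_normal_density y)"
  by (simp add: std_normal_density_def field_simps power2_eq_square flip: exp_add)

lemma std_normal_density_le: "std_normal_density y \<le> std_normal_density 0"
  by (simp add: std_normal_density_def divide_right_mono)

lemma std_normal_density_eq: "std_normal_density w = exp (- w\<^sup>2 / 2) * std_normal_density 0"
  by (simp add: std_normal_density_def)

lemma std_normal_density_zero_bounds: "1 / 3 \<le> std_normal_density 0" "std_normal_density 0 \<le> 1 / 2"
proof -
  have "sqrt (2 * pi) \<le> sqrt 9" using pi_less_4 by (intro real_sqrt_le_mono) auto
  then have a: "sqrt (2 * pi) \<le> 3" by simp
  have "sqrt 4 \<le> sqrt (2 * pi)" using pi_ge_two by (intro real_sqrt_le_mono) auto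
  then have b: "2 \<le> sqrt (2 * pi)" by simp
  show "1 / 3 \<le> std_normal_density 0" "std_normal_density 0 \<le> 1 / 2"
    using a b by (auto simp: std_normal_density_def field_simps)
qed

lemma mills_gauss:
  assumes "0 \<le> w"
  shows "upper_tail w \<le> exp (- w\<^sup>2 / 2)"
proof -
  interpret real_distribution std_normal_distribution by (rule real_dist_normal_dist)
  have "upper_tail w \<le> (LBINT y. exp (- w\<^sup>2 / 2) * (std_normal_density (0 + y) * indicator {0<..} y))"
    unfolding upper_tail_shift[of w]
  proof (intro integral_mono integrable_std_normal_shift integrable_mult_right)
    fix y :: real
    have "std_normal_density (w + y) \<le> exp (- w\<^sup>2 / 2) * std_normal_density y" if "y > 0"
      unfolding std_normal_density_shift using assms that
      by (intro mult_left_mono mult_left_le_one_le) auto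
    then show "std_normal_density (w + y) * indicator {0<..} y
        \<le> exp (- w\<^sup>2 / 2) * (std_normal_density (0 + y) * indicator {0<..} y)"
      by (auto simp: indicator_def)
  qed
  also have "\<dots> = exp (- w\<^sup>2 / 2) * upper_tail 0"
    unfolding upper_tail_shift[of 0] by (subst integral_mult_right_zero) simp
  also have "\<dots> \<le> exp (- w\<^sup>2 / 2) * 1"
    unfolding upper_tail_def by (intro mult_left_mono) auto
  finally show ?thesis by simp
qed

lemma mills_inverse:
  assumes "0 \<le> w"
  shows "w * upper_tail w \<le> std_normal_density w"
proof (cases "w = 0")
  case False
  then have w: "0 < w" using assms by simp
  have nn: "(\<integral>\<^sup>+y. ennreal (exponential_density w y) \<partial>lborel) = 1"
  proof -
    interpret prob_space "density lborel (exponential_density w)"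
      by (rule prob_space_exponential_density[OF w])
    show ?thesis using emeasure_space_1 by (simp add: emeasure_density)
  qed
  have hb: "has_bochner_integral lborel (exponential_density w) 1"
    by (rule has_bochner_integral_nn_integral)
       (use nn w in \<open>auto simp: exponential_density_def\<close>)
  have "w * upper_tail w = (LBINT y. w * (std_normal_density (w + y) * indicator {0<..} y))"
    unfolding upper_tail_shift by simp
  also have "\<dots> \<le> (LBINT y. std_normal_density w * exponential_density w y)"
  proof (intro integral_mono integrable_mult_right integrable_std_normal_shift)
    show "integrable lborel (exponential_density w)" using hb by (auto simp: has_bochner_integral_iff)
    fix y :: real
    have "w * std_normal_density (w + y) \<le> std_normal_density w * (w * exp (- (w * y)))"
    proof -
      have "std_normal_density (w + y) \<le> exp (- w\<^sup>2 / 2) * (exp (- (w * y)) * std_normal_density 0)"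
        unfolding std_normal_density_shift by (intro mult_left_mono std_normal_density_le) auto
      then have "w * std_normal_density (w + y) \<le> w * (exp (- w\<^sup>2 / 2) * (exp (- (w * y)) * std_normal_density 0))"
        using w by (intro mult_left_mono) auto
      also have "\<dots> = std_normal_density w * (w * exp (- (w * y)))"
        by (subst (2) std_normal_density_eq) simp
      finally show ?thesis .
    qed
    then show "w * (std_normal_density (w + y) * indicator {0<..} y) \<le> std_normal_density w * exponential_density w y"
      using w by (auto simp: indicator_def exponential_density_def mult_ac)
  qed
  also have "\<dots> = std_normal_density w"
    using hb by (simp add: has_bochner_integral_iff)
  finally show ?thesis .
qed simp

text \<open>On the interval \<open>{0<..1 / (1 + w)}\<close> the factor \<open>exp (- w * y - y\<^sup>2 / 2)\<close> is at least \<open>exp (- 3 / 2)\<close>.\<close>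
lemma mills_lower:
  assumes "0 \<le> w"
  shows "exp (- w\<^sup>2 / 2) \<le> 15 * (1 + w) * upper_tail w"
proof -
  define r where "r = 1 / (1 + w)"
  have r: "0 < r" "r \<le> 1" "w * r \<le> 1" using assms by (auto simp: r_def field_simps)
  have e: "exp (3/2 :: real) \<le> 5"
  proof (rule power2_le_imp_le)
    have "(exp (3/2 :: real))\<^sup>2 = exp 1 ^ 3" by (simp flip: exp_of_nat_mult exp_double)
    also have "\<dots> \<le> (272/100) ^ 3" using e_less_272 by (intro power_mono) auto
    also have "\<dots> \<le> 5\<^sup>2" by (simp add: power_divide)
    finally show "(exp (3/2 :: real))\<^sup>2 \<le> 5\<^sup>2" .
  qed simp
  have "exp (- w\<^sup>2 / 2) * (exp (-3/2) * std_normal_density 0) * r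
     = (LBINT y. exp (- w\<^sup>2 / 2) * (exp (-3/2) * std_normal_density 0) * indicator {0<..r} y)"
    using r by simp
  also have "\<dots> \<le> upper_tail w"
    unfolding upper_tail_shift
  proof (intro integral_mono integrable_std_normal_shift)
    show "integrable lborel (\<lambda>y. exp (- w\<^sup>2 / 2) * (exp (-3/2) * std_normal_density 0) * indicat_real {0<..r} y)"
      by (intro integrable_mult_right integrable_real_indicator) (use r in auto)
    fix y :: real
    have "exp (- w\<^sup>2 / 2) * (exp (-3/2) * std_normal_density 0) \<le> std_normal_density (w + y)"
      if y: "0 < y" "y \<le> r"
    proof -
      have "w * y \<le> 1" using r y assms mult_left_mono[OF y(2) assms] by linarith
      moreover have "y\<^sup>2 \<le> 1" using r y by (auto intro: power_le_one)
      ultimately have "exp (-3/2) \<le> exp (- (w * y)) * exp (- y\<^sup>2 / 2)"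
        unfolding exp_add[symmetric] by simp
      then have "exp (-3/2) * std_normal_density 0 \<le> exp (- (w * y)) * std_normal_density y"
        by (subst (2) std_normal_density_eq) (simp add: mult_right_mono flip: mult.assoc)
      then show ?thesis unfolding std_normal_density_shift by (intro mult_left_mono) auto
    qed
    then show "exp (- w\<^sup>2 / 2) * (exp (-3/2) * std_normal_density 0) * indicat_real {0<..r} y
        \<le> std_normal_density (w + y) * indicator {0<..} y"
      by (auto simp: indicator_def)
  qed
  finally have tail: "exp (- w\<^sup>2 / 2) * (exp (-3/2) * std_normal_density 0) \<le> (1 + w) * upper_tail w"
    using assms by (simp add: r_def field_simps)
  have "1 \<le> 15 * (exp (-3/2) * std_normal_density 0)"
  proof -
    have "1 \<le> exp (-3/2) * (5::real)" using mult_left_mono[OF e, of "exp (-3/2)"] by (simp flip: exp_add)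
    also have "\<dots> \<le> exp (-3/2) * (15 * std_normal_density 0)"
      using std_normal_density_zero_bounds by (intro mult_left_mono) auto
    finally show ?thesis by simp
  qed
  note K = this
  have "exp (- w\<^sup>2 / 2) * 1 \<le> exp (- w\<^sup>2 / 2) * (15 * (exp (-3/2) * std_normal_density 0))"
    by (intro mult_left_mono K) auto
  also have "\<dots> = 15 * (exp (- w\<^sup>2 / 2) * (exp (-3/2) * std_normal_density 0))" by simp
  also have "\<dots> \<le> 15 * ((1 + w) * upper_tail w)"
    by (intro mult_left_mono) (use tail in auto)
  finally show ?thesis by (simp only: mult_1_right mult.assoc)
qed

lemma upper_tail_pos: "0 \<le> w \<Longrightarrow> 0 < upper_tail w"
  using mills_lower[of w] by (smt (verit) exp_gt_zero mult_nonneg_nonpos)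

lemma has_derivative_lower_integral:
  fixes g :: "real \<Rightarrow> real"
  assumes g: "integrable lborel g" and cont: "continuous_on UNIV g"
  shows "((\<lambda>w. LBINT x. g x * indicator {..w} x) has_real_derivative g w) (at w)"
proof -
  define m where "m = w - 1"
  have int: "integrable lborel (\<lambda>x. g x * indicator S x)" if "S \<in> sets borel" for S
    using g that by (intro integrable_real_mult_indicator) auto
  have eq: "(LBINT x. g x * indicator {..u} x) = (LBINT x. g x * indicator {..m} x) + integral {m..u} g"
    if "m < u" for u
  proof -
    have "(LBINT x. g x * indicator {..u} x) = (LBINT x. g x * indicator {..m} x + g x * indicator {m<..u} x)"
      using that by (intro Bochner_Integration.integral_cong) (auto simp: indicator_def)
    also have "\<dots> = (LBINT x. g x * indicator {..m} x) + (LBINT x. g x * indicator {m<..u} x)"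
      by (intro Bochner_Integration.integral_add int) auto
    also have "(LBINT x. g x * indicator {m<..u} x) = (LBINT x. g x * indicator {m..u} x)"
      by (intro integral_cong_AE)
         (use g AE_lborel_singleton[of m] in \<open>auto simp: indicator_def elim!: eventually_mono\<close>)
    also have "\<dots> = integral {m..u} g"
      using set_borel_integral_eq_integral(2)[of "{m..u}" g] int[of "{m..u}"]
      by (simp add: set_integrable_def set_lebesgue_integral_def mult.commute)
    finally show ?thesis .
  qed
  have "((\<lambda>u. integral {m..u} g) has_real_derivative g w) (at w within {m..w + 1})"
    by (rule integral_has_real_derivative) (use cont in \<open>auto simp: m_def intro: continuous_on_subset\<close>)
  then have "((\<lambda>u. integral {m..u} g) has_real_derivative g w) (at w)"
    by (subst (asm) at_within_interior) (auto simp: m_def)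
  then have "((\<lambda>u. (LBINT x. g x * indicator {..m} x) + integral {m..u} g) has_real_derivative g w) (at w)"
    by (auto intro!: derivative_eq_intros)
  then show ?thesis
  proof (rule has_field_derivative_transform_within_open[where S="{m<..}"])
  qed (auto simp: eq m_def)
qed

text \<open>The solution is \<open>f = P / p\<close>, where p is the normal density and \<open>P w\<close> the integral of \<open>(h - c) * p\<close> over
\<open>{..w}\<close>. The integral over the whole line vanishes, so \<open>\<bar>P w\<bar>\<close> is at most the normal tail beyond \<open>\<bar>w\<bar>\<close> on
either side of the origin, and the two upper Mills bounds control f and \<open>w * f w\<close>.\<close>
lemma stein_solution:
  fixes h :: "real \<Rightarrow> real"
  assumes cont: "continuous_on UNIV h" and h01: "\<And>x. 0 \<le> h x" "\<And>x. h x \<le> 1"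
  obtains f f' where
    "\<And>w. (f has_real_derivative f' w) (at w)"
    "\<And>w. f' w = w * f w + h w - integral\<^sup>L std_normal_distribution h"
    "\<And>w. \<bar>f w\<bar> \<le> 3" "\<And>w. \<bar>f' w\<bar> \<le> 2"
proof -
  have hm[measurable]: "h \<in> borel_measurable borel"
    using cont by (rule borel_measurable_continuous_onI)
  interpret N: real_distribution std_normal_distribution by (rule real_dist_normal_dist)
  define c where "c = integral\<^sup>L std_normal_distribution h"
  have hi: "integrable std_normal_distribution h"
    by (rule N.integrable_const_bound[where B=1]) (use h01 in auto)
  have c01: "0 \<le> c" "c \<le> 1"
    unfolding c_def using h01 hi N.integral_le_const[OF hi, of 1]
    by (auto intro!: integral_nonneg_AE)
  define g where "g = (\<lambda>x. std_normal_density x * (h x - c))"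
  have g1: "\<bar>g x\<bar> \<le> std_normal_density x" for x
    unfolding g_def abs_mult using h01(1,2)[of x] c01 by (simp add: mult_left_le abs_le_iff)
  have gi: "integrable lborel g"
    by (rule Bochner_Integration.integrable_bound[OF integrable_normal_density[of 1 0]])
       (use g1 in \<open>auto simp: g_def\<close>)
  have gc: "continuous_on UNIV g"
    unfolding g_def std_normal_density_def by (intro continuous_intros cont) auto
  have g0: "(LBINT x. g x) = 0"
  proof -
    have "(LBINT x. g x) = integral\<^sup>L std_normal_distribution (\<lambda>x. h x - c)"
      unfolding g_def by (rule std_normal_integral[symmetric]) simp
    also have "\<dots> = c - c" using hi N.prob_space
      by (subst Bochner_Integration.integral_diff) (auto simp: c_def)
    finally show ?thesis by simp
  qed
  define P where "P = (\<lambda>w. LBINT x. g x * indicator {..w} x)"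
  have int: "integrable lborel (\<lambda>x. g x * indicator S x)" if "S \<in> sets borel" for S
    using gi that by (intro integrable_real_mult_indicator) auto
  have int': "integrable lborel (\<lambda>x. std_normal_density x * indicator S x)" if "S \<in> sets borel" for S
    using that by (intro integrable_real_mult_indicator) auto
  have bnd: "\<bar>LBINT x. g x * indicator S x\<bar> \<le> (LBINT x. std_normal_density x * indicator S x)"
    if S: "S \<in> sets borel" for S
  proof -
    have "\<bar>LBINT x. g x * indicator S x\<bar> \<le> (LBINT x. \<bar>g x * indicator S x\<bar>)"
      using integral_norm_bound[of lborel "\<lambda>x. g x * indicator S x"] by simp
    also have "\<dots> \<le> (LBINT x. std_normal_density x * indicator S x)"
      by (intro integral_mono integrable_abs int int' S)
         (use g1 in \<open>auto simp: indicator_def\<close>)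
    finally show ?thesis .
  qed
  have P_le: "\<bar>P w\<bar> \<le> upper_tail \<bar>w\<bar>" for w
  proof (cases "w \<ge> 0")
    case True
    have "(LBINT x. g x) = (LBINT x. g x * indicator {..w} x + g x * indicator {w<..} x)"
      by (intro Bochner_Integration.integral_cong) (auto simp: indicator_def)
    also have "\<dots> = P w + (LBINT x. g x * indicator {w<..} x)"
      unfolding P_def by (intro Bochner_Integration.integral_add int) auto
    finally have "P w = - (LBINT x. g x * indicator {w<..} x)" using g0 by simp
    then show ?thesis using bnd[of "{w<..}"] True by (simp add: upper_tail_integral)
  next
    case False
    then show ?thesis using bnd[of "{..w}"] by (simp add: P_def lower_tail_eq_upper_tail)
  qed
  define f where "f = (\<lambda>w. P w / std_normal_density w)"
  define f' where "f' = (\<lambda>w. w * f w + h w - c)"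
  have dpos: "std_normal_density w > 0" for w by (rule normal_density_pos) simp
  have Pd: "(P has_real_derivative g w) (at w)" for w
    unfolding P_def by (rule has_derivative_lower_integral[OF gi gc])
  have dd: "(std_normal_density has_real_derivative (- w * std_normal_density w)) (at w)" for w
  proof -
    define k where "k = std_normal_density 0"
    have "std_normal_density = (\<lambda>w. exp (- w\<^sup>2 / 2) * k)"
      unfolding k_def by (rule ext) (rule std_normal_density_eq)
    then show ?thesis by (auto intro!: derivative_eq_intros)
  qed
  have "(f has_real_derivative f' w) (at w)" for w
    unfolding f_def
    by (rule derivative_eq_intros refl Pd dd)+
       (use dpos[of w] in \<open>auto simp: f'_def f_def g_def field_simps power2_eq_square\<close>)
  moreover have "f' w = w * f w + h w - integral\<^sup>L std_normal_distribution h" for w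
    by (simp add: f'_def c_def)
  moreover have "\<bar>f w\<bar> \<le> 3" for w
  proof -
    have "\<bar>P w\<bar> \<le> exp (- w\<^sup>2 / 2)" using P_le[of w] mills_gauss[of "\<bar>w\<bar>"] by simp
    also have "\<dots> \<le> exp (- w\<^sup>2 / 2) * (3 * std_normal_density 0)"
      using std_normal_density_zero_bounds by simp
    also have "\<dots> = 3 * std_normal_density w" by (subst (2) std_normal_density_eq) simp
    finally show ?thesis unfolding f_def using dpos[of w] by (simp add: field_simps abs_mult)
  qed
  moreover have "\<bar>f' w\<bar> \<le> 2" for w
  proof -
    have "\<bar>w\<bar> * \<bar>P w\<bar> \<le> \<bar>w\<bar> * upper_tail \<bar>w\<bar>" using P_le[of w] by (intro mult_left_mono) auto
    also have "\<dots> \<le> std_normal_density w" using mills_inverse[of "\<bar>w\<bar>"] by (simp add: std_normal_density_def)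
    finally have "\<bar>w * f w\<bar> \<le> 1" unfolding f_def using dpos[of w] by (simp add: field_simps abs_mult)
    moreover have "\<bar>h w - c\<bar> \<le> 1" using h01(1,2)[of w] c01 by (simp add: abs_le_iff)
    ultimately show ?thesis unfolding f'_def by linarith
  qed
  ultimately show ?thesis by (rule that)
qed

text \<open>The integral of g is the integral over s of the measures of the sets \<open>{x. s < g x}\<close>. The lemma is
applied to functions for which these sets are intervals.\<close>
lemma layer_cake_comparison:
  fixes g :: "real \<Rightarrow> real"
  assumes \<mu>: "real_distribution \<mu>" and \<nu>: "real_distribution \<nu>"
    and gm[measurable]: "g \<in> borel_measurable borel" and g01: "\<And>x. 0 \<le> g x" "\<And>x. g x \<le> 1"
    and close: "\<And>s. 0 < s \<Longrightarrow> s < 1 \<Longrightarrow> \<bar>measure \<mu> {x. s < g x} - measure \<nu> {x. s < g x}\<bar> \<le> d"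
  shows "\<bar>integral\<^sup>L \<mu> g - integral\<^sup>L \<nu> g\<bar> \<le> d"
proof -
  have rep: "integral\<^sup>L \<mu> g = (LBINT s. measure \<mu> {x. s < g x} * indicator {0<..<1} s) \<and>
      integrable lborel (\<lambda>s. measure \<mu> {x. s < g x} * indicator {0<..<1} s)"
    if "real_distribution \<mu>" for \<mu>
  proof -
    interpret real_distribution \<mu> by fact
    interpret pair_sigma_finite \<mu> lborel ..
    have meas: "(\<lambda>s. measure \<mu> {x. s < g x}) \<in> borel_measurable lborel"
    proof -
      have "(\<lambda>s. \<integral>x. (if s < g x then 1 else 0::real) \<partial>\<mu>) \<in> borel_measurable lborel"
        by measurable
      moreover have "(\<integral>x. (if s < g x then 1 else 0::real) \<partial>\<mu>) = measure \<mu> {x. s < g x}" for s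
      proof -
        have "(\<integral>x. (if s < g x then 1 else 0::real) \<partial>\<mu>) = (\<integral>x. indicator {x. s < g x} x \<partial>\<mu>)"
          by (intro Bochner_Integration.integral_cong) (auto simp: indicator_def)
        then show ?thesis by simp
      qed
      ultimately show ?thesis by simp
    qed
    have int: "integrable lborel (\<lambda>s. measure \<mu> {x. s < g x} * indicator {0<..<1::real} s)"
      by (rule Bochner_Integration.integrable_bound[where f="indicator {0<..<1::real}"])
         (use meas in \<open>auto simp: indicator_def\<close>)
    have "(\<integral>\<^sup>+x. ennreal (g x) \<partial>\<mu>) = (\<integral>\<^sup>+x. \<integral>\<^sup>+s. indicator {s. 0 < s \<and> s < 1 \<and> s < g x} s \<partial>lborel \<partial>\<mu>)"
    proof (intro nn_integral_cong)
      fix x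
      have "{s. 0 < s \<and> s < 1 \<and> s < g x} = {0<..<g x}" using g01(2)[of x] by auto
      then show "ennreal (g x) = (\<integral>\<^sup>+s. indicator {s. 0 < s \<and> s < 1 \<and> s < g x} s \<partial>lborel)"
        using g01(1)[of x] by simp
    qed
    also have "\<dots> = (\<integral>\<^sup>+s. \<integral>\<^sup>+x. indicator {s. 0 < s \<and> s < 1 \<and> s < g x} s \<partial>\<mu> \<partial>lborel)"
      by (rule Fubini'[symmetric]) measurable
    also have "\<dots> = (\<integral>\<^sup>+s. ennreal (measure \<mu> {x. s < g x} * indicator {0<..<1} s) \<partial>lborel)"
    proof (intro nn_integral_cong)
      fix s :: real
      have "(\<integral>\<^sup>+x. indicator {s. 0 < s \<and> s < 1 \<and> s < g x} s \<partial>\<mu>) = (\<integral>\<^sup>+x. indicator {0<..<1} s * indicator {x. s < g x} x \<partial>\<mu>)"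
        by (intro nn_integral_cong) (auto simp: indicator_def)
      also have "\<dots> = indicator {0<..<1} s * emeasure \<mu> {x. s < g x}"
        by (subst nn_integral_cmult) auto
      finally show "(\<integral>\<^sup>+x. indicator {s. 0 < s \<and> s < 1 \<and> s < g x} s \<partial>\<mu>) = ennreal (measure \<mu> {x. s < g x} * indicator {0<..<1} s)"
        by (auto simp: indicator_def emeasure_eq_measure)
    qed
    also have "\<dots> = ennreal (LBINT s. measure \<mu> {x. s < g x} * indicator {0<..<1} s)"
      using int by (intro nn_integral_eq_integral) auto
    finally have "integral\<^sup>L \<mu> g = (LBINT s. measure \<mu> {x. s < g x} * indicator {0<..<1} s)"
      using g01 by (subst integral_eq_nn_integral) (auto intro!: integral_nonneg_AE)
    then show ?thesis using int by blast
  qed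
  have d: "0 \<le> d" using close[of "1/2"] by auto
  have "\<bar>integral\<^sup>L \<mu> g - integral\<^sup>L \<nu> g\<bar>
     = \<bar>LBINT s. measure \<mu> {x. s < g x} * indicator {0<..<1} s - measure \<nu> {x. s < g x} * indicator {0<..<1} s\<bar>"
    using rep[OF \<mu>] rep[OF \<nu>] by (subst Bochner_Integration.integral_diff) auto
  also have "\<dots> \<le> (LBINT s. \<bar>measure \<mu> {x. s < g x} * indicator {0<..<1} s - measure \<nu> {x. s < g x} * indicator {0<..<1} s\<bar>)"
    by (rule integral_abs_bound)
  also have "\<dots> \<le> (LBINT s. d * indicator {0<..<1::real} s)"
    by (intro integral_mono integrable_abs Bochner_Integration.integrable_diff integrable_mult_right
          integrable_real_indicator rep[OF \<mu>, THEN conjunct2] rep[OF \<nu>, THEN conjunct2])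
       (use close in \<open>auto simp: indicator_def\<close>)
  also have "\<dots> = d" by simp
  finally show ?thesis .
qed

section \<open>From smooth test functions to the Kolmogorov distance\<close>

text \<open>The half-line without its end point is reached by left limits of the distribution functions.\<close>
lemma interval_measure_close:
  assumes \<mu>: "real_distribution \<mu>" and \<nu>: "real_distribution \<nu>"
    and close: "\<And>x. \<bar>cdf \<mu> x - cdf \<nu> x\<bar> \<le> e"
  shows "\<bar>measure \<mu> {l<..<u} - measure \<nu> {l<..<u}\<bar> \<le> 2 * e"
    and "\<bar>measure \<mu> {l<..} - measure \<nu> {l<..}\<bar> \<le> e"
proof -
  interpret \<mu>: real_distribution \<mu> by fact
  interpret \<nu>: real_distribution \<nu> by fact
  have lt: "\<bar>measure \<mu> {..<u} - measure \<nu> {..<u}\<bar> \<le> e"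
  proof (rule tendsto_upperbound)
    show "((\<lambda>x. \<bar>cdf \<mu> x - cdf \<nu> x\<bar>) \<longlongrightarrow> \<bar>measure \<mu> {..<u} - measure \<nu> {..<u}\<bar>) (at_left u)"
      by (intro tendsto_rabs tendsto_diff \<mu>.cdf_at_left \<nu>.cdf_at_left)
  qed (use close in auto)
  have e0: "0 \<le> e" using close[of 0] by linarith
  have split: "measure \<rho> {l<..<u} = measure \<rho> {..<u} - cdf \<rho> l" if "real_distribution \<rho>" "l < u" for \<rho>
  proof -
    interpret real_distribution \<rho> by fact
    have "measure \<rho> ({..<u} - {..l}) = measure \<rho> {..<u} - measure \<rho> {..l}"
      by (rule finite_measure_Diff) (use that in auto)
    moreover have "{..<u} - {..l} = {l<..<u}" by auto
    ultimately show ?thesis by (simp add: cdf_def2)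
  qed
  show "\<bar>measure \<mu> {l<..<u} - measure \<nu> {l<..<u}\<bar> \<le> 2 * e"
  proof (cases "l < u")
    case True
    show ?thesis unfolding split[OF \<mu> True] split[OF \<nu> True] using lt close[of l] by linarith
  qed (use e0 in auto)
  have compl: "measure \<rho> {l<..} = 1 - cdf \<rho> l" if "real_distribution \<rho>" for \<rho>
  proof -
    interpret real_distribution \<rho> by fact
    have "measure \<rho> (space \<rho> - {..l}) = 1 - measure \<rho> {..l}" by (rule prob_compl) auto
    moreover have "space \<rho> - {..l} = {l<..}" by auto
    ultimately show ?thesis by (simp add: cdf_def2)
  qed
  show "\<bar>measure \<mu> {l<..} - measure \<nu> {l<..}\<bar> \<le> e"
    unfolding compl[OF \<mu>] compl[OF \<nu>] using close[of l] by linarith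
qed

lemma exp_kernel_close:
  fixes \<alpha> x :: real
  assumes \<mu>: "real_distribution \<mu>" and \<nu>: "real_distribution \<nu>"
    and close: "\<And>x. \<bar>cdf \<mu> x - cdf \<nu> x\<bar> \<le> e" and \<alpha>: "0 < \<alpha>"
  shows "\<bar>(\<integral>v. exp (- (\<bar>v - x\<bar> / \<alpha>)) \<partial>\<mu>) - (\<integral>v. exp (- (\<bar>v - x\<bar> / \<alpha>)) \<partial>\<nu>)\<bar> \<le> 2 * e"
proof (rule layer_cake_comparison[OF \<mu> \<nu>])
  fix s :: real assume s: "0 < s" "s < 1"
  have "s < exp (- (\<bar>v - x\<bar> / \<alpha>)) \<longleftrightarrow> v \<in> {x - \<alpha> * ln (1 / s)<..<x + \<alpha> * ln (1 / s)}" for v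
  proof -
    have "s < exp (- (\<bar>v - x\<bar> / \<alpha>)) \<longleftrightarrow> ln s < - (\<bar>v - x\<bar> / \<alpha>)"
      using s ln_less_cancel_iff[of s "exp (- (\<bar>v - x\<bar> / \<alpha>))"] by simp
    also have "\<dots> \<longleftrightarrow> \<bar>v - x\<bar> < \<alpha> * ln (1 / s)"
      using \<alpha> s by (simp add: ln_div field_simps) linarith
    finally show ?thesis by auto
  qed
  then have "{v. s < exp (- (\<bar>v - x\<bar> / \<alpha>))} = {x - \<alpha> * ln (1 / s)<..<x + \<alpha> * ln (1 / s)}" by blast
  then show "\<bar>measure \<mu> {v. s < exp (- (\<bar>v - x\<bar> / \<alpha>))} - measure \<nu> {v. s < exp (- (\<bar>v - x\<bar> / \<alpha>))}\<bar> \<le> 2 * e"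
    using interval_measure_close(1)[OF \<mu> \<nu> close] by simp
qed (use \<alpha> in auto)

lemma std_normal_density_le_half: "std_normal_density y \<le> 1 / 2"
  by (rule order_trans[OF std_normal_density_le std_normal_density_zero_bounds(2)])

lemma exp_kernel_normal_le:
  fixes \<alpha> x :: real
  assumes \<alpha>: "0 < \<alpha>"
  shows "(\<integral>v. exp (- (\<bar>v - x\<bar> / \<alpha>)) \<partial>std_normal_distribution) \<le> \<alpha>"
proof -
  have nn: "(\<integral>\<^sup>+y. ennreal (exponential_density (1 / \<alpha>) y) \<partial>lborel) = 1"
  proof -
    interpret prob_space "density lborel (exponential_density (1 / \<alpha>))"
      by (rule prob_space_exponential_density) (use \<alpha> in simp)
    show ?thesis using emeasure_space_1 by (simp add: emeasure_density)
  qed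
  have hb: "has_bochner_integral lborel (exponential_density (1 / \<alpha>)) 1"
    by (rule has_bochner_integral_nn_integral)
       (use nn \<alpha> in \<open>auto simp: exponential_density_def\<close>)
  have hb1: "has_bochner_integral lborel (\<lambda>v. exponential_density (1 / \<alpha>) (- x + 1 * v)) 1"
    using lborel_has_bochner_integral_real_affine_iff[of 1 "exponential_density (1 / \<alpha>)" 1 "- x"] hb by simp
  have hb2: "has_bochner_integral lborel (\<lambda>v. exponential_density (1 / \<alpha>) (x + (-1) * v)) 1"
    using lborel_has_bochner_integral_real_affine_iff[of "-1" "exponential_density (1 / \<alpha>)" 1 x] hb by simp
  have "(\<integral>v. exp (- (\<bar>v - x\<bar> / \<alpha>)) \<partial>std_normal_distribution)
      = (LBINT v. std_normal_density v * exp (- (\<bar>v - x\<bar> / \<alpha>)))"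
    by (rule std_normal_integral) measurable
  also have "\<dots> \<le> (LBINT v. \<alpha> / 2 * (exponential_density (1 / \<alpha>) (- x + 1 * v) + exponential_density (1 / \<alpha>) (x + (-1) * v)))"
  proof (rule integral_mono)
    show "integrable lborel (\<lambda>v. std_normal_density v * exp (- (\<bar>v - x\<bar> / \<alpha>)))"
    proof (rule Bochner_Integration.integrable_bound[where f=std_normal_density], simp, measurable, rule AE_I2)
      fix v :: real
      have "exp (- (\<bar>v - x\<bar> / \<alpha>)) \<le> 1" using \<alpha> by simp
      then have "std_normal_density v * exp (- (\<bar>v - x\<bar> / \<alpha>)) \<le> std_normal_density v * 1"
        by (rule mult_left_mono) simp
      then show "norm (std_normal_density v * exp (- (\<bar>v - x\<bar> / \<alpha>))) \<le> norm (std_normal_density v)"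
        by simp
    qed
    show "integrable lborel (\<lambda>v. \<alpha> / 2 * (exponential_density (1 / \<alpha>) (- x + 1 * v) + exponential_density (1 / \<alpha>) (x + (-1) * v)))"
      using hb1 hb2 by (intro integrable_mult_right Bochner_Integration.integrable_add) (auto simp: has_bochner_integral_iff)
    fix v :: real
    have "std_normal_density v * exp (- (\<bar>v - x\<bar> / \<alpha>)) \<le> 1 / 2 * exp (- (\<bar>v - x\<bar> / \<alpha>))"
      by (intro mult_right_mono std_normal_density_le_half) auto
    also have "\<dots> \<le> \<alpha> / 2 * (exponential_density (1 / \<alpha>) (- x + 1 * v) + exponential_density (1 / \<alpha>) (x + (-1) * v))"
      using \<alpha> by (auto simp: exponential_density_def abs_if field_simps)
    finally show "std_normal_density v * exp (- (\<bar>v - x\<bar> / \<alpha>))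
      \<le> \<alpha> / 2 * (exponential_density (1 / \<alpha>) (- x + 1 * v) + exponential_density (1 / \<alpha>) (x + (-1) * v))" .
  qed
  also have "\<dots> = \<alpha>"
    using hb1 hb2 by (subst integral_mult_right_zero, subst Bochner_Integration.integral_add) (auto simp: has_bochner_integral_iff)
  finally show ?thesis .
qed

lemma normal_cdf_lipschitz:
  assumes "x \<le> y"
  shows "cdf std_normal_distribution y - cdf std_normal_distribution x \<le> (y - x) / 2"
proof -
  interpret real_distribution std_normal_distribution by (rule real_dist_normal_dist)
  have "cdf std_normal_distribution y - cdf std_normal_distribution x = measure std_normal_distribution {x<..y}"
  proof (cases "x < y")
    case True
    then show ?thesis by (rule cdf_diff_eq)
  qed (use assms in simp)
  also have "\<dots> = integral\<^sup>L std_normal_distribution (indicator {x<..y})" by simp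
  also have "\<dots> = (LBINT v. std_normal_density v * indicator {x<..y} v)"
    by (rule std_normal_integral) simp
  also have "\<dots> \<le> (LBINT v. (1 / 2 :: real) * indicator {x<..y} v)"
  proof (rule integral_mono)
    show "integrable lborel (\<lambda>v. std_normal_density v * indicator {x<..y} v)"
      by (intro integrable_real_mult_indicator) auto
    show "integrable lborel (\<lambda>v. (1 / 2 :: real) * indicator {x<..y} v)"
      by (intro integrable_mult_right integrable_real_indicator) (use assms in auto)
    fix v :: real
    show "std_normal_density v * indicator {x<..y} v \<le> 1 / 2 * indicator {x<..y} v"
      by (intro mult_right_mono std_normal_density_le_half) auto
  qed
  also have "\<dots> = (y - x) / 2" using assms by simp
  finally show ?thesis .
qed

text \<open>The continuous piecewise linear function that is 1 up to x, 0 from \<open>x + \<alpha>\<close> on, and linear in between.\<close>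
definition ramp :: "real \<Rightarrow> real \<Rightarrow> real \<Rightarrow> real" where
  "ramp \<alpha> x v = max 0 (min 1 (1 - (v - x) / \<alpha>))"

lemma ramp_bounds: "0 \<le> ramp \<alpha> x v" "ramp \<alpha> x v \<le> 1" by (auto simp: ramp_def)

lemma ramp_continuous: "0 < \<alpha> \<Longrightarrow> continuous_on UNIV (ramp \<alpha> x)"
  unfolding ramp_def by (intro continuous_intros) auto

lemma ramp_measurable[measurable]: "ramp \<alpha> x \<in> borel_measurable borel"
  unfolding ramp_def by measurable

lemma ramp_left: "0 < \<alpha> \<Longrightarrow> v \<le> x \<Longrightarrow> ramp \<alpha> x v = 1"
  by (simp add: ramp_def divide_nonpos_pos)

lemma ramp_right: "0 < \<alpha> \<Longrightarrow> x + \<alpha> \<le> v \<Longrightarrow> ramp \<alpha> x v = 0"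
  by (simp add: ramp_def field_simps max_def min_def)

text \<open>The ramp can change between v and \<open>v + u\<close> only if \<open>\<bar>v - x\<bar> \<le> \<bar>u\<bar> + \<alpha>\<close>. Bounding the indicator of this event by
\<open>exp ((\<bar>u\<bar> + \<alpha> - \<bar>v - x\<bar>) / \<alpha>)\<close> gives a product of a function of u and a function of v. This is what later separates the
random size u of a neighbourhood sum from the position v of W.\<close>
lemma ramp_oscillation:
  assumes \<alpha>: "0 < \<alpha>"
  shows "\<bar>ramp \<alpha> x (v + u) - ramp \<alpha> x v\<bar> \<le> 3 / \<alpha> * (\<bar>u\<bar> * exp (1 / \<alpha> * \<bar>u\<bar>)) * exp (- (\<bar>v - x\<bar> / \<alpha>))"
proof -
  have nn: "0 \<le> 3 / \<alpha> * (\<bar>u\<bar> * exp (1 / \<alpha> * \<bar>u\<bar>)) * exp (- (\<bar>v - x\<bar> / \<alpha>))" using \<alpha> by simp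
  have "\<bar>v - x\<bar> \<le> \<bar>u\<bar> + \<alpha> \<or> (v \<le> x \<and> v + u \<le> x) \<or> (x + \<alpha> \<le> v \<and> x + \<alpha> \<le> v + u)"
  proof -
    have "\<bar>v - x\<bar> \<le> \<bar>u\<bar> + \<alpha>" if "\<not> (v \<le> x \<and> v + u \<le> x)" "\<not> (x + \<alpha> \<le> v \<and> x + \<alpha> \<le> v + u)"
    proof (rule abs_leI)
      show "v - x \<le> \<bar>u\<bar> + \<alpha>"
      proof (cases "x + \<alpha> \<le> v")
        case True
        then have "v + u < x + \<alpha>" using that(2) by simp
        then show ?thesis by linarith
      qed linarith
      show "- (v - x) \<le> \<bar>u\<bar> + \<alpha>"
      proof (cases "v \<le> x")
        case True
        then have "x < v + u" using that(1) by simp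
        then show ?thesis using \<alpha> by linarith
      qed (use \<alpha> in linarith)
    qed
    then show ?thesis by blast
  qed
  then show ?thesis
  proof (elim disjE conjE)
    assume near: "\<bar>v - x\<bar> \<le> \<bar>u\<bar> + \<alpha>"
    have "\<bar>ramp \<alpha> x (v + u) - ramp \<alpha> x v\<bar> \<le> \<bar>(1 - (v + u - x) / \<alpha>) - (1 - (v - x) / \<alpha>)\<bar>"
      unfolding ramp_def by linarith
    also have "\<dots> = \<bar>u\<bar> / \<alpha>"
    proof -
      have "(1 - (v + u - x) / \<alpha>) - (1 - (v - x) / \<alpha>) = - (u / \<alpha>)"
        by (simp add: diff_divide_distrib add_divide_distrib)
      then show ?thesis using \<alpha> by (simp only: abs_minus_cancel abs_divide abs_of_pos)
    qed
    also have "\<dots> = \<bar>u\<bar> / \<alpha> * 1" by simp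
    also have "\<dots> \<le> \<bar>u\<bar> / \<alpha> * exp ((\<bar>u\<bar> + \<alpha> - \<bar>v - x\<bar>) / \<alpha>)"
      by (rule mult_left_mono) (use near \<alpha> in auto)
    also have "(\<bar>u\<bar> + \<alpha> - \<bar>v - x\<bar>) / \<alpha> = 1 + (1 / \<alpha> * \<bar>u\<bar> + - (\<bar>v - x\<bar> / \<alpha>))"
      using \<alpha> by (simp add: field_simps)
    also have "\<bar>u\<bar> / \<alpha> * exp (1 + (1 / \<alpha> * \<bar>u\<bar> + - (\<bar>v - x\<bar> / \<alpha>)))
       = exp 1 * (\<bar>u\<bar> / \<alpha> * (exp (1 / \<alpha> * \<bar>u\<bar>) * exp (- (\<bar>v - x\<bar> / \<alpha>))))"
      by (simp only: exp_add mult_ac)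
    also have "\<dots> \<le> 3 * (\<bar>u\<bar> / \<alpha> * (exp (1 / \<alpha> * \<bar>u\<bar>) * exp (- (\<bar>v - x\<bar> / \<alpha>))))"
      using \<alpha> by (intro mult_right_mono exp_le) auto
    finally show ?thesis by (simp add: mult.assoc)
  next
    assume "v \<le> x" "v + u \<le> x"
    then show ?thesis using nn \<alpha> by (simp add: ramp_left)
  next
    assume "x + \<alpha> \<le> v" "x + \<alpha> \<le> v + u"
    then show ?thesis using nn \<alpha> by (simp add: ramp_right)
  qed
qed

lemma ramp_integral_bounds:
  assumes \<mu>: "real_distribution \<mu>" and \<alpha>: "0 < \<alpha>"
  shows "cdf \<mu> x \<le> integral\<^sup>L \<mu> (ramp \<alpha> x)" "integral\<^sup>L \<mu> (ramp \<alpha> x) \<le> cdf \<mu> (x + \<alpha>)"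
proof -
  interpret real_distribution \<mu> by fact
  have int: "integrable \<mu> (ramp \<alpha> x)"
    by (rule integrable_const_bound[where B=1]) (auto simp: ramp_bounds abs_of_nonneg)
  have ind: "integrable \<mu> (indicat_real {..y})" for y by (intro integrable_real_indicator) (auto simp: less_top[symmetric])
  have "cdf \<mu> x = integral\<^sup>L \<mu> (indicat_real {..x})" by (simp add: cdf_def2)
  also have "\<dots> \<le> integral\<^sup>L \<mu> (ramp \<alpha> x)"
    by (intro integral_mono int ind) (auto simp: indicator_def ramp_left[OF \<alpha>] ramp_bounds)
  finally show "cdf \<mu> x \<le> integral\<^sup>L \<mu> (ramp \<alpha> x)" .
  have "integral\<^sup>L \<mu> (ramp \<alpha> x) \<le> integral\<^sup>L \<mu> (indicat_real {..x + \<alpha>})"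
    by (intro integral_mono int ind) (auto simp: indicator_def ramp_right[OF \<alpha>] ramp_bounds)
  also have "\<dots> = cdf \<mu> (x + \<alpha>)" by (simp add: cdf_def2)
  finally show "integral\<^sup>L \<mu> (ramp \<alpha> x) \<le> cdf \<mu> (x + \<alpha>)" .
qed

text \<open>Let e be the Kolmogorov distance. The kernel integral in the hypothesis is at most \<open>\<alpha> + 2 * e\<close>, because the superlevel
sets of the kernel are intervals and its normal integral is at most \<open>\<alpha>\<close>. Comparing indicators with ramps then gives
\<open>e \<le> \<alpha> / 2 + d + (\<alpha> + 2 * e) / 25\<close>, in which e on the right has a coefficient below 1.\<close>
lemma kolmogorov_by_smoothing:
  assumes \<mu>: "real_distribution \<mu>" and \<alpha>: "0 < \<alpha>" and d: "0 \<le> d"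
    and smooth: "\<And>x. \<bar>integral\<^sup>L \<mu> (ramp \<alpha> x) - integral\<^sup>L std_normal_distribution (ramp \<alpha> x)\<bar>
       \<le> d + (\<integral>v. exp (- (\<bar>v - x\<bar> / \<alpha>)) \<partial>\<mu>) / 25"
  shows "\<bar>cdf \<mu> x - cdf std_normal_distribution x\<bar> \<le> \<alpha> + 2 * d"
proof -
  note \<nu> = real_dist_normal_dist
  interpret \<mu>: real_distribution \<mu> by fact
  interpret \<nu>: real_distribution std_normal_distribution by (rule \<nu>)
  define D where "D x = \<bar>cdf \<mu> x - cdf std_normal_distribution x\<bar>" for x
  have D1: "D x \<le> 1" for x
    unfolding D_def using \<mu>.cdf_nonneg[of x] \<nu>.cdf_nonneg[of x] \<mu>.cdf_bounded_prob[of x] \<nu>.cdf_bounded_prob[of x]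
    by (simp add: abs_le_iff)
  define e where "e = (SUP x. D x)"
  have bdd: "bdd_above (range D)" using D1 by (auto intro!: bdd_aboveI[of _ 1])
  have De: "D x \<le> e" for x unfolding e_def by (rule cSUP_upper[OF _ bdd]) auto
  have err: "\<bar>integral\<^sup>L \<mu> (ramp \<alpha> x) - integral\<^sup>L std_normal_distribution (ramp \<alpha> x)\<bar> \<le> d + (\<alpha> + 2 * e) / 25" for x
  proof -
    have "(\<integral>v. exp (- (\<bar>v - x\<bar> / \<alpha>)) \<partial>\<mu>) \<le> \<alpha> + 2 * e"
      using exp_kernel_close[OF \<mu> \<nu> De[unfolded D_def] \<alpha>, of x] exp_kernel_normal_le[OF \<alpha>, of x] by linarith
    then have "d + (\<integral>v. exp (- (\<bar>v - x\<bar> / \<alpha>)) \<partial>\<mu>) / 25 \<le> d + (\<alpha> + 2 * e) / 25"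
      by (intro add_left_mono divide_right_mono) auto
    then show ?thesis by (rule order_trans[OF smooth])
  qed
  have "D x \<le> \<alpha> / 2 + (d + (\<alpha> + 2 * e) / 25)" for x
  proof -
    have "cdf \<mu> x \<le> cdf std_normal_distribution (x + \<alpha>) + (d + (\<alpha> + 2 * e) / 25)"
      using ramp_integral_bounds(1)[OF \<mu> \<alpha>, of x] ramp_integral_bounds(2)[OF \<nu> \<alpha>, of x] err[of x] by linarith
    moreover have "cdf std_normal_distribution (x - \<alpha>) - (d + (\<alpha> + 2 * e) / 25) \<le> cdf \<mu> x"
      using ramp_integral_bounds(2)[OF \<mu> \<alpha>, of "x - \<alpha>"] ramp_integral_bounds(1)[OF \<nu> \<alpha>, of "x - \<alpha>"] err[of "x - \<alpha>"] by simp
    ultimately show ?thesis unfolding D_def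
      using normal_cdf_lipschitz[of x "x + \<alpha>"] normal_cdf_lipschitz[of "x - \<alpha>" x] \<alpha> by (simp add: abs_le_iff)
  qed
  then have "e \<le> \<alpha> / 2 + (d + (\<alpha> + 2 * e) / 25)" unfolding e_def by (intro cSUP_least) auto
  then have "23 * e \<le> 27 / 2 * \<alpha> + 25 * d" by (simp add: field_simps)
  then have "e \<le> \<alpha> + 2 * d" using \<alpha> d by linarith
  then show ?thesis using De[of x] by (simp add: D_def)
qed

text \<open>The superlevel sets of \<open>exp (- z * v)\<close> restricted to \<open>v > 0\<close> are intervals, and completing the square
evaluates the normal integral.\<close>
lemma laplace_upper_half_close:
  assumes \<mu>: "real_distribution \<mu>" and close: "\<And>x. \<bar>cdf \<mu> x - cdf std_normal_distribution x\<bar> \<le> e" and z: "0 \<le> z"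
  shows "\<bar>(\<integral>v. exp (- (z * v)) * indicator {0<..} v \<partial>\<mu>) - exp (z\<^sup>2 / 2) * upper_tail z\<bar> \<le> 2 * e"
proof -
  note \<nu> = real_dist_normal_dist
  have e0: "0 \<le> e" using close[of 0] by linarith
  have "(\<integral>v. exp (- (z * v)) * indicator {0<..} v \<partial>std_normal_distribution)
     = (LBINT v. std_normal_density v * (exp (- (z * v)) * indicator {0<..} v))"
    by (rule std_normal_integral) measurable
  also have "\<dots> = (LBINT v. exp (z\<^sup>2 / 2) * (std_normal_density (z + v) * indicator {0<..} v))"
  proof (intro Bochner_Integration.integral_cong refl)
    fix v
    have "exp (z\<^sup>2 / 2) * exp (- z\<^sup>2 / 2) = 1" by (simp flip: exp_add)
    then have "exp (z\<^sup>2 / 2) * std_normal_density (z + v) = exp (- (z * v)) * std_normal_density v"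
      unfolding std_normal_density_shift by (simp only: mult.assoc[symmetric] mult_1_left)
    note eq = this
    have "std_normal_density v * (exp (- (z * v)) * indicator {0<..} v)
       = (exp (- (z * v)) * std_normal_density v) * indicator {0<..} v" by (simp only: mult_ac)
    also have "\<dots> = (exp (z\<^sup>2 / 2) * std_normal_density (z + v)) * indicator {0<..} v" by (simp only: eq)
    finally show "std_normal_density v * (exp (- (z * v)) * indicator {0<..} v)
       = exp (z\<^sup>2 / 2) * (std_normal_density (z + v) * indicator {0<..} v)" by (simp only: mult.assoc)
  qed
  also have "\<dots> = exp (z\<^sup>2 / 2) * upper_tail z" unfolding upper_tail_shift by simp
  finally have normal: "(\<integral>v. exp (- (z * v)) * indicator {0<..} v \<partial>std_normal_distribution) = exp (z\<^sup>2 / 2) * upper_tail z" .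
  have "\<bar>(\<integral>v. exp (- (z * v)) * indicator {0<..} v \<partial>\<mu>) - (\<integral>v. exp (- (z * v)) * indicator {0<..} v \<partial>std_normal_distribution)\<bar> \<le> 2 * e"
  proof (rule layer_cake_comparison[OF \<mu> \<nu>])
    show "0 \<le> exp (- (z * x)) * indicator {0<..} x" for x by simp
    show "exp (- (z * x)) * indicator {0<..} x \<le> 1" for x
      using z by (cases "0 < x") auto
    fix s :: real assume s: "0 < s" "s < 1"
    show "\<bar>measure \<mu> {v. s < exp (- (z * v)) * indicator {0<..} v}
        - measure std_normal_distribution {v. s < exp (- (z * v)) * indicator {0<..} v}\<bar> \<le> 2 * e"
    proof (cases "z = 0")
      case True
      have "s < exp (- (z * v)) * indicator {0<..} v \<longleftrightarrow> 0 < v" for v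
        using s True by (cases "0 < v") simp_all
      then have "{v. s < exp (- (z * v)) * indicator {0<..} v} = {0<..}" by (simp add: greaterThan_def)
      then show ?thesis using interval_measure_close(2)[OF \<mu> \<nu> close, of 0] e0 by simp
    next
      case False
      then have zp: "0 < z" using z by simp
      have "s < exp (- (z * v)) \<longleftrightarrow> v < ln (1 / s) / z" for v
      proof -
        have "s < exp (- (z * v)) \<longleftrightarrow> ln s < - (z * v)"
          using s ln_less_cancel_iff[of s "exp (- (z * v))"] by simp
        moreover have "v < ln (1 / s) / z \<longleftrightarrow> z * v < - ln s"
        proof -
          have "ln (1 / s) = - ln s" using s by (simp add: ln_div)
          then show ?thesis using pos_less_divide_eq[OF zp, of v "ln (1 / s)"] by (simp only: mult.commute)
        qed
        ultimately show ?thesis by auto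
      qed
      then have "s < exp (- (z * v)) * indicator {0<..} v \<longleftrightarrow> v \<in> {0<..<ln (1 / s) / z}" for v
        using s by (cases "0 < v") simp_all
      then have "{v. s < exp (- (z * v)) * indicator {0<..} v} = {0<..<ln (1 / s) / z}" by blast
      then show ?thesis using interval_measure_close(1)[OF \<mu> \<nu> close] by simp
    qed
  qed measurable
  then show ?thesis unfolding normal .
qed

section \<open>Local dependence and independence of local functions\<close>

text \<open>A locally dependent field in which every index lies in its own neighbourhood. By (LD1) a centred variable whose
index violates this vanishes almost surely, so the general case reduces to this one by discarding variables. The
condition makes i a member of \<open>nbhd J B j\<close> whenever \<open>i \<in> B j\<close>. The number \<kappa> is only an upper bound for the
sizes of the sets \<open>nbhd J B i\<close>, so that it need not change when variables are discarded.\<close>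
locale dependent_field = prob_space M for M :: "'a measure" +
  fixes J :: "'i set" and X :: "'i \<Rightarrow> 'a \<Rightarrow> real" and A B :: "'i \<Rightarrow> 'i set"
    and a b :: real and \<kappa> :: nat
  assumes finite_J: "finite J"
    and X_meas: "i \<in> J \<Longrightarrow> X i \<in> borel_measurable M"
    and X_mean: "i \<in> J \<Longrightarrow> expectation (X i) = 0"
    and self_in: "i \<in> J \<Longrightarrow> i \<in> A i"
    and LD1: "LD1 M J X A"
    and LD2: "LD2 M J X A B"
    and a_ge_1: "1 \<le> a" and b_ge_1: "1 \<le> b"
    and exp_integrable: "i \<in> J \<Longrightarrow> integrable M (\<lambda>\<omega>. exp (a * (\<Sum>j\<in>B i. \<bar>X j \<omega>\<bar>)))"
    and exp_le: "i \<in> J \<Longrightarrow> expectation (\<lambda>\<omega>. exp (a * (\<Sum>j\<in>B i. \<bar>X j \<omega>\<bar>))) \<le> b"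
    and degree: "i \<in> J \<Longrightarrow> card (nbhd J B i) \<le> \<kappa>"
    and unit_variance: "variance (\<lambda>\<omega>. \<Sum>i\<in>J. X i \<omega>) = 1"
begin

lemma J_ne: "J \<noteq> {}"
  using unit_variance by auto

definition "W \<omega> = (\<Sum>i\<in>J. X i \<omega>)"
definition "L \<omega> = (\<Sum>i\<in>J. \<bar>X i \<omega>\<bar>)"
definition "S i \<omega> = (\<Sum>j\<in>B i. \<bar>X j \<omega>\<bar>)"
definition "Y i \<omega> = (\<Sum>j\<in>A i. X j \<omega>)"
definition "Z i \<omega> = (\<Sum>j\<in>B i. X j \<omega>)"
text \<open>This is \<open>\<theta>\<^sup>2\<close>; \<open>rho\<close> is the error rate in terms of which all estimates are stated.\<close>
definition "v = b * real (card J) / a\<^sup>2"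
definition "rho = real \<kappa> * (1 + v) / a"

text \<open>The \<sigma>-algebra generated by the \<open>X j\<close> with \<open>j \<in> T\<close>. A random variable that is measurable with respect to it is a
function of \<open>X\<^sub>T\<close>; measurability in this form is preserved by arithmetic and monotone in T, so no factorisation through
\<open>X\<^sub>T\<close> has to be written down.\<close>
definition loc :: "'i set \<Rightarrow> 'a measure" where
  "loc T = vimage_algebra (space M) (\<lambda>\<omega>. \<lambda>i\<in>T. X i \<omega>) (PiM T (\<lambda>_. borel))"

lemma A_sub_B: "i \<in> J \<Longrightarrow> A i \<subseteq> B i" and B_sub_J: "i \<in> J \<Longrightarrow> B i \<subseteq> J"
  using LD2 by (auto simp: LD2_def)

lemma A_sub_J: "i \<in> J \<Longrightarrow> A i \<subseteq> J" using A_sub_B B_sub_J by blast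

lemma self_in_B: "i \<in> J \<Longrightarrow> i \<in> B i" using self_in A_sub_B by blast

lemma finite_B: "i \<in> J \<Longrightarrow> finite (B i)"
  using B_sub_J finite_J finite_subset by metis

lemma space_loc[simp]: "space (loc T) = space M" by (simp add: loc_def)

lemma X_loc[measurable]: "j \<in> T \<Longrightarrow> X j \<in> borel_measurable (loc T)"
proof -
  assume j: "j \<in> T"
  have "(\<lambda>\<omega>. \<lambda>i\<in>T. X i \<omega>) \<in> measurable (loc T) (PiM T (\<lambda>_. borel))"
    unfolding loc_def by (rule measurable_vimage_algebra1) (auto simp: space_PiM)
  then have "(\<lambda>\<omega>. (\<lambda>i\<in>T. X i \<omega>) j) \<in> measurable (loc T) borel"
    by (rule measurable_compose[OF _ measurable_component_singleton[OF j]])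
  then show ?thesis using j by simp
qed

lemma loc_le:
  assumes "space N = space M" "\<And>j. j \<in> T \<Longrightarrow> X j \<in> borel_measurable N" "F \<in> borel_measurable (loc T)"
  shows "F \<in> borel_measurable N"
proof -
  have "(\<lambda>\<omega>. \<lambda>i\<in>T. X i \<omega>) \<in> measurable N (PiM T (\<lambda>_. borel))"
    by (rule measurable_restrict) (use assms in auto)
  then have "sets (loc T) \<subseteq> sets N"
    unfolding loc_def sets_vimage_algebra assms(1)[symmetric]
    by (intro sets.sigma_sets_subset) (auto intro: measurable_sets)
  then show ?thesis using assms(1,3) by (auto simp: measurable_def)
qed

lemma loc_meas: "T \<subseteq> J \<Longrightarrow> F \<in> borel_measurable (loc T) \<Longrightarrow> F \<in> borel_measurable M"
  by (rule loc_le[of M T]) (auto intro: X_meas)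

lemma loc_mono: "T \<subseteq> T' \<Longrightarrow> F \<in> borel_measurable (loc T) \<Longrightarrow> F \<in> borel_measurable (loc T')"
  by (rule loc_le[of "loc T'" T]) (auto intro: X_loc)

lemma indep_product:
  assumes ind: "indep_subfamilies M X T U"
    and F: "F \<in> borel_measurable (loc T)" "integrable M F"
    and G: "G \<in> borel_measurable (loc U)" "integrable M G"
  shows "integrable M (\<lambda>\<omega>. F \<omega> * G \<omega>)"
    and "expectation (\<lambda>\<omega>. F \<omega> * G \<omega>) = expectation F * expectation (G :: 'a \<Rightarrow> real)"
proof -
  have H1: "indep_set (sets (loc T)) (sets (loc U))"
    using ind by (simp add: indep_subfamilies_def indep_var_eq loc_def sets_vimage_algebra)
  have H2: "sigma_sets (space M) {F -` C \<inter> space M | C. C \<in> sets borel} \<subseteq> sets (loc T)"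
    unfolding space_loc[of T, symmetric]
    by (intro sets.sigma_sets_subset) (use measurable_sets[OF F(1)] in auto)
  have H3: "sigma_sets (space M) {G -` C \<inter> space M | C. C \<in> sets borel} \<subseteq> sets (loc U)"
    unfolding space_loc[of U, symmetric]
    by (intro sets.sigma_sets_subset) (use measurable_sets[OF G(1)] in auto)
  have "indep_set (sigma_sets (space M) {F -` C \<inter> space M | C. C \<in> sets borel})
      (sigma_sets (space M) {G -` C \<inter> space M | C. C \<in> sets borel})"
    unfolding indep_set_def
    by (rule indep_sets_mono_sets[OF H1[unfolded indep_set_def]]) (use H2 H3 in \<open>auto split: bool.split\<close>)
  then have "indep_var borel F borel G"
    using F G by (simp add: indep_var_eq borel_measurable_integrable)
  then show "integrable M (\<lambda>\<omega>. F \<omega> * G \<omega>)"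
    "expectation (\<lambda>\<omega>. F \<omega> * G \<omega>) = expectation F * expectation G"
    using F G by (auto intro: indep_var_integrable indep_var_lebesgue_integral)
qed

section \<open>Counting neighbours\<close>

text \<open>The indices j for which a function of \<open>X\<^sub>A\<close> with \<open>A = A j\<close> may depend on functions of \<open>X\<^sub>A\<close> with \<open>A = A i\<close>.\<close>
definition "D i = {j \<in> J. A j \<inter> B i \<noteq> {}}"

lemma D_sub: "D i \<subseteq> J" and finite_D: "finite (D i)" using finite_J by (auto simp: D_def)

lemma card_le_kappa: "i \<in> J \<Longrightarrow> T \<subseteq> nbhd J B i \<Longrightarrow> card T \<le> \<kappa>"
  using degree[of i] card_mono[of "nbhd J B i" T] finite_J by (auto simp: nbhd_def)

lemma card_D: "i \<in> J \<Longrightarrow> card (D i) \<le> \<kappa>"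
  by (rule card_le_kappa) (use A_sub_B in \<open>auto simp: D_def nbhd_def\<close>)

lemma card_D_inv: "j \<in> J \<Longrightarrow> card {i \<in> J. j \<in> D i} \<le> \<kappa>"
  by (rule card_le_kappa) (use A_sub_B in \<open>auto simp: D_def nbhd_def\<close>)

lemma card_B: "i \<in> J \<Longrightarrow> card (B i) \<le> \<kappa>"
  by (rule card_le_kappa) (use self_in_B B_sub_J in \<open>auto simp: nbhd_def\<close>)

lemma card_B_inv: "j \<in> J \<Longrightarrow> card {i \<in> J. j \<in> B i} \<le> \<kappa>"
  by (rule card_le_kappa) (use self_in_B in \<open>auto simp: nbhd_def\<close>)

lemma card_B_pos: "i \<in> J \<Longrightarrow> 0 < card (B i)"
  using self_in_B finite_B card_gt_0_iff by blast

lemma kappa_pos: "1 \<le> \<kappa>"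
  using J_ne card_B card_B_pos by (metis One_nat_def Suc_leI all_not_in_conv less_le_trans)

lemma card_J_pos: "1 \<le> card J" using J_ne finite_J by (simp add: Suc_leI card_gt_0_iff)

text \<open>Double counting: each j occurs in at most \<kappa> of the sets \<open>R i\<close>.\<close>
lemma sum_overlap_le:
  fixes f :: "'i \<Rightarrow> real"
  assumes "\<And>i. i \<in> J \<Longrightarrow> R i \<subseteq> J" "\<And>j. j \<in> J \<Longrightarrow> card {i \<in> J. j \<in> R i} \<le> \<kappa>" "\<And>j. j \<in> J \<Longrightarrow> 0 \<le> f j"
  shows "(\<Sum>i\<in>J. \<Sum>j\<in>R i. f j) \<le> real \<kappa> * (\<Sum>j\<in>J. f j)"
proof -
  have "(\<Sum>i\<in>J. \<Sum>j\<in>R i. f j) = (\<Sum>i\<in>J. \<Sum>j | j \<in> J \<and> j \<in> R i. f j)"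
    by (intro sum.cong refl arg_cong2[where f=sum]) (use assms(1) in auto)
  also have "\<dots> = (\<Sum>j\<in>J. \<Sum>i | i \<in> J \<and> j \<in> R i. f j)"
    by (rule sum.swap_restrict) (use finite_J in auto)
  also have "\<dots> = (\<Sum>j\<in>J. real (card {i \<in> J. j \<in> R i}) * f j)" by simp
  also have "\<dots> \<le> (\<Sum>j\<in>J. real \<kappa> * f j)"
    by (intro sum_mono mult_right_mono) (use assms in auto)
  finally show ?thesis by (simp add: sum_distrib_left)
qed

section \<open>A crude bound for the moment generating function\<close>

lemma abs_X_le_S: "i \<in> J \<Longrightarrow> j \<in> B i \<Longrightarrow> \<bar>X j \<omega>\<bar> \<le> S i \<omega>"
  unfolding S_def by (rule member_le_sum) (auto intro: finite_B)

lemma S_nonneg: "0 \<le> S i \<omega>" unfolding S_def by (simp add: sum_nonneg)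

lemma abs_Z_le_S: "\<bar>Z i \<omega>\<bar> \<le> S i \<omega>" unfolding S_def Z_def by (rule sum_abs)

lemma abs_Y_le_S: "i \<in> J \<Longrightarrow> \<bar>Y i \<omega>\<bar> \<le> S i \<omega>"
proof -
  assume i: "i \<in> J"
  have "\<bar>Y i \<omega>\<bar> \<le> (\<Sum>j\<in>A i. \<bar>X j \<omega>\<bar>)" unfolding Y_def by (rule sum_abs)
  also have "\<dots> \<le> S i \<omega>" unfolding S_def
    by (rule sum_mono2) (use i finite_B A_sub_B in auto)
  finally show ?thesis .
qed

lemma L_nonneg: "0 \<le> L \<omega>" unfolding L_def by (simp add: sum_nonneg)

lemma abs_W_le_L: "\<bar>W \<omega>\<bar> \<le> L \<omega>" unfolding W_def L_def by (rule sum_abs)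

lemma W_minus_Z: "i \<in> J \<Longrightarrow> W \<omega> - Z i \<omega> = (\<Sum>j\<in>J - B i. X j \<omega>)"
  unfolding W_def Z_def using sum.subset_diff[OF B_sub_J finite_J, of i "\<lambda>j. X j \<omega>"] by simp

lemma W_minus_Y: "i \<in> J \<Longrightarrow> W \<omega> - Y i \<omega> = (\<Sum>j\<in>J - A i. X j \<omega>)"
  unfolding W_def Y_def using sum.subset_diff[OF A_sub_J finite_J, of i "\<lambda>j. X j \<omega>"] by simp

lemma abs_sub_sum_le_L: "T \<subseteq> J \<Longrightarrow> \<bar>\<Sum>j\<in>T. X j \<omega>\<bar> \<le> L \<omega>"
proof -
  assume T: "T \<subseteq> J"
  have "\<bar>\<Sum>j\<in>T. X j \<omega>\<bar> \<le> (\<Sum>j\<in>T. \<bar>X j \<omega>\<bar>)" by (rule sum_abs)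
  also have "\<dots> \<le> L \<omega>" unfolding L_def by (rule sum_mono2) (use T finite_J in auto)
  finally show ?thesis .
qed

lemma W_meas[measurable]: "W \<in> borel_measurable M"
  unfolding W_def by (rule borel_measurable_sum) (rule X_meas)

lemma L_meas[measurable]: "L \<in> borel_measurable M"
  unfolding L_def using X_meas by (intro borel_measurable_sum borel_measurable_abs)

lemma S_meas: "i \<in> J \<Longrightarrow> S i \<in> borel_measurable M"
  unfolding S_def using X_meas B_sub_J by (intro borel_measurable_sum borel_measurable_abs) blast

lemma Z_meas: "i \<in> J \<Longrightarrow> Z i \<in> borel_measurable M"
  unfolding Z_def using X_meas B_sub_J by (intro borel_measurable_sum) blast

lemma Y_loc: "i \<in> J \<Longrightarrow> Y i \<in> borel_measurable (loc (A i))"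
  unfolding Y_def by (intro borel_measurable_sum X_loc)

lemma Y_meas: "i \<in> J \<Longrightarrow> Y i \<in> borel_measurable M"
  by (rule loc_meas[OF A_sub_J Y_loc])

lemma exp_S_integrable: "i \<in> J \<Longrightarrow> integrable M (\<lambda>\<omega>. exp (a * S i \<omega>))"
  and exp_S_le: "i \<in> J \<Longrightarrow> expectation (\<lambda>\<omega>. exp (a * S i \<omega>)) \<le> b"
  using exp_integrable exp_le by (auto simp: S_def)

lemma integrable_le_exp_S:
  assumes "i \<in> J" "F \<in> borel_measurable M" "\<And>\<omega>. \<omega> \<in> space M \<Longrightarrow> \<bar>F \<omega>\<bar> \<le> C * exp (a * S i \<omega>)"
  shows "integrable M F"
  by (rule Bochner_Integration.integrable_bound[OF integrable_mult_right[OF exp_S_integrable[OF assms(1)], of C] assms(2)])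
     (use assms(3) in \<open>auto intro!: AE_I2 order_trans[OF _ abs_ge_self]\<close>)

text \<open>If no two elements of I are neighbours, each \<open>X x\<close> is independent of the remaining \<open>X i\<close>, \<open>i \<in> I\<close>, by (LD1), and the
factors can be split off one by one.\<close>
lemma indep_product_class:
  assumes "I \<subseteq> J" and "\<And>i j. i \<in> I \<Longrightarrow> j \<in> I \<Longrightarrow> i \<noteq> j \<Longrightarrow> j \<notin> A i"
    and "\<And>i. i \<in> I \<Longrightarrow> g i \<in> borel_measurable borel"
    and "\<And>i. i \<in> I \<Longrightarrow> integrable M (\<lambda>\<omega>. g i (X i \<omega>) :: real)"
  shows "integrable M (\<lambda>\<omega>. \<Prod>i\<in>I. g i (X i \<omega>)) \<and>
    expectation (\<lambda>\<omega>. \<Prod>i\<in>I. g i (X i \<omega>)) = (\<Prod>i\<in>I. expectation (\<lambda>\<omega>. g i (X i \<omega>)))"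
  using finite_subset[OF assms(1) finite_J] assms
proof (induction I rule: finite_induct)
  case empty
  then show ?case using prob_space by simp
next
  case (insert x F)
  have IH: "integrable M (\<lambda>\<omega>. \<Prod>i\<in>F. g i (X i \<omega>))"
    "expectation (\<lambda>\<omega>. \<Prod>i\<in>F. g i (X i \<omega>)) = (\<Prod>i\<in>F. expectation (\<lambda>\<omega>. g i (X i \<omega>)))"
    using insert by auto
  have sub: "F \<subseteq> J - A x" using insert.hyps insert.prems by auto
  have ind: "indep_subfamilies M X {x} (J - A x)" using LD1 insert.prems by (auto simp: LD1_def)
  have g1: "(\<lambda>\<omega>. g x (X x \<omega>)) \<in> borel_measurable (loc {x})"
    by (rule measurable_compose[OF X_loc insert.prems(3)]) auto
  have g2: "(\<lambda>\<omega>. \<Prod>i\<in>F. g i (X i \<omega>)) \<in> borel_measurable (loc (J - A x))"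
    using sub insert.prems(3) by (intro borel_measurable_prod measurable_compose[OF X_loc]) auto
  show ?case
    using insert.hyps indep_product[OF ind g1 _ g2] IH insert.prems(4) by auto
qed

text \<open>Colour J with \<kappa> colours so that neighbours get different colours. By Jensen's inequality the exponential of the sum is at
most the average over the colours q of the products of \<open>exp (\<kappa> * g i (X i))\<close> over the class of q, and the
expectation of such a product factorises. The normalisation to the bound 1 lets constants be absorbed into g.\<close>
lemma exp_sum_le_one:
  assumes g: "\<And>i. i \<in> J \<Longrightarrow> g i \<in> borel_measurable borel"
    and int: "\<And>i. i \<in> J \<Longrightarrow> integrable M (\<lambda>\<omega>. exp (real \<kappa> * g i (X i \<omega>)))"
    and le: "\<And>i. i \<in> J \<Longrightarrow> expectation (\<lambda>\<omega>. exp (real \<kappa> * g i (X i \<omega>))) \<le> 1"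
  shows "integrable M (\<lambda>\<omega>. exp (\<Sum>i\<in>J. g i (X i \<omega>)))"
    and "expectation (\<lambda>\<omega>. exp (\<Sum>i\<in>J. g i (X i \<omega>))) \<le> 1"
proof -
  define adj where "adj = (\<lambda>i j. j \<in> A i \<and> i \<in> J \<or> i \<in> A j \<and> j \<in> J)"
  have "\<exists>c::'i \<Rightarrow> nat. (\<forall>i\<in>J. c i < \<kappa>) \<and> (\<forall>i\<in>J. \<forall>j\<in>J. i \<noteq> j \<longrightarrow> adj i j \<longrightarrow> c i \<noteq> c j)"
  proof (rule greedy_colouring[OF finite_J])
    fix i assume "i \<in> J"
    then show "card {j \<in> J. adj i j \<or> j = i} \<le> \<kappa>"
      by (rule card_le_kappa) (use A_sub_B self_in_B \<open>i \<in> J\<close> in \<open>auto simp: adj_def nbhd_def\<close>)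
  qed (auto simp: adj_def)
  then obtain c :: "'i \<Rightarrow> nat" where c: "\<And>i. i \<in> J \<Longrightarrow> c i < \<kappa>"
    "\<And>i j. i \<in> J \<Longrightarrow> j \<in> J \<Longrightarrow> i \<noteq> j \<Longrightarrow> j \<in> A i \<Longrightarrow> c i \<noteq> c j"
    by (auto simp: adj_def)
  define I where "I q = {i \<in> J. c i = q}" for q
  have prod: "integrable M (\<lambda>\<omega>. \<Prod>i\<in>I q. exp (real \<kappa> * g i (X i \<omega>))) \<and>
    expectation (\<lambda>\<omega>. \<Prod>i\<in>I q. exp (real \<kappa> * g i (X i \<omega>))) = (\<Prod>i\<in>I q. expectation (\<lambda>\<omega>. exp (real \<kappa> * g i (X i \<omega>))))" for q
    by (rule indep_product_class[where g="\<lambda>i x. exp (real \<kappa> * g i x)"])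
       (use c(2) g int in \<open>fastforce simp: I_def\<close>)+
  have prod_le: "expectation (\<lambda>\<omega>. \<Prod>i\<in>I q. exp (real \<kappa> * g i (X i \<omega>))) \<le> 1" for q
    using prod[of q] le by (auto intro!: prod_le_1 simp: I_def)
  have pt: "exp (\<Sum>i\<in>J. g i (X i \<omega>)) \<le> (\<Sum>q<\<kappa>. \<Prod>i\<in>I q. exp (real \<kappa> * g i (X i \<omega>))) / real \<kappa>" for \<omega>
  proof -
    have "(\<Sum>i\<in>J. g i (X i \<omega>)) = (\<Sum>q<\<kappa>. \<Sum>i\<in>I q. g i (X i \<omega>))"
      unfolding I_def by (rule sum.group[symmetric]) (use finite_J c in auto)
    moreover have "exp (\<Sum>q<\<kappa>. \<Sum>i\<in>I q. g i (X i \<omega>)) \<le> (\<Sum>q<\<kappa>. exp (real (card {..<\<kappa>}) * (\<Sum>i\<in>I q. g i (X i \<omega>)))) / real (card {..<\<kappa>})"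
      by (rule exp_sum_le_average) (use kappa_pos in \<open>auto simp: lessThan_empty_iff\<close>)
    ultimately show ?thesis
      using finite_J by (simp add: sum_distrib_left exp_sum I_def)
  qed
  have dom: "integrable M (\<lambda>\<omega>. (\<Sum>q<\<kappa>. \<Prod>i\<in>I q. exp (real \<kappa> * g i (X i \<omega>))) / real \<kappa>)"
    using prod by (intro integrable_divide integrable_sum) auto
  show int: "integrable M (\<lambda>\<omega>. exp (\<Sum>i\<in>J. g i (X i \<omega>)))"
  proof (rule Bochner_Integration.integrable_bound[OF dom])
    have "(\<lambda>\<omega>. \<Sum>i\<in>J. g i (X i \<omega>)) \<in> borel_measurable M"
      by (intro borel_measurable_sum measurable_compose[OF X_meas]) (use g in auto)
    then show "(\<lambda>\<omega>. exp (\<Sum>i\<in>J. g i (X i \<omega>))) \<in> borel_measurable M" by measurable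
    show "AE \<omega> in M. norm (exp (\<Sum>i\<in>J. g i (X i \<omega>)))
        \<le> norm ((\<Sum>q<\<kappa>. \<Prod>i\<in>I q. exp (real \<kappa> * g i (X i \<omega>))) / real \<kappa>)"
      using order_trans[OF pt abs_ge_self] by (intro AE_I2) (simp only: real_norm_def abs_exp_cancel)
  qed
  have "expectation (\<lambda>\<omega>. exp (\<Sum>i\<in>J. g i (X i \<omega>)))
      \<le> expectation (\<lambda>\<omega>. (\<Sum>q<\<kappa>. \<Prod>i\<in>I q. exp (real \<kappa> * g i (X i \<omega>))) / real \<kappa>)"
    by (intro integral_mono int dom pt)
  also have "\<dots> = (\<Sum>q<\<kappa>. expectation (\<lambda>\<omega>. \<Prod>i\<in>I q. exp (real \<kappa> * g i (X i \<omega>)))) / real \<kappa>"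
    using prod by (subst integral_divide_zero, subst Bochner_Integration.integral_sum) auto
  also have "\<dots> \<le> (\<Sum>q<\<kappa>. 1) / real \<kappa>"
    by (intro divide_right_mono sum_mono prod_le) auto
  also have "\<dots> = 1" using kappa_pos by simp
  finally show "expectation (\<lambda>\<omega>. exp (\<Sum>i\<in>J. g i (X i \<omega>))) \<le> 1" .
qed

lemma exp_L_integrable:
  assumes "real \<kappa> * u \<le> a" "0 \<le> u"
  shows "integrable M (\<lambda>\<omega>. exp (u * L \<omega>))"
proof -
  \<comment> \<open>The constant l normalises the expectations of \<open>exp (\<kappa> * (u * \<bar>X i\<bar> - l))\<close> to at most 1.\<close>
  define l where "l = ln b / real \<kappa>"
  have kl: "real \<kappa> * l = ln b" using kappa_pos by (simp add: l_def)
  have bp: "b > 0" using b_ge_1 by simp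
  have eq: "exp (real \<kappa> * (u * \<bar>x\<bar> - l)) = exp (real \<kappa> * u * \<bar>x\<bar>) / b" for x
    using bp by (simp add: right_diff_distrib kl exp_diff mult.assoc)
  have le: "exp (real \<kappa> * u * \<bar>X i \<omega>\<bar>) \<le> exp (a * S i \<omega>)" if "i \<in> J" for i \<omega>
    using assms abs_X_le_S[OF that self_in_B[OF that]] a_ge_1 by (auto intro!: mult_mono)
  have m: "(\<lambda>\<omega>. exp (real \<kappa> * u * \<bar>X i \<omega>\<bar>)) \<in> borel_measurable M" if "i \<in> J" for i
    using X_meas[OF that] by measurable
  have i: "integrable M (\<lambda>\<omega>. exp (real \<kappa> * u * \<bar>X i \<omega>\<bar>))" if "i \<in> J" for i
    by (rule integrable_le_exp_S[OF that m[OF that], of 1]) (use le[OF that] in auto)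
  have "integrable M (\<lambda>\<omega>. exp (\<Sum>i\<in>J. (u * \<bar>X i \<omega>\<bar> - l)))"
  proof (rule exp_sum_le_one(1)[where g="\<lambda>_ x. u * \<bar>x\<bar> - l"])
    fix i assume iJ: "i \<in> J"
    show "integrable M (\<lambda>\<omega>. exp (real \<kappa> * (u * \<bar>X i \<omega>\<bar> - l)))" unfolding eq using i[OF iJ] by simp
    have "expectation (\<lambda>\<omega>. exp (real \<kappa> * u * \<bar>X i \<omega>\<bar>)) \<le> expectation (\<lambda>\<omega>. exp (a * S i \<omega>))"
      by (intro integral_mono i exp_S_integrable iJ le)
    also have "\<dots> \<le> b" by (rule exp_S_le[OF iJ])
    finally show "expectation (\<lambda>\<omega>. exp (real \<kappa> * (u * \<bar>X i \<omega>\<bar> - l))) \<le> 1"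
      unfolding eq using bp by simp
  qed auto
  moreover have "exp (\<Sum>i\<in>J. (u * \<bar>X i \<omega>\<bar> - l)) = exp (u * L \<omega>) * exp (- (real (card J) * l))" for \<omega>
    by (simp add: L_def sum_subtractf sum_distrib_left flip: exp_add)
  ultimately show ?thesis by simp
qed

text \<open>A second-order expansion of each \<open>exp (\<kappa> * u * X i)\<close>, in which the linear term has mean zero, combined with the
colouring bound.\<close>
lemma exp_W_le:
  assumes u: "real \<kappa> * \<bar>u\<bar> \<le> a / 2"
  shows "expectation (\<lambda>\<omega>. exp (u * W \<omega>)) \<le> exp (8 * real \<kappa> * u\<^sup>2 * v)"
proof -
  define l where "l = 8 * real \<kappa> * u\<^sup>2 * b / a\<^sup>2"
  define w where "w = real \<kappa> * u"
  have w: "\<bar>w\<bar> \<le> a / 2" using u by (simp add: w_def abs_mult)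
  have ap: "a > 0" using a_ge_1 by simp
  have eq: "exp (real \<kappa> * (u * x - l)) = exp (w * x) * exp (- (real \<kappa> * l))" for x
    by (simp add: w_def algebra_simps flip: exp_add)
  have XS: "\<bar>X i \<omega>\<bar> \<le> S i \<omega>" if "i \<in> J" for i \<omega> using abs_X_le_S[OF that self_in_B[OF that]] .
  have pt: "exp (w * X i \<omega>) \<le> 1 + w * X i \<omega> + 8 * w\<^sup>2 / a\<^sup>2 * exp (a * S i \<omega>)" if "i \<in> J" for i \<omega>
  proof -
    define x where "x = X i \<omega>"
    have "exp (w * x) \<le> 1 + w * x + (w * x)\<^sup>2 * exp \<bar>w * x\<bar>"
      using abs_exp_minus_affine_le[of "w * x"] by (simp add: abs_le_iff)
    moreover have "(w * x)\<^sup>2 * exp \<bar>w * x\<bar> \<le> 8 * w\<^sup>2 / a\<^sup>2 * exp (a * S i \<omega>)"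
    proof -
      have "\<bar>x\<bar>\<^sup>2 \<le> fact 2 / (a / 2)\<^sup>2 * exp (a / 2 * \<bar>x\<bar>)"
        by (rule power_le_exp_scaled) (use ap in auto)
      then have "x\<^sup>2 \<le> 8 / a\<^sup>2 * exp (a / 2 * \<bar>x\<bar>)" by (simp add: power_divide fact_2)
      then have "(w * x)\<^sup>2 * exp \<bar>w * x\<bar> \<le> (w\<^sup>2 * (8 / a\<^sup>2 * exp (a / 2 * \<bar>x\<bar>))) * exp (a / 2 * \<bar>x\<bar>)"
        unfolding power_mult_distrib using mult_right_mono[OF w, of "\<bar>x\<bar>"]
        by (intro mult_mono) (auto simp: abs_mult intro!: mult_left_mono)
      also have "\<dots> = 8 * w\<^sup>2 / a\<^sup>2 * exp (a * \<bar>x\<bar>)" by (simp flip: exp_add)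
      also have "\<dots> \<le> 8 * w\<^sup>2 / a\<^sup>2 * exp (a * S i \<omega>)"
        using XS[OF that, of \<omega>] ap by (intro mult_left_mono) (auto simp: x_def)
      finally show ?thesis .
    qed
    ultimately show ?thesis by (simp add: x_def)
  qed
  have Xi: "integrable M (X i)" if "i \<in> J" for i
  proof (rule integrable_le_exp_S[OF that X_meas[OF that], of 1])
    fix \<omega>
    have "S i \<omega> \<le> a * S i \<omega>" using a_ge_1 S_nonneg[of i \<omega>] mult_right_mono[of 1 a "S i \<omega>"] by simp
    also have "\<dots> \<le> exp (a * S i \<omega>)" using exp_ge_add_one_self[of "a * S i \<omega>"] by linarith
    finally show "\<bar>X i \<omega>\<bar> \<le> 1 * exp (a * S i \<omega>)" using XS[OF that, of \<omega>] by simp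
  qed
  have m: "(\<lambda>\<omega>. exp (w * X i \<omega>)) \<in> borel_measurable M" if "i \<in> J" for i
    using X_meas[OF that] by measurable
  have ei: "integrable M (\<lambda>\<omega>. exp (w * X i \<omega>))" if "i \<in> J" for i
  proof (rule integrable_le_exp_S[OF that m[OF that], of 1])
    fix \<omega>
    have "w * X i \<omega> \<le> \<bar>w\<bar> * \<bar>X i \<omega>\<bar>" by (simp flip: abs_mult)
    also have "\<dots> \<le> a * S i \<omega>" using w ap XS[OF that, of \<omega>] by (intro mult_mono) auto
    finally show "\<bar>exp (w * X i \<omega>)\<bar> \<le> 1 * exp (a * S i \<omega>)" by simp
  qed
  have E: "expectation (\<lambda>\<omega>. exp (w * X i \<omega>)) \<le> exp (real \<kappa> * l)" if iJ: "i \<in> J" for i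
  proof -
    have "expectation (\<lambda>\<omega>. exp (w * X i \<omega>)) \<le> expectation (\<lambda>\<omega>. 1 + w * X i \<omega> + 8 * w\<^sup>2 / a\<^sup>2 * exp (a * S i \<omega>))"
      using Xi[OF iJ] exp_S_integrable[OF iJ] ei[OF iJ] pt[OF iJ] by (intro integral_mono) auto
    also have "\<dots> = 1 + 8 * w\<^sup>2 / a\<^sup>2 * expectation (\<lambda>\<omega>. exp (a * S i \<omega>))"
      using Xi[OF iJ] exp_S_integrable[OF iJ] X_mean[OF iJ] prob_space by simp
    also have "\<dots> \<le> 1 + 8 * w\<^sup>2 / a\<^sup>2 * b"
      using exp_S_le[OF iJ] by (intro add_left_mono mult_left_mono) auto
    also have "\<dots> = 1 + real \<kappa> * l" by (simp add: w_def l_def power2_eq_square)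
    also have "\<dots> \<le> exp (real \<kappa> * l)" by (rule exp_ge_add_one_self)
    finally show ?thesis .
  qed
  have "expectation (\<lambda>\<omega>. exp (\<Sum>i\<in>J. (u * X i \<omega> - l))) \<le> 1"
  proof (rule exp_sum_le_one(2)[where g="\<lambda>_ x. u * x - l"])
    fix i assume iJ: "i \<in> J"
    show "integrable M (\<lambda>\<omega>. exp (real \<kappa> * (u * X i \<omega> - l)))" unfolding eq using ei[OF iJ] by simp
    show "expectation (\<lambda>\<omega>. exp (real \<kappa> * (u * X i \<omega> - l))) \<le> 1"
      unfolding eq using E[OF iJ] by (simp add: exp_minus field_simps)
  qed auto
  moreover have "exp (\<Sum>i\<in>J. (u * X i \<omega> - l)) = exp (u * W \<omega>) * exp (- (real (card J) * l))" for \<omega>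
    by (simp add: W_def sum_subtractf sum_distrib_left flip: exp_add)
  moreover have "real (card J) * l = 8 * real \<kappa> * u\<^sup>2 * v" by (simp add: l_def v_def)
  ultimately show ?thesis by (simp add: exp_minus field_simps)
qed

end

section \<open>Decoupling under exponential tilts\<close>

text \<open>All tilts are by parameters t with \<open>\<bar>t\<bar> \<le> \<tau>\<close>. The smallness condition, used with \<open>\<tau> = z + 2\<close>, is what the
range of z in the theorem amounts to for \<open>z \<ge> 1\<close>, up to constants. The constant \<open>1 / 10 ^ 8\<close> is small enough for every absorption below; the most
demanding one is \<open>\<bar>ln (\<phi> t) - t\<^sup>2 / 2\<bar> \<le> 1 / 2\<close>.\<close>
locale tilted_field = dependent_field M J X A B a b \<kappa>
  for M :: "'a measure" and J :: "'i set" and X A B a b \<kappa> +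
  fixes \<tau> :: real
  assumes tau_ge_1: "1 \<le> \<tau>" and small: "rho * \<tau> ^ 3 \<le> 1 / 10 ^ 8"
begin

text \<open>The tilted expectation before normalisation: the tilted law assigns \<open>tE t F / \<phi> t\<close> to F.\<close>
definition tE :: "real \<Rightarrow> ('a \<Rightarrow> real) \<Rightarrow> real" where
  "tE t F = expectation (\<lambda>\<omega>. F \<omega> * exp (t * W \<omega>))"

definition "\<phi> t = expectation (\<lambda>\<omega>. exp (t * W \<omega>))"

lemma a_pos: "0 < a" using a_ge_1 by simp
lemma v_nonneg: "0 \<le> v" using b_ge_1 by (simp add: v_def)

lemma small_a: "10 ^ 8 * (real \<kappa> * (1 + v) * \<tau> ^ 3) \<le> a"
  using small a_pos by (simp add: rho_def field_simps)

lemma small_pieces: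
  "100000000 * (real \<kappa> * \<tau>) \<le> a" "100000000 * (real \<kappa> * v * \<tau> ^ 3) \<le> a" "100000000 * \<tau> ^ 3 \<le> a" "100000000 * \<tau> \<le> a" "v \<le> a"
proof -
  have k: "1 \<le> real \<kappa>" using kappa_pos by simp
  have t: "\<tau> \<le> \<tau> ^ 3" using power_increasing[of 1 3 \<tau>] tau_ge_1 by simp
  have t1: "1 \<le> \<tau> ^ 3" using t tau_ge_1 by simp
  have "real \<kappa> * \<tau> \<le> real \<kappa> * (1 + v) * \<tau> ^ 3"
    using k t v_nonneg tau_ge_1 by (intro mult_mono) auto
  then show "100000000 * (real \<kappa> * \<tau>) \<le> a" using small_a by simp
  have "real \<kappa> * v * \<tau> ^ 3 \<le> real \<kappa> * (1 + v) * \<tau> ^ 3"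
    by (intro mult_right_mono mult_left_mono) (use t1 tau_ge_1 in auto)
  then show "100000000 * (real \<kappa> * v * \<tau> ^ 3) \<le> a" using small_a by simp
  have "1 * \<tau> ^ 3 \<le> real \<kappa> * (1 + v) * \<tau> ^ 3"
    using k v_nonneg t1 mult_mono[of 1 "real \<kappa>" 1 "1 + v"] tau_ge_1 by (intro mult_right_mono) auto
  then show 1: "100000000 * \<tau> ^ 3 \<le> a" using small_a by simp
  show "100000000 * \<tau> \<le> a" using 1 t by simp
  have "(1 * v) * 1 \<le> real \<kappa> * (1 + v) * \<tau> ^ 3"
    using k v_nonneg t1 by (intro mult_mono) auto
  then show "v \<le> a" using small_a a_pos by simp
qed

text \<open>Since J is not empty, \<open>b \<le> v * a\<^sup>2 \<le> a ^ 3\<close>, a power of a, whereas smallness forces \<open>\<tau> ^ 3 \<le> a\<close> and hence makes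
\<open>a / \<tau>\<close> at least a multiple of \<open>a powr (2 / 3)\<close>. The sixth power in the exponential series is enough.\<close>
lemma b_le_exp: "b \<le> exp (a / (32 * \<tau>))"
proof -
  have tp: "\<tau> > 0" using tau_ge_1 by simp
  have "b \<le> b * real (card J)" using card_J_pos b_ge_1 by simp
  also have "\<dots> = v * a\<^sup>2" using a_pos by (simp add: v_def)
  also have "\<dots> \<le> a * a\<^sup>2" using small_pieces(5) by (intro mult_right_mono) auto
  finally have b: "b \<le> a ^ 3" by (simp add: power2_eq_square power3_eq_cube)
  have "\<tau> ^ 6 = (\<tau> ^ 3)\<^sup>2" by simp
  also have "\<dots> \<le> (a / 10 ^ 8)\<^sup>2"
    by (intro power_mono) (use small_pieces(3) tp in auto)
  finally have t6: "10 ^ 16 * \<tau> ^ 6 \<le> a\<^sup>2" by (simp add: power_divide)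
  have "fact 6 * (32 * \<tau>) ^ 6 \<le> 10 ^ 16 * \<tau> ^ 6"
  proof -
    have "fact 6 * 32 ^ 6 \<le> (10 ^ 16 :: real)" by (simp add: fact_numeral)
    then have "(fact 6 * 32 ^ 6) * \<tau> ^ 6 \<le> 10 ^ 16 * \<tau> ^ 6"
      by (rule mult_right_mono) (use tp in simp)
    then show ?thesis by (simp only: power_mult_distrib mult.assoc)
  qed
  then have "b * (fact 6 * (32 * \<tau>) ^ 6) \<le> a ^ 3 * (10 ^ 16 * \<tau> ^ 6)"
    by (rule mult_mono[OF b]) (use tp a_pos in auto)
  also have "\<dots> \<le> a ^ 3 * a\<^sup>2" by (intro mult_left_mono t6) (use a_pos in auto)
  also have "\<dots> \<le> a ^ 6" using power_increasing[of 5 6 a] a_ge_1 by (simp flip: power_add)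
  finally have "b * fact 6 \<le> (a / (32 * \<tau>)) ^ 6"
    using tp by (simp add: power_divide field_simps)
  also have "\<dots> \<le> fact 6 * exp (a / (32 * \<tau>))"
    by (rule power_le_exp) (use a_pos tp in auto)
  finally show ?thesis by (simp add: fact_numeral)
qed

lemma tW_le_tau_L: "\<bar>t\<bar> \<le> \<tau> \<Longrightarrow> t * W \<omega> \<le> \<tau> * L \<omega>"
proof -
  assume t: "\<bar>t\<bar> \<le> \<tau>"
  have "t * W \<omega> \<le> \<bar>t\<bar> * \<bar>W \<omega>\<bar>" by (simp flip: abs_mult)
  also have "\<dots> \<le> \<tau> * L \<omega>" using t tau_ge_1 by (intro mult_mono abs_W_le_L) auto
  finally show ?thesis .
qed

lemma tau_S_le: "\<tau> * S i \<omega> \<le> a * S i \<omega> / 16"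
proof -
  have "\<tau> \<le> a / 16" using small_pieces(4) tau_ge_1 by simp
  then show ?thesis using mult_right_mono[of \<tau> "a / 16" "S i \<omega>"] S_nonneg by simp
qed

lemma aS_nonneg: "0 \<le> a * S i \<omega>" using a_pos S_nonneg[of i \<omega>] by simp

text \<open>Every integrand below is dominated by such a product of two neighbourhood exponentials and \<open>exp (2 * \<tau> * L)\<close>. The
product is integrable because the exponent is at most the largest of \<open>a * S i\<close>, \<open>a * S j\<close> and \<open>4 * \<tau> * L\<close>.\<close>
lemma dom_integrable:
  assumes G: "G \<in> borel_measurable M" and ij: "i \<in> J" "j \<in> J"
    and le: "\<And>\<omega>. \<omega> \<in> space M \<Longrightarrow> \<bar>G \<omega>\<bar> \<le> C * exp (a * S i \<omega> / 4 + a * S j \<omega> / 4 + 2 * \<tau> * L \<omega>)"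
  shows "integrable M (G :: 'a \<Rightarrow> real)"
proof -
  have L4: "integrable M (\<lambda>\<omega>. exp (4 * \<tau> * L \<omega>))"
  proof (rule exp_L_integrable)
    have "0 \<le> real \<kappa> * \<tau>" using tau_ge_1 by simp
    moreover have "real \<kappa> * (4 * \<tau>) = 4 * (real \<kappa> * \<tau>)" by simp
    ultimately show "real \<kappa> * (4 * \<tau>) \<le> a" using small_pieces(1) by linarith
    show "0 \<le> 4 * \<tau>" using tau_ge_1 by simp
  qed
  have D: "integrable M (\<lambda>\<omega>. C * (exp (a * S i \<omega>) + exp (a * S j \<omega>) + exp (4 * \<tau> * L \<omega>)))"
    using exp_S_integrable ij L4 by auto
  show ?thesis
  proof (rule Bochner_Integration.integrable_bound[OF D G], rule AE_I2)
    fix \<omega> assume w: "\<omega> \<in> space M"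
    define x y z where "x = a * S i \<omega>" and "y = a * S j \<omega>" and "z = 2 * \<tau> * L \<omega>"
    have nn: "0 \<le> x" "0 \<le> y" "0 \<le> z"
      using aS_nonneg L_nonneg tau_ge_1 by (auto simp: x_def y_def z_def)
    define m where "m = max x (max y (2 * z))"
    have "x \<le> m" "y \<le> m" "2 * z \<le> m" by (auto simp: m_def)
    then have "x / 4 + y / 4 + z \<le> m" by linarith
    then have "exp (x / 4 + y / 4 + z) \<le> exp m" by simp
    also have "\<dots> \<le> exp x + exp y + exp (2 * z)"
    proof -
      have "m = x \<or> m = y \<or> m = 2 * z" by (auto simp: m_def max_def)
      then show ?thesis by (elim disjE) (simp_all add: add_nonneg_nonneg)
    qed
    finally have "\<bar>C\<bar> * exp (x / 4 + y / 4 + z) \<le> \<bar>C\<bar> * (exp x + exp y + exp (2 * z))"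
      by (intro mult_left_mono) auto
    moreover have "C * exp (x / 4 + y / 4 + z) \<le> \<bar>C\<bar> * exp (x / 4 + y / 4 + z)"
      by (intro mult_right_mono) auto
    ultimately have "\<bar>G \<omega>\<bar> \<le> \<bar>C\<bar> * (exp x + exp y + exp (2 * z))"
      using le[OF w, folded x_def y_def z_def] by linarith
    then show "norm (G \<omega>) \<le> norm (C * (exp (a * S i \<omega>) + exp (a * S j \<omega>) + exp (4 * \<tau> * L \<omega>)))"
      by (simp add: x_def y_def z_def abs_mult mult.assoc)
  qed
qed

lemma tilt_integrable:
  assumes t: "\<bar>t\<bar> \<le> \<tau>" and F: "F \<in> borel_measurable M" and ij: "i \<in> J" "j \<in> J"
    and le: "\<And>\<omega>. \<omega> \<in> space M \<Longrightarrow> \<bar>F \<omega>\<bar> \<le> C * exp (a * S i \<omega> / 4 + a * S j \<omega> / 4 + \<tau> * L \<omega>)"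
  shows "integrable M (\<lambda>\<omega>. F \<omega> * exp (t * W \<omega>))"
proof (rule dom_integrable[OF _ ij])
  show "(\<lambda>\<omega>. F \<omega> * exp (t * W \<omega>)) \<in> borel_measurable M" using F by measurable
  fix \<omega> assume w: "\<omega> \<in> space M"
  have C: "0 \<le> C * exp (a * S i \<omega> / 4 + a * S j \<omega> / 4 + \<tau> * L \<omega>)" using le[OF w] by simp
  have "\<bar>F \<omega> * exp (t * W \<omega>)\<bar> \<le> (C * exp (a * S i \<omega> / 4 + a * S j \<omega> / 4 + \<tau> * L \<omega>)) * exp (\<tau> * L \<omega>)"
    unfolding abs_mult using le[OF w] tW_le_tau_L[OF t, of \<omega>] C by (intro mult_mono) auto
  also have "\<dots> = C * exp (a * S i \<omega> / 4 + a * S j \<omega> / 4 + 2 * \<tau> * L \<omega>)"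
    by (simp add: mult.assoc flip: exp_add)
  finally show "\<bar>F \<omega> * exp (t * W \<omega>)\<bar> \<le> C * exp (a * S i \<omega> / 4 + a * S j \<omega> / 4 + 2 * \<tau> * L \<omega>)" .
qed

lemma J_elem: obtains i where "i \<in> J" using J_ne by blast

lemma tau_L_nonneg: "0 \<le> \<tau> * L \<omega>" using tau_ge_1 L_nonneg by simp

lemma exp_tW_integrable: "\<bar>t\<bar> \<le> \<tau> \<Longrightarrow> integrable M (\<lambda>\<omega>. exp (t * W \<omega>))"
proof -
  assume t: "\<bar>t\<bar> \<le> \<tau>"
  obtain i where i: "i \<in> J" by (rule J_elem)
  have "integrable M (\<lambda>\<omega>. 1 * exp (t * W \<omega>))"
    by (rule tilt_integrable[OF t _ i i, where C=1]) (use aS_nonneg tau_L_nonneg in \<open>auto simp: add_nonneg_nonneg\<close>)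
  then show ?thesis by simp
qed

lemma X_integrable: "i \<in> J \<Longrightarrow> integrable M (X i)"
proof (rule integrable_le_exp_S[OF _ X_meas, of i i 1])
  fix \<omega> assume i: "i \<in> J"
  have "S i \<omega> \<le> a * S i \<omega>" using a_ge_1 S_nonneg[of i \<omega>] mult_right_mono[of 1 a "S i \<omega>"] by simp
  also have "\<dots> \<le> exp (a * S i \<omega>)" using exp_ge_add_one_self[of "a * S i \<omega>"] by linarith
  finally show "\<bar>X i \<omega>\<bar> \<le> 1 * exp (a * S i \<omega>)" using abs_X_le_S[OF i self_in_B[OF i], of \<omega>] by simp
qed auto

lemma W_mean: "integrable M W" "expectation W = 0"
proof -
  show "integrable M W" unfolding W_def by (rule Bochner_Integration.integrable_sum) (rule X_integrable)
  show "expectation W = 0" unfolding W_def using X_integrable X_mean by (subst Bochner_Integration.integral_sum) auto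
qed

lemma phi_ge_1: "\<bar>t\<bar> \<le> \<tau> \<Longrightarrow> 1 \<le> \<phi> t"
proof -
  assume t: "\<bar>t\<bar> \<le> \<tau>"
  have "1 = expectation (\<lambda>\<omega>. 1 + t * W \<omega>)" using W_mean prob_space by simp
  also have "\<dots> \<le> \<phi> t" unfolding \<phi>_def
    using W_mean exp_tW_integrable[OF t] by (intro integral_mono) auto
  finally show ?thesis .
qed

lemma tE_1: "tE t (\<lambda>_. 1) = \<phi> t" by (simp add: tE_def \<phi>_def)

text \<open>The factor \<open>exp (- a / (16 * \<tau>))\<close> is what Markov's inequality gives for the event \<open>S i > 1 / \<tau>\<close> at the exponent
\<open>a / 16\<close>. It beats the crude bound for \<open>exp (2 * t * W)\<close>, whose exponent is a multiple of \<open>\<kappa> * v * \<tau>\<^sup>2\<close>, precisely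
because \<open>\<kappa> * v * \<tau> ^ 3\<close> is small compared with a.\<close>
lemma far_part_small:
  assumes ij: "i \<in> J" "j \<in> J" and t: "\<bar>t\<bar> \<le> \<tau>"
  shows "integrable M (\<lambda>\<omega>. exp (a * S i \<omega> / 4 + a * S j \<omega> / 16 + t * W \<omega>))"
    and "exp (- a / (16 * \<tau>)) * expectation (\<lambda>\<omega>. exp (a * S i \<omega> / 4 + a * S j \<omega> / 16 + t * W \<omega>)) \<le> 1"
proof -
  let ?g = "\<lambda>\<omega>. exp (a * S i \<omega> / 4 + a * S j \<omega> / 16 + t * W \<omega>)"
  have tp: "\<tau> > 0" using tau_ge_1 by simp
  have m[measurable]: "S i \<in> borel_measurable M" "S j \<in> borel_measurable M" using S_meas ij by auto
  show int: "integrable M ?g"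
  proof (rule dom_integrable[OF _ ij, where C=1])
    fix \<omega>
    show "\<bar>?g \<omega>\<bar> \<le> 1 * exp (a * S i \<omega> / 4 + a * S j \<omega> / 4 + 2 * \<tau> * L \<omega>)"
      using tW_le_tau_L[OF t, of \<omega>] aS_nonneg[of j \<omega>] tau_L_nonneg[of \<omega>] by simp
  qed measurable
  \<comment> \<open>The weight K balances the two squares: the crude bound gives at most \<open>exp (2 * K)\<close> for the second one.\<close>
  define K where "K = 16 * real \<kappa> * \<tau>\<^sup>2 * v"
  have t2: "\<bar>2 * t\<bar> \<le> 2 * \<tau>" using t by simp
  have int2: "integrable M (\<lambda>\<omega>. exp (2 * t * W \<omega>))"
  proof (rule dom_integrable[OF _ ij, where C=1])
    fix \<omega>
    show "\<bar>exp (2 * t * W \<omega>)\<bar> \<le> 1 * exp (a * S i \<omega> / 4 + a * S j \<omega> / 4 + 2 * \<tau> * L \<omega>)"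
      using tW_le_tau_L[OF t, of \<omega>] aS_nonneg[of i \<omega>] aS_nonneg[of j \<omega>] by simp
  qed measurable
  have pt: "?g \<omega>
      \<le> exp K / 4 * (exp (a * S i \<omega>) + exp (a * S j \<omega>)) + exp (- K) / 2 * exp (2 * t * W \<omega>)" for \<omega>
  proof -
    have am: "exp (p + q) \<le> (exp (2 * p) + exp (2 * q)) / 2" for p q :: real
      using sum_squares_bound[of "exp p" "exp q"] by (simp add: exp_add exp_double)
    have "?g \<omega>
       = exp ((K / 2 + (a * S i \<omega> / 4 + a * S j \<omega> / 16)) + (- K / 2 + t * W \<omega>))" by simp
    also have "\<dots> \<le> (exp (2 * (K / 2 + (a * S i \<omega> / 4 + a * S j \<omega> / 16))) + exp (2 * (- K / 2 + t * W \<omega>))) / 2"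
      by (rule am)
    also have "\<dots> = exp K / 2 * exp (a * S i \<omega> / 2 + a * S j \<omega> / 8) + exp (- K) / 2 * exp (2 * t * W \<omega>)"
      by (simp add: algebra_simps add_divide_distrib flip: exp_add)
    also have "exp (a * S i \<omega> / 2 + a * S j \<omega> / 8) \<le> exp (a * S i \<omega> / 2 + a * S j \<omega> / 2)"
      using aS_nonneg[of j \<omega>] by simp
    also have "\<dots> \<le> (exp (2 * (a * S i \<omega> / 2)) + exp (2 * (a * S j \<omega> / 2))) / 2" by (rule am)
    finally show ?thesis by (simp add: algebra_simps add_divide_distrib)
  qed
  have "expectation ?g
     \<le> expectation (\<lambda>\<omega>. exp K / 4 * (exp (a * S i \<omega>) + exp (a * S j \<omega>)) + exp (- K) / 2 * exp (2 * t * W \<omega>))"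
    using int exp_S_integrable[OF ij(1)] exp_S_integrable[OF ij(2)] int2 pt by (intro integral_mono) auto
  also have "\<dots> = exp K / 4 * (expectation (\<lambda>\<omega>. exp (a * S i \<omega>)) + expectation (\<lambda>\<omega>. exp (a * S j \<omega>)))
      + exp (- K) / 2 * expectation (\<lambda>\<omega>. exp (2 * t * W \<omega>))"
    using exp_S_integrable[OF ij(1)] exp_S_integrable[OF ij(2)] int2 by simp
  also have "\<dots> \<le> exp K / 4 * (b + b) + exp (- K) / 2 * exp (2 * K)"
  proof (intro add_mono mult_left_mono exp_S_le ij)
    have "real \<kappa> * \<bar>2 * t\<bar> \<le> real \<kappa> * (2 * \<tau>)" by (intro mult_left_mono t2) auto
    also have "\<dots> = 2 * (real \<kappa> * \<tau>)" by simp
    also have "\<dots> \<le> a / 2" using small_pieces(1) mult_nonneg_nonneg[of "real \<kappa>" \<tau>, OF of_nat_0_le_iff less_imp_le[OF tp]] by linarith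
    finally have "expectation (\<lambda>\<omega>. exp (2 * t * W \<omega>)) \<le> exp (8 * real \<kappa> * (2 * t)\<^sup>2 * v)"
      by (rule exp_W_le)
    also have "\<dots> \<le> exp (2 * K)"
    proof -
      have "t\<^sup>2 \<le> \<tau>\<^sup>2" using t tp by (simp add: abs_le_square_iff[symmetric])
      then have "32 * (real \<kappa> * v) * t\<^sup>2 \<le> 32 * (real \<kappa> * v) * \<tau>\<^sup>2"
        using v_nonneg by (intro mult_left_mono) auto
      then show ?thesis by (simp add: K_def power_mult_distrib mult_ac)
    qed
    finally show "expectation (\<lambda>\<omega>. exp (2 * t * W \<omega>)) \<le> exp (2 * K)" .
  qed auto
  also have "\<dots> = exp K / 2 * b + exp K / 2 * 1" by (simp flip: exp_add)
  also have "\<dots> \<le> exp K / 2 * b + exp K / 2 * b" using b_ge_1 by (intro add_left_mono mult_left_mono) auto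
  also have "\<dots> = exp K * b" by simp
  also have "\<dots> \<le> exp (a / (32 * \<tau>)) * exp (a / (32 * \<tau>))"
  proof (intro mult_mono b_le_exp)
    have "K * (32 * \<tau>) = 512 * (real \<kappa> * v * \<tau> ^ 3)" by (simp add: K_def power2_eq_square power3_eq_cube)
    also have "\<dots> \<le> a"
    proof -
      have "0 \<le> real \<kappa> * v * \<tau> ^ 3" using v_nonneg tp by simp
      then show ?thesis using small_pieces(2) by linarith
    qed
    finally show "exp K \<le> exp (a / (32 * \<tau>))" using tp by (simp add: field_simps)
  qed (use b_ge_1 in auto)
  also have "\<dots> = exp (a / (16 * \<tau>))" by (simp flip: exp_add)
  finally have *: "expectation ?g \<le> exp (a / (16 * \<tau>))" .
  have "exp (- a / (16 * \<tau>)) * expectation ?g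
      \<le> exp (- a / (16 * \<tau>)) * exp (a / (16 * \<tau>))"
    using * by (intro mult_left_mono) auto
  then show "exp (- a / (16 * \<tau>)) * expectation ?g \<le> 1"
    by (simp flip: exp_add)
qed

text \<open>The first summand covers \<open>S i \<le> 1 / \<tau>\<close>, the second one the complementary event.\<close>
lemma exp_tau_S_le: "exp (\<tau> * S i \<omega>) \<le> 3 + exp (- a / (16 * \<tau>)) * exp (a * S i \<omega> / 8)"
proof (cases "\<tau> * S i \<omega> \<le> 1")
  case True
  then have "exp (\<tau> * S i \<omega>) \<le> exp 1" by simp
  also have "\<dots> \<le> 3" by (rule Transcendental.exp_le)
  finally show ?thesis by (simp add: add_increasing2)
next
  case False
  then have "a / (16 * \<tau>) * 1 \<le> a / (16 * \<tau>) * (\<tau> * S i \<omega>)"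
    using a_pos tau_ge_1 by (intro mult_left_mono) auto
  then have "a / (16 * \<tau>) \<le> a * S i \<omega> / 16" using tau_ge_1 by simp
  then have "exp (\<tau> * S i \<omega>) \<le> exp (- a / (16 * \<tau>)) * exp (a * S i \<omega> / 8)"
    using tau_S_le[of i \<omega>] by (simp flip: exp_add)
  then show ?thesis by simp
qed

text \<open>Passing from \<open>exp (t * Q)\<close> to \<open>exp (t * P)\<close> costs a factor \<open>exp (\<tau> * S i)\<close>, which is at most 3 up to the
negligible far part. The comparison is pointwise, so G may depend on both neighbourhoods.\<close>
lemma change_exponent:
  assumes ij: "i \<in> J" "j \<in> J" and t: "\<bar>t\<bar> \<le> \<tau>"
    and P: "P \<in> borel_measurable M" "\<And>\<omega>. \<bar>P \<omega> - W \<omega>\<bar> \<le> S i \<omega>"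
    and Q: "Q \<in> borel_measurable M" "\<And>\<omega>. \<bar>Q \<omega> - W \<omega>\<bar> \<le> S i \<omega>"
    and PQ: "\<And>\<omega>. \<bar>P \<omega> - Q \<omega>\<bar> \<le> S i \<omega>"
    and G: "G \<in> borel_measurable M" "\<And>\<omega>. 0 \<le> G \<omega>" "\<And>\<omega>. G \<omega> \<le> exp (a * S i \<omega> / 16 + a * S j \<omega> / 16)"
  shows "expectation (\<lambda>\<omega>. G \<omega> * exp (t * P \<omega>)) \<le> 3 * expectation (\<lambda>\<omega>. G \<omega> * exp (t * Q \<omega>)) + 1"
proof -
  let ?g = "\<lambda>\<omega>. exp (a * S i \<omega> / 4 + a * S j \<omega> / 16 + t * W \<omega>)"
  have tp: "\<tau> > 0" using tau_ge_1 by simp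
  have mult_le: "t * x \<le> \<tau> * S i \<omega>" if "\<bar>x\<bar> \<le> S i \<omega>" for x \<omega>
  proof -
    have "t * x \<le> \<bar>t\<bar> * \<bar>x\<bar>" by (simp flip: abs_mult)
    also have "\<dots> \<le> \<tau> * S i \<omega>" using t that tp by (intro mult_mono) auto
    finally show ?thesis .
  qed
  define \<eta> where "\<eta> = exp (- a / (16 * \<tau>))"
  have int: "integrable M (\<lambda>\<omega>. G \<omega> * exp (t * R \<omega>))"
    if R[measurable]: "R \<in> borel_measurable M" and R2: "\<And>\<omega>. \<bar>R \<omega> - W \<omega>\<bar> \<le> S i \<omega>" for R
  proof (rule dom_integrable[OF _ ij, where C=1])
    show "(\<lambda>\<omega>. G \<omega> * exp (t * R \<omega>)) \<in> borel_measurable M" using G by measurable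
    fix \<omega>
    have "t * R \<omega> = t * W \<omega> + t * (R \<omega> - W \<omega>)" by (simp add: algebra_simps)
    then have "t * R \<omega> \<le> \<tau> * L \<omega> + a * S i \<omega> / 16"
      using tW_le_tau_L[OF t, of \<omega>] mult_le[OF R2, of \<omega>] tau_S_le[of i \<omega>] by simp
    then have "G \<omega> * exp (t * R \<omega>) \<le> exp (a * S i \<omega> / 16 + a * S j \<omega> / 16) * exp (\<tau> * L \<omega> + a * S i \<omega> / 16)"
      using G by (intro mult_mono) auto
    also have "\<dots> \<le> exp (a * S i \<omega> / 4 + a * S j \<omega> / 4 + 2 * \<tau> * L \<omega>)"
      using aS_nonneg[of i \<omega>] aS_nonneg[of j \<omega>] tau_L_nonneg[of \<omega>] by (simp flip: exp_add)
    finally show "\<bar>G \<omega> * exp (t * R \<omega>)\<bar> \<le> 1 * exp (a * S i \<omega> / 4 + a * S j \<omega> / 4 + 2 * \<tau> * L \<omega>)"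
      using G by simp
  qed
  have pt: "G \<omega> * exp (t * P \<omega>) \<le> 3 * (G \<omega> * exp (t * Q \<omega>)) + \<eta> * ?g \<omega>" for \<omega>
  proof -
    have "t * P \<omega> = t * Q \<omega> + t * (P \<omega> - Q \<omega>)" by (simp add: algebra_simps)
    then have "t * P \<omega> \<le> t * Q \<omega> + \<tau> * S i \<omega>" using mult_le[OF PQ, of \<omega>] by simp
    then have "exp (t * P \<omega>) \<le> exp (t * Q \<omega>) * exp (\<tau> * S i \<omega>)" by (simp flip: exp_add)
    also have "\<dots> \<le> exp (t * Q \<omega>) * (3 + \<eta> * exp (a * S i \<omega> / 8))"
      using exp_tau_S_le[of i \<omega>] by (intro mult_left_mono) (auto simp: \<eta>_def)
    finally have "G \<omega> * exp (t * P \<omega>) \<le> G \<omega> * (exp (t * Q \<omega>) * (3 + \<eta> * exp (a * S i \<omega> / 8)))"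
      using G by (intro mult_left_mono) auto
    also have "\<dots> = 3 * (G \<omega> * exp (t * Q \<omega>)) + \<eta> * (G \<omega> * (exp (t * Q \<omega>) * exp (a * S i \<omega> / 8)))"
      by (simp add: algebra_simps)
    also have "G \<omega> * (exp (t * Q \<omega>) * exp (a * S i \<omega> / 8))
        \<le> exp (a * S i \<omega> / 16 + a * S j \<omega> / 16) * (exp (t * W \<omega> + a * S i \<omega> / 16) * exp (a * S i \<omega> / 8))"
    proof -
      have "t * Q \<omega> = t * W \<omega> + t * (Q \<omega> - W \<omega>)" by (simp add: algebra_simps)
      then have "t * Q \<omega> \<le> t * W \<omega> + a * S i \<omega> / 16"
        using mult_le[OF Q(2), of \<omega>] tau_S_le[of i \<omega>] by simp
      then show ?thesis using G by (intro mult_mono) auto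
    qed
    also have "\<dots> = ?g \<omega>"
      by (simp flip: exp_add)
    finally show ?thesis by (simp add: \<eta>_def)
  qed
  have "expectation (\<lambda>\<omega>. G \<omega> * exp (t * P \<omega>))
      \<le> expectation (\<lambda>\<omega>. 3 * (G \<omega> * exp (t * Q \<omega>)) + \<eta> * ?g \<omega>)"
    using int[OF P] int[OF Q] far_part_small(1)[OF ij t] pt by (intro integral_mono) auto
  also have "\<dots> = 3 * expectation (\<lambda>\<omega>. G \<omega> * exp (t * Q \<omega>))
      + \<eta> * expectation ?g"
    using int[OF Q] far_part_small(1)[OF ij t] by simp
  also have "\<dots> \<le> 3 * expectation (\<lambda>\<omega>. G \<omega> * exp (t * Q \<omega>)) + 1"
    using far_part_small(2)[OF ij t] by (simp add: \<eta>_def)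
  finally show ?thesis .
qed

lemma remove_nbhd:
  assumes "i \<in> J" "j \<in> J" "\<bar>t\<bar> \<le> \<tau>"
    and G: "G \<in> borel_measurable M" "\<And>\<omega>. 0 \<le> G \<omega>" "\<And>\<omega>. G \<omega> \<le> exp (a * S i \<omega> / 16 + a * S j \<omega> / 16)"
  shows "tE t G \<le> 3 * expectation (\<lambda>\<omega>. G \<omega> * exp (t * (W \<omega> - Z i \<omega>))) + 1"
  unfolding tE_def
  by (rule change_exponent[OF assms(1-3) _ _ _ _ _ G]) (use abs_Z_le_S Z_meas[OF assms(1)] S_nonneg in auto)

lemma restore_nbhd:
  assumes "i \<in> J" "j \<in> J" "\<bar>t\<bar> \<le> \<tau>"
    and G: "G \<in> borel_measurable M" "\<And>\<omega>. 0 \<le> G \<omega>" "\<And>\<omega>. G \<omega> \<le> exp (a * S i \<omega> / 16 + a * S j \<omega> / 16)"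
  shows "expectation (\<lambda>\<omega>. G \<omega> * exp (t * (W \<omega> - Z i \<omega>))) \<le> 3 * tE t G + 1"
  unfolding tE_def
  by (rule change_exponent[OF assms(1-3) _ _ _ _ _ G]) (use abs_Z_le_S Z_meas[OF assms(1)] S_nonneg in auto)

end

context tilted_field
begin

lemma indep_nbhd:
  fixes F G :: "'a \<Rightarrow> real"
  assumes "i \<in> J" "F \<in> borel_measurable (loc (A i))" "integrable M F"
    "G \<in> borel_measurable (loc (J - B i))" "integrable M G"
  shows "expectation (\<lambda>\<omega>. F \<omega> * G \<omega>) = expectation F * expectation G"
proof -
  have "indep_subfamilies M X (A i) (J - B i)" using LD2 assms(1) by (auto simp: LD2_def)
  then show ?thesis by (rule indep_product(2)[OF _ assms(2-5)])
qed

lemma exp_W_minus_Z_loc: "i \<in> J \<Longrightarrow> (\<lambda>\<omega>. exp (t * (W \<omega> - Z i \<omega>))) \<in> borel_measurable (loc (J - B i))"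
proof -
  assume i: "i \<in> J"
  have "(\<lambda>\<omega>. \<Sum>j\<in>J - B i. X j \<omega>) \<in> borel_measurable (loc (J - B i))"
    by (intro borel_measurable_sum X_loc)
  then show ?thesis unfolding W_minus_Z[OF i] by measurable
qed

lemma abs_W_minus_Z_le_L: "i \<in> J \<Longrightarrow> \<bar>W \<omega> - Z i \<omega>\<bar> \<le> L \<omega>"
  unfolding W_minus_Z by (rule abs_sub_sum_le_L) auto

lemma mult_le_tau_L: "\<bar>t\<bar> \<le> \<tau> \<Longrightarrow> \<bar>x\<bar> \<le> L \<omega> \<Longrightarrow> t * x \<le> \<tau> * L \<omega>"
proof -
  assume t: "\<bar>t\<bar> \<le> \<tau>" and x: "\<bar>x\<bar> \<le> L \<omega>"
  have "t * x \<le> \<bar>t\<bar> * \<bar>x\<bar>" by (simp flip: abs_mult)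
  also have "\<dots> \<le> \<tau> * L \<omega>" using t tau_ge_1 x by (intro mult_mono) auto
  finally show ?thesis .
qed

lemma exp_integrable_of_le_L:
  assumes t: "\<bar>t\<bar> \<le> \<tau>" and R: "R \<in> borel_measurable M" "\<And>\<omega>. \<bar>R \<omega>\<bar> \<le> L \<omega>"
    and ij: "i \<in> J" "j \<in> J" and F: "F \<in> borel_measurable M"
    and le: "\<And>\<omega>. \<bar>F \<omega>\<bar> \<le> C * exp (a * S i \<omega> / 4 + a * S j \<omega> / 4)"
  shows "integrable M (\<lambda>\<omega>. F \<omega> * exp (t * R \<omega>))"
proof (rule dom_integrable[OF _ ij])
  show "(\<lambda>\<omega>. F \<omega> * exp (t * R \<omega>)) \<in> borel_measurable M" using F R by measurable
  fix \<omega>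
  have C: "0 \<le> C * exp (a * S i \<omega> / 4 + a * S j \<omega> / 4)" using order_trans[OF abs_ge_zero le] .
  have "\<bar>F \<omega> * exp (t * R \<omega>)\<bar> \<le> (C * exp (a * S i \<omega> / 4 + a * S j \<omega> / 4)) * exp (2 * \<tau> * L \<omega>)"
    unfolding abs_mult
  proof (intro mult_mono le C)
    show "\<bar>exp (t * R \<omega>)\<bar> \<le> exp (2 * \<tau> * L \<omega>)"
      using mult_le_tau_L[OF t R(2), of \<omega>] tau_L_nonneg[of \<omega>] by simp
  qed auto
  also have "\<dots> = C * exp (a * S i \<omega> / 4 + a * S j \<omega> / 4 + 2 * \<tau> * L \<omega>)"
    by (simp add: mult.assoc flip: exp_add)
  finally show "\<bar>F \<omega> * exp (t * R \<omega>)\<bar> \<le> C * exp (a * S i \<omega> / 4 + a * S j \<omega> / 4 + 2 * \<tau> * L \<omega>)" .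
qed

lemma exp_W_minus_Z_le:
  assumes i: "i \<in> J" and t: "\<bar>t\<bar> \<le> \<tau>"
  shows "expectation (\<lambda>\<omega>. exp (t * (W \<omega> - Z i \<omega>))) \<le> 4 * \<phi> t"
proof -
  have "expectation (\<lambda>\<omega>. 1 * exp (t * (W \<omega> - Z i \<omega>))) \<le> 3 * tE t (\<lambda>_. 1) + 1"
    by (rule restore_nbhd[OF i i t]) (use aS_nonneg in auto)
  then show ?thesis using phi_ge_1[OF t] by (simp add: tE_1)
qed

lemma local_expectation_le:
  assumes i: "i \<in> J" and F: "F \<in> borel_measurable M" and le: "\<And>\<omega>. F \<omega> \<le> exp (a * S i \<omega>)" "\<And>\<omega>. 0 \<le> F \<omega>"
  shows "expectation F \<le> b"
proof -
  have "expectation F \<le> expectation (\<lambda>\<omega>. exp (a * S i \<omega>))"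
    by (intro integral_mono exp_S_integrable[OF i] integrable_le_exp_S[OF i F, of 1]) (use le in auto)
  then show ?thesis using exp_S_le[OF i] by simp
qed

text \<open>Remove the neighbourhood of i from W; by (LD2) the remaining exponential is independent of F, and its expectation is
at most \<open>4 * \<phi> t\<close> by restoring the neighbourhood.\<close>
lemma tE_local_le:
  assumes i: "i \<in> J" and t: "\<bar>t\<bar> \<le> \<tau>" and loc: "F \<in> borel_measurable (loc (A i))"
    and F: "\<And>\<omega>. 0 \<le> F \<omega>" "\<And>\<omega>. F \<omega> \<le> exp (a * S i \<omega> / 16)"
  shows "tE t F \<le> 13 * b * \<phi> t"
proof -
  have Fm: "F \<in> borel_measurable M" by (rule loc_meas[OF A_sub_J[OF i] loc])
  have FS: "F \<omega> \<le> exp (a * S i \<omega>)" for \<omega>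
    by (rule order_trans[OF F(2)]) (use aS_nonneg[of i \<omega>] in simp)
  have Fi: "integrable M F" by (rule integrable_le_exp_S[OF i Fm, of 1]) (use F FS in auto)
  have Ei: "integrable M (\<lambda>\<omega>. exp (t * (W \<omega> - Z i \<omega>)))"
    using exp_integrable_of_le_L[OF t _ abs_W_minus_Z_le_L[OF i] i i, of "\<lambda>_. 1" 1] Z_meas[OF i] aS_nonneg[of i]
    by (simp add: add_nonneg_nonneg)
  have "tE t F \<le> 3 * expectation (\<lambda>\<omega>. F \<omega> * exp (t * (W \<omega> - Z i \<omega>))) + 1"
  proof (rule remove_nbhd[OF i i t Fm F(1)])
    fix \<omega>
    show "F \<omega> \<le> exp (a * S i \<omega> / 16 + a * S i \<omega> / 16)"
      by (rule order_trans[OF F(2)]) (use aS_nonneg[of i \<omega>] in simp)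
  qed
  also have "expectation (\<lambda>\<omega>. F \<omega> * exp (t * (W \<omega> - Z i \<omega>))) = expectation F * expectation (\<lambda>\<omega>. exp (t * (W \<omega> - Z i \<omega>)))"
    by (rule indep_nbhd[OF i loc Fi exp_W_minus_Z_loc[OF i] Ei])
  also have "\<dots> \<le> b * (4 * \<phi> t)"
    using b_ge_1
    by (intro mult_mono local_expectation_le[OF i Fm FS F(1)] exp_W_minus_Z_le[OF i t]) auto
  finally have "tE t F \<le> 12 * (b * \<phi> t) + 1" by simp
  moreover have "1 \<le> b * \<phi> t" using mult_mono[OF b_ge_1 phi_ge_1[OF t]] b_ge_1 by simp
  ultimately show ?thesis by simp
qed

text \<open>Remove the neighbourhood of i; then F is independent of the product of G with the remaining exponential, because G is a
function of \<open>X\<close> on \<open>A j\<close>, which does not meet \<open>B i\<close>. Restore the neighbourhood and decouple G around j.\<close>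
lemma tE_separated_le:
  assumes ij: "i \<in> J" "j \<in> J" and sep: "A j \<inter> B i = {}" and t: "\<bar>t\<bar> \<le> \<tau>"
    and locF: "F \<in> borel_measurable (loc (A i))" and F: "\<And>\<omega>. 0 \<le> F \<omega>" "\<And>\<omega>. F \<omega> \<le> exp (a * S i \<omega> / 16)"
    and locG: "G \<in> borel_measurable (loc (A j))" and G: "\<And>\<omega>. 0 \<le> G \<omega>" "\<And>\<omega>. G \<omega> \<le> exp (a * S j \<omega> / 16)"
  shows "tE t (\<lambda>\<omega>. F \<omega> * G \<omega>) \<le> 121 * b\<^sup>2 * \<phi> t"
proof -
  have Fm[measurable]: "F \<in> borel_measurable M" by (rule loc_meas[OF A_sub_J[OF ij(1)] locF])
  have Gm[measurable]: "G \<in> borel_measurable M" by (rule loc_meas[OF A_sub_J[OF ij(2)] locG])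
  have FS: "F \<omega> \<le> exp (a * S i \<omega>)" for \<omega>
    by (rule order_trans[OF F(2)]) (use aS_nonneg[of i \<omega>] in simp)
  have Fi: "integrable M F" by (rule integrable_le_exp_S[OF ij(1) Fm, of 1]) (use F FS in auto)
  have G4: "G \<omega> \<le> exp (a * S i \<omega> / 4 + a * S j \<omega> / 4)" for \<omega>
    by (rule order_trans[OF G(2)]) (use aS_nonneg[of i \<omega>] aS_nonneg[of j \<omega>] in simp)
  have Ei: "integrable M (\<lambda>\<omega>. G \<omega> * exp (t * (W \<omega> - Z i \<omega>)))"
    by (rule exp_integrable_of_le_L[OF t _ abs_W_minus_Z_le_L[OF ij(1)] ij, where C=1])
       (use Z_meas[OF ij(1)] G G4 in auto)
  have locE: "(\<lambda>\<omega>. G \<omega> * exp (t * (W \<omega> - Z i \<omega>))) \<in> borel_measurable (loc (J - B i))"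
    by (intro borel_measurable_times exp_W_minus_Z_loc[OF ij(1)] loc_mono[OF _ locG])
       (use sep A_sub_J[OF ij(2)] in auto)
  have "tE t (\<lambda>\<omega>. F \<omega> * G \<omega>) \<le> 3 * expectation (\<lambda>\<omega>. (F \<omega> * G \<omega>) * exp (t * (W \<omega> - Z i \<omega>))) + 1"
  proof (rule remove_nbhd[OF ij t])
    fix \<omega>
    show "F \<omega> * G \<omega> \<le> exp (a * S i \<omega> / 16 + a * S j \<omega> / 16)"
      unfolding exp_add using F G by (intro mult_mono) auto
  qed (use F G in auto)
  also have "expectation (\<lambda>\<omega>. (F \<omega> * G \<omega>) * exp (t * (W \<omega> - Z i \<omega>)))
      = expectation F * expectation (\<lambda>\<omega>. G \<omega> * exp (t * (W \<omega> - Z i \<omega>)))"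
    using indep_nbhd[OF ij(1) locF Fi locE Ei] by (simp add: mult.assoc)
  also have "\<dots> \<le> b * (3 * tE t G + 1)"
  proof (intro mult_mono local_expectation_le[OF ij(1) Fm FS F(1)])
    show "expectation (\<lambda>\<omega>. G \<omega> * exp (t * (W \<omega> - Z i \<omega>))) \<le> 3 * tE t G + 1"
    proof (rule restore_nbhd[OF ij t])
      fix \<omega> show "G \<omega> \<le> exp (a * S i \<omega> / 16 + a * S j \<omega> / 16)"
        by (rule order_trans[OF G(2)]) (use aS_nonneg[of i \<omega>] in simp)
    qed (use G in auto)
  qed (use b_ge_1 G in \<open>auto intro!: integral_nonneg_AE\<close>)
  also have "\<dots> \<le> b * (3 * (13 * b * \<phi> t) + 1)"
    using tE_local_le[OF ij(2) t locG G] b_ge_1 by (intro mult_left_mono) auto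
  finally have "tE t (\<lambda>\<omega>. F \<omega> * G \<omega>) \<le> 117 * (b\<^sup>2 * \<phi> t) + 3 * b + 1"
    by (simp add: power2_eq_square algebra_simps)
  moreover have "1 \<le> b" "b * 1 \<le> b\<^sup>2 * \<phi> t"
    using b_ge_1 phi_ge_1[OF t] mult_mono[of b "b\<^sup>2" 1 "\<phi> t"] by (auto simp: power2_eq_square)
  ultimately show ?thesis by simp
qed

lemma prod_sum_integrable:
  assumes t: "\<bar>t\<bar> \<le> \<tau>" and R: "R \<in> borel_measurable M" "\<And>\<omega>. \<bar>R \<omega>\<bar> \<le> L \<omega>"
    and T: "T \<subseteq> J" "T' \<subseteq> J"
    and F: "\<And>i. i \<in> J \<Longrightarrow> F i \<in> borel_measurable M" "\<And>i \<omega>. i \<in> J \<Longrightarrow> \<bar>F i \<omega>\<bar> \<le> c * exp (a * S i \<omega> / 4)"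
    and G: "\<And>i. i \<in> J \<Longrightarrow> G i \<in> borel_measurable M" "\<And>i \<omega>. i \<in> J \<Longrightarrow> \<bar>G i \<omega>\<bar> \<le> d * exp (a * S i \<omega> / 4)"
  shows "integrable M (\<lambda>\<omega>. (\<Sum>i\<in>T. F i \<omega>) * (\<Sum>j\<in>T'. G j \<omega>) * exp (t * R \<omega>))"
proof -
  have "integrable M (\<lambda>\<omega>. (F i \<omega> * G j \<omega>) * exp (t * R \<omega>))" if "i \<in> T" "j \<in> T'" for i j
  proof (rule exp_integrable_of_le_L[OF t R, where C="c * d"])
    show ij: "i \<in> J" "j \<in> J" using that T by auto
    show "(\<lambda>\<omega>. F i \<omega> * G j \<omega>) \<in> borel_measurable M" using F(1)[OF ij(1)] G(1)[OF ij(2)] by measurable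
    fix \<omega>
    have "\<bar>F i \<omega> * G j \<omega>\<bar> \<le> (c * exp (a * S i \<omega> / 4)) * (d * exp (a * S j \<omega> / 4))"
      unfolding abs_mult using order_trans[OF abs_ge_zero F(2)[OF ij(1)]]
      by (intro mult_mono F G ij) auto
    then show "\<bar>F i \<omega> * G j \<omega>\<bar> \<le> c * d * exp (a * S i \<omega> / 4 + a * S j \<omega> / 4)"
      by (simp add: exp_add mult_ac)
  qed
  then have int: "integrable M (\<lambda>\<omega>. \<Sum>i\<in>T. \<Sum>j\<in>T'. (F i \<omega> * G j \<omega>) * exp (t * R \<omega>))"
    by (intro Bochner_Integration.integrable_sum)
  have eq: "(\<Sum>i\<in>T. F i \<omega>) * (\<Sum>j\<in>T'. G j \<omega>) * exp (t * R \<omega>)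
      = (\<Sum>i\<in>T. \<Sum>j\<in>T'. (F i \<omega> * G j \<omega>) * exp (t * R \<omega>))" for \<omega>
    by (subst sum_product) (simp only: sum_distrib_right)
  show ?thesis unfolding eq by (rule int)
qed

text \<open>Every pair of summands contributes at most \<open>121 * b\<^sup>2 * \<phi> t\<close>: separated pairs by decoupling twice, the others by
\<open>x * y \<le> (x\<^sup>2 + y\<^sup>2) / 2\<close> and decoupling once.\<close>
lemma tE_square_sum_le:
  assumes t: "\<bar>t\<bar> \<le> \<tau>" and loc: "\<And>i. i \<in> J \<Longrightarrow> F i \<in> borel_measurable (loc (A i))"
    and F: "\<And>i \<omega>. i \<in> J \<Longrightarrow> 0 \<le> F i \<omega>" "\<And>i \<omega>. i \<in> J \<Longrightarrow> F i \<omega> \<le> exp (a * S i \<omega> / 32)"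
  shows "tE t (\<lambda>\<omega>. (\<Sum>i\<in>J. F i \<omega>)\<^sup>2) \<le> 121 * (b * real (card J))\<^sup>2 * \<phi> t"
proof -
  have Fm: "F i \<in> borel_measurable M" if "i \<in> J" for i by (rule loc_meas[OF A_sub_J[OF that] loc[OF that]])
  have mono: "exp (a * S i \<omega> / 32) \<le> exp (a * S i \<omega> / 16)" "exp (a * S i \<omega> / 32) \<le> exp (a * S i \<omega> / 4)" for i \<omega>
    using aS_nonneg[of i \<omega>] by auto
  have int: "integrable M (\<lambda>\<omega>. F i \<omega> * F j \<omega> * exp (t * W \<omega>))" if ij: "i \<in> J" "j \<in> J" for i j
    using prod_sum_integrable[OF t W_meas abs_W_le_L, of "{i}" "{j}" F 1 F 1]
    using ij Fm F(1) order_trans[OF F(2) mono(2)] by simp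
  have pair: "tE t (\<lambda>\<omega>. F i \<omega> * F j \<omega>) \<le> 121 * b\<^sup>2 * \<phi> t" if ij: "i \<in> J" "j \<in> J" for i j
  proof (cases "A j \<inter> B i = {}")
    case True
    show ?thesis
      by (rule tE_separated_le[OF ij True t loc[OF ij(1)] _ _ loc[OF ij(2)]])
         (use F ij order_trans[OF F(2) mono(1)] in auto)
  next
    case False
    have sq: "tE t (\<lambda>\<omega>. (F k \<omega>)\<^sup>2) \<le> 13 * b * \<phi> t" if k: "k \<in> J" for k
    proof (rule tE_local_le[OF k t])
      show "(\<lambda>\<omega>. (F k \<omega>)\<^sup>2) \<in> borel_measurable (loc (A k))" using loc[OF k] by measurable
      fix \<omega>
      have "(F k \<omega>)\<^sup>2 \<le> (exp (a * S k \<omega> / 32))\<^sup>2" using F k by (intro power_mono) auto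
      then show "(F k \<omega>)\<^sup>2 \<le> exp (a * S k \<omega> / 16)" by (simp flip: exp_double)
    qed auto
    have "tE t (\<lambda>\<omega>. F i \<omega> * F j \<omega>) \<le> tE t (\<lambda>\<omega>. (F i \<omega>)\<^sup>2 / 2 + (F j \<omega>)\<^sup>2 / 2)"
      unfolding tE_def
    proof (intro integral_mono int ij)
      show "integrable M (\<lambda>\<omega>. ((F i \<omega>)\<^sup>2 / 2 + (F j \<omega>)\<^sup>2 / 2) * exp (t * W \<omega>))"
        using int[OF ij(1) ij(1)] int[OF ij(2) ij(2)] by (simp add: power2_eq_square ring_distribs)
      fix \<omega>
      have "F i \<omega> * F j \<omega> \<le> (F i \<omega>)\<^sup>2 / 2 + (F j \<omega>)\<^sup>2 / 2" using sum_squares_bound[of "F i \<omega>" "F j \<omega>"] by simp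
      then show "F i \<omega> * F j \<omega> * exp (t * W \<omega>) \<le> ((F i \<omega>)\<^sup>2 / 2 + (F j \<omega>)\<^sup>2 / 2) * exp (t * W \<omega>)"
        by (intro mult_right_mono) auto
    qed
    also have "\<dots> = tE t (\<lambda>\<omega>. (F i \<omega>)\<^sup>2) / 2 + tE t (\<lambda>\<omega>. (F j \<omega>)\<^sup>2) / 2"
      unfolding tE_def using int[OF ij(1) ij(1)] int[OF ij(2) ij(2)] by (simp add: power2_eq_square ring_distribs)
    also have "\<dots> \<le> 13 * b * \<phi> t" using sq[OF ij(1)] sq[OF ij(2)] by simp
    also have "\<dots> \<le> 121 * b\<^sup>2 * \<phi> t"
      using b_ge_1 phi_ge_1[OF t] mult_mono[of 13 121 b "b\<^sup>2"] self_le_power[of b 2]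
      by (intro mult_right_mono) auto
    finally show ?thesis .
  qed
  have "tE t (\<lambda>\<omega>. (\<Sum>i\<in>J. F i \<omega>)\<^sup>2) = (\<Sum>i\<in>J. \<Sum>j\<in>J. tE t (\<lambda>\<omega>. F i \<omega> * F j \<omega>))"
  proof -
    have eq: "(\<Sum>i\<in>J. F i \<omega>)\<^sup>2 * exp (t * W \<omega>) = (\<Sum>i\<in>J. \<Sum>j\<in>J. F i \<omega> * F j \<omega> * exp (t * W \<omega>))" for \<omega>
      unfolding power2_eq_square by (subst sum_product) (simp only: sum_distrib_right)
    have "expectation (\<lambda>\<omega>. \<Sum>i\<in>J. \<Sum>j\<in>J. F i \<omega> * F j \<omega> * exp (t * W \<omega>))
        = (\<Sum>i\<in>J. expectation (\<lambda>\<omega>. \<Sum>j\<in>J. F i \<omega> * F j \<omega> * exp (t * W \<omega>)))"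
      by (intro Bochner_Integration.integral_sum Bochner_Integration.integrable_sum int)
    also have "\<dots> = (\<Sum>i\<in>J. \<Sum>j\<in>J. expectation (\<lambda>\<omega>. F i \<omega> * F j \<omega> * exp (t * W \<omega>)))"
      by (intro sum.cong refl Bochner_Integration.integral_sum int)
    finally show ?thesis unfolding tE_def eq .
  qed
  also have "\<dots> \<le> (\<Sum>i\<in>J. \<Sum>j\<in>J. 121 * b\<^sup>2 * \<phi> t)" by (intro sum_mono pair)
  also have "\<dots> = 121 * (b * real (card J))\<^sup>2 * \<phi> t" by (simp add: power2_eq_square)
  finally show ?thesis .
qed

section \<open>Concentration of sums of local functions under tilts\<close>

text \<open>A function of \<open>X\<close> on \<open>B i\<close> is bounded by a sum of functions of single variables, each of which is
local. Jensen's inequality multiplies the exponent by the cardinality of \<open>B i\<close>, at most \<kappa>, and \<open>\<kappa> * \<tau>\<close> is small compared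
with a.\<close>
lemma S_exp_tau_S_le:
  assumes i: "i \<in> J"
  shows "S i \<omega> * exp (\<tau> * S i \<omega>) \<le> 128 / a * (\<Sum>j\<in>B i. exp (a * \<bar>X j \<omega>\<bar> / 64))"
proof -
  define m where "m = real (card (B i))"
  have m: "0 < m" "m \<le> real \<kappa>" using card_B_pos[OF i] card_B[OF i] by (auto simp: m_def)
  \<comment> \<open>The polynomial factor \<open>S i\<close> costs an exponent s so small that \<open>m * s\<close> is still a fraction of a.\<close>
  define s where "s = a / (128 * m)"
  have s: "0 < s" using m a_pos by (simp add: s_def)
  have "S i \<omega> ^ 1 \<le> fact 1 / s ^ 1 * exp (s * S i \<omega>)"
    by (rule power_le_exp_scaled[OF S_nonneg s])
  then have "S i \<omega> * exp (\<tau> * S i \<omega>) \<le> (1 / s * exp (s * S i \<omega>)) * exp (\<tau> * S i \<omega>)"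
    by (intro mult_right_mono) auto
  also have "\<dots> = 1 / s * exp (\<Sum>j\<in>B i. (s + \<tau>) * \<bar>X j \<omega>\<bar>)"
  proof -
    have "(\<Sum>j\<in>B i. (s + \<tau>) * \<bar>X j \<omega>\<bar>) = (s + \<tau>) * S i \<omega>" by (simp add: S_def sum_distrib_left)
    then have "exp (\<Sum>j\<in>B i. (s + \<tau>) * \<bar>X j \<omega>\<bar>) = exp (s * S i \<omega>) * exp (\<tau> * S i \<omega>)"
      by (simp only: distrib_right exp_add)
    then show ?thesis by (simp only: mult.assoc)
  qed
  also have "\<dots> \<le> 1 / s * ((\<Sum>j\<in>B i. exp (m * ((s + \<tau>) * \<bar>X j \<omega>\<bar>))) / m)"
    unfolding m_def using s finite_B[OF i] self_in_B[OF i]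
    by (intro mult_left_mono exp_sum_le_average) auto
  also have "\<dots> \<le> 1 / s * ((\<Sum>j\<in>B i. exp (a * \<bar>X j \<omega>\<bar> / 64)) / m)"
  proof -
    have "m * \<tau> \<le> real \<kappa> * \<tau>" using m tau_ge_1 by (intro mult_right_mono) auto
    moreover have "0 \<le> m * \<tau>" using m tau_ge_1 by simp
    moreover have "m * s = a / 128" using m by (simp add: s_def)
    ultimately have "m * (s + \<tau>) \<le> a / 64" using small_pieces(1) by (simp add: distrib_left)
    note le = this
    have "m * ((s + \<tau>) * x) \<le> a * x / 64" if "0 \<le> x" for x
      using mult_right_mono[OF le that] by (simp only: mult.assoc times_divide_eq_left)
    then have "exp (m * ((s + \<tau>) * \<bar>X j \<omega>\<bar>)) \<le> exp (a * \<bar>X j \<omega>\<bar> / 64)" for j by simp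
    then show ?thesis
      by (intro mult_left_mono divide_right_mono sum_mono) (use s m in auto)
  qed
  also have "\<dots> = 128 / a * (\<Sum>j\<in>B i. exp (a * \<bar>X j \<omega>\<bar> / 64))"
    using m a_pos by (simp add: s_def field_simps)
  finally show ?thesis .
qed

context
  fixes F :: "'i \<Rightarrow> 'a \<Rightarrow> real" and t :: real
  assumes t: "\<bar>t\<bar> \<le> \<tau>"
    and loc: "\<And>i. i \<in> J \<Longrightarrow> F i \<in> borel_measurable (loc (A i))"
    and F: "\<And>i \<omega>. i \<in> J \<Longrightarrow> \<bar>F i \<omega>\<bar> \<le> exp (a * S i \<omega> / 64)"
begin

definition "centred i \<omega> = F i \<omega> - expectation (F i)"
text \<open>A bound, by squares of sums of local functions, for the square of the error term that appears when the neighbourhoods are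
removed from W.\<close>
definition "majorant \<omega> = (64 * real \<kappa> / a)\<^sup>2 *
   (18 * (\<Sum>j\<in>J. (2 * (F j \<omega>)\<^sup>2 + exp (a * \<bar>X j \<omega>\<bar> / 32)) / 3)\<^sup>2 + 8 * (b * real (card J))\<^sup>2)"

lemma F_meas: "i \<in> J \<Longrightarrow> F i \<in> borel_measurable M"
  by (rule loc_meas[OF A_sub_J loc])

lemma F_integrable: "i \<in> J \<Longrightarrow> integrable M (F i)"
proof -
  assume i: "i \<in> J"
  show ?thesis
  proof (rule integrable_le_exp_S[OF i F_meas[OF i]])
    fix \<omega> show "\<bar>F i \<omega>\<bar> \<le> 1 * exp (a * S i \<omega>)"
      using order_trans[OF F[OF i, of \<omega>]] aS_nonneg[of i \<omega>] by simp
  qed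
qed

lemma F_sq_le: "i \<in> J \<Longrightarrow> (F i \<omega>)\<^sup>2 \<le> exp (a * S i \<omega> / 32)"
proof -
  assume i: "i \<in> J"
  have "\<bar>F i \<omega>\<bar>\<^sup>2 \<le> (exp (a * S i \<omega> / 64))\<^sup>2" by (intro power_mono F i) auto
  then show ?thesis by (simp flip: exp_double)
qed

lemma mean_sq_le: "i \<in> J \<Longrightarrow> (expectation (F i))\<^sup>2 \<le> b"
proof -
  assume i: "i \<in> J"
  have m: "(\<lambda>\<omega>. (F i \<omega>)\<^sup>2) \<in> borel_measurable M" using F_meas[OF i] by measurable
  have le: "(F i \<omega>)\<^sup>2 \<le> exp (a * S i \<omega>)" for \<omega>
    by (rule order_trans[OF F_sq_le[OF i]]) (use aS_nonneg[of i \<omega>] in simp)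
  have sq: "integrable M (\<lambda>\<omega>. (F i \<omega>)\<^sup>2)" by (rule integrable_le_exp_S[OF i m, of 1]) (use le in auto)
  have "0 \<le> variance (F i)" by (rule variance_positive)
  then have "(expectation (F i))\<^sup>2 \<le> expectation (\<lambda>\<omega>. (F i \<omega>)\<^sup>2)"
    using variance_eq[OF F_integrable[OF i] sq] by simp
  also have "\<dots> \<le> b" by (rule local_expectation_le[OF i m le]) auto
  finally show ?thesis .
qed

lemma centred_meas: "i \<in> J \<Longrightarrow> centred i \<in> borel_measurable M"
  unfolding centred_def using F_meas by measurable

lemma centred_loc: "i \<in> J \<Longrightarrow> centred i \<in> borel_measurable (loc (A i))"
  unfolding centred_def using loc by measurable

lemma centred_sq_le: "i \<in> J \<Longrightarrow> (centred i \<omega>)\<^sup>2 \<le> 2 * (F i \<omega>)\<^sup>2 + 2 * b"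
proof -
  assume i: "i \<in> J"
  have "(centred i \<omega>)\<^sup>2 \<le> 2 * (F i \<omega>)\<^sup>2 + 2 * (expectation (F i))\<^sup>2"
    unfolding centred_def using zero_le_power2[of "F i \<omega> + expectation (F i)"] by (simp add: power2_sum power2_diff)
  then show ?thesis using mean_sq_le[OF i] by simp
qed

lemma centred_le: "i \<in> J \<Longrightarrow> \<bar>centred i \<omega>\<bar> \<le> (1 + b) * exp (a * S i \<omega> / 64)"
proof -
  assume i: "i \<in> J"
  have "(expectation (F i))\<^sup>2 \<le> b\<^sup>2" using mean_sq_le[OF i] self_le_power[of b 2] b_ge_1 by simp
  then have "\<bar>expectation (F i)\<bar> \<le> b" using b_ge_1 by (simp add: abs_le_square_iff[symmetric])
  also have "b \<le> b * exp (a * S i \<omega> / 64)" using aS_nonneg[of i \<omega>] b_ge_1 by simp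
  finally have "\<bar>expectation (F i)\<bar> \<le> b * exp (a * S i \<omega> / 64)" .
  then show ?thesis unfolding centred_def using F[OF i, of \<omega>] by (simp add: distrib_right)
qed

lemma centred_le': "i \<in> J \<Longrightarrow> \<bar>centred i \<omega>\<bar> \<le> (1 + b) * exp (a * S i \<omega> / 4)"
  by (rule order_trans[OF centred_le]) (use aS_nonneg[of i \<omega>] b_ge_1 in auto)

lemma centred_mean: "i \<in> J \<Longrightarrow> expectation (centred i) = 0"
  unfolding centred_def using F_integrable prob_space by simp

lemma centred_integrable: "i \<in> J \<Longrightarrow> integrable M (centred i)"
  unfolding centred_def using F_integrable by simp

lemma centred_prod_integrable:
  assumes "R \<in> borel_measurable M" "\<And>\<omega>. \<bar>R \<omega>\<bar> \<le> L \<omega>" "T \<subseteq> J" "T' \<subseteq> J"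
  shows "integrable M (\<lambda>\<omega>. (\<Sum>i\<in>T. centred i \<omega>) * (\<Sum>j\<in>T'. centred j \<omega>) * exp (t * R \<omega>))"
  by (rule prod_sum_integrable[OF t assms centred_meas centred_le' centred_meas centred_le'])

lemma tE_centred_summand_sq_le:
  assumes i: "i \<in> J"
  shows "tE t (\<lambda>\<omega>. (centred i \<omega>)\<^sup>2) \<le> 28 * b * \<phi> t"
proof -
  have F4: "\<bar>F i \<omega>\<bar> \<le> 1 * exp (a * S i \<omega> / 4)" if "i \<in> J" for i \<omega>
    using order_trans[OF F[OF that, of \<omega>]] aS_nonneg[of i \<omega>] by simp
  have int: "integrable M (\<lambda>\<omega>. (F i \<omega>)\<^sup>2 * exp (t * W \<omega>))"
    using prod_sum_integrable[OF t W_meas abs_W_le_L, of "{i}" "{i}" F 1 F 1] i F4 F_meas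
    by (simp add: power2_eq_square)
  have "tE t (\<lambda>\<omega>. (centred i \<omega>)\<^sup>2) \<le> expectation (\<lambda>\<omega>. (2 * (F i \<omega>)\<^sup>2 + 2 * b) * exp (t * W \<omega>))"
    unfolding tE_def
  proof (intro integral_mono)
    show "integrable M (\<lambda>\<omega>. (centred i \<omega>)\<^sup>2 * exp (t * W \<omega>))"
      using centred_prod_integrable[OF W_meas abs_W_le_L, of "{i}" "{i}"] i by (simp add: power2_eq_square)
    show "integrable M (\<lambda>\<omega>. (2 * (F i \<omega>)\<^sup>2 + 2 * b) * exp (t * W \<omega>))"
      using int exp_tW_integrable[OF t] by (simp add: ring_distribs mult.assoc)
  qed (use centred_sq_le[OF i] in \<open>auto intro!: mult_right_mono\<close>)
  also have "\<dots> = 2 * tE t (\<lambda>\<omega>. (F i \<omega>)\<^sup>2) + 2 * b * \<phi> t"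
    unfolding tE_def \<phi>_def using int exp_tW_integrable[OF t] by (simp add: ring_distribs mult.assoc)
  also have "tE t (\<lambda>\<omega>. (F i \<omega>)\<^sup>2) \<le> 13 * b * \<phi> t"
  proof (rule tE_local_le[OF i t])
    show "(\<lambda>\<omega>. (F i \<omega>)\<^sup>2) \<in> borel_measurable (loc (A i))" using loc[OF i] by measurable
    fix \<omega> show "(F i \<omega>)\<^sup>2 \<le> exp (a * S i \<omega> / 16)"
      by (rule order_trans[OF F_sq_le[OF i]]) (use aS_nonneg[of i \<omega>] in simp)
  qed auto
  finally show ?thesis by simp
qed

text \<open>The product of \<open>centred i\<close> with a function of a single variable is separated by \<open>2 * x * y \<le> x\<^sup>2 + y\<^sup>2\<close>, and double
counting reduces the sum over i and \<open>j \<in> B i\<close> to \<kappa> times a sum over J.\<close>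
lemma majorant_bound:
  "(\<Sum>i\<in>J. \<bar>centred i \<omega>\<bar> * (S i \<omega> * exp (\<tau> * S i \<omega>)))\<^sup>2 \<le> majorant \<omega>"
proof -
  define \<psi> where "\<psi> j = (2 * (F j \<omega>)\<^sup>2 + exp (a * \<bar>X j \<omega>\<bar> / 32)) / 3" for j
  have \<psi>: "0 \<le> \<psi> j" for j by (simp add: \<psi>_def)
  have one: "\<bar>centred i \<omega>\<bar> * (S i \<omega> * exp (\<tau> * S i \<omega>))
      \<le> 64 / a * (\<Sum>j\<in>B i. ((centred i \<omega>)\<^sup>2 + exp (a * \<bar>X j \<omega>\<bar> / 32)))" if i: "i \<in> J" for i
  proof -
    have "\<bar>centred i \<omega>\<bar> * (S i \<omega> * exp (\<tau> * S i \<omega>)) \<le> \<bar>centred i \<omega>\<bar> * (128 / a * (\<Sum>j\<in>B i. exp (a * \<bar>X j \<omega>\<bar> / 64)))"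
      by (intro mult_left_mono S_exp_tau_S_le[OF i]) auto
    also have "\<dots> = 64 / a * (\<Sum>j\<in>B i. 2 * (\<bar>centred i \<omega>\<bar> * exp (a * \<bar>X j \<omega>\<bar> / 64)))"
      by (simp add: sum_distrib_left mult_ac)
    also have "\<dots> \<le> 64 / a * (\<Sum>j\<in>B i. ((centred i \<omega>)\<^sup>2 + exp (a * \<bar>X j \<omega>\<bar> / 32)))"
    proof (intro mult_left_mono sum_mono)
      fix j
      have "2 * (\<bar>centred i \<omega>\<bar> * exp (a * \<bar>X j \<omega>\<bar> / 64)) \<le> \<bar>centred i \<omega>\<bar>\<^sup>2 + (exp (a * \<bar>X j \<omega>\<bar> / 64))\<^sup>2"
        using sum_squares_bound[of "\<bar>centred i \<omega>\<bar>" "exp (a * \<bar>X j \<omega>\<bar> / 64)"] by (simp add: mult.assoc)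
      also have "\<dots> = (centred i \<omega>)\<^sup>2 + exp (a * \<bar>X j \<omega>\<bar> / 32)" by (simp flip: exp_double)
      finally show "2 * (\<bar>centred i \<omega>\<bar> * exp (a * \<bar>X j \<omega>\<bar> / 64)) \<le> (centred i \<omega>)\<^sup>2 + exp (a * \<bar>X j \<omega>\<bar> / 32)" .
    qed (use a_pos in auto)
    finally show ?thesis .
  qed
  have "(\<Sum>i\<in>J. \<bar>centred i \<omega>\<bar> * (S i \<omega> * exp (\<tau> * S i \<omega>)))
      \<le> (\<Sum>i\<in>J. 64 / a * (\<Sum>j\<in>B i. ((centred i \<omega>)\<^sup>2 + exp (a * \<bar>X j \<omega>\<bar> / 32))))"
    by (intro sum_mono one)
  also have "\<dots> = 64 / a * ((\<Sum>i\<in>J. real (card (B i)) * (centred i \<omega>)\<^sup>2) + (\<Sum>i\<in>J. \<Sum>j\<in>B i. exp (a * \<bar>X j \<omega>\<bar> / 32)))"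
    by (simp add: sum.distrib sum_distrib_left[symmetric] del: times_divide_eq_left)
  also have "\<dots> \<le> 64 / a * ((\<Sum>i\<in>J. real \<kappa> * (centred i \<omega>)\<^sup>2) + real \<kappa> * (\<Sum>j\<in>J. exp (a * \<bar>X j \<omega>\<bar> / 32)))"
    using a_pos B_sub_J card_B card_B_inv
    by (intro mult_left_mono add_mono sum_mono mult_right_mono sum_overlap_le) auto
  also have "\<dots> = 64 * real \<kappa> / a * (\<Sum>i\<in>J. ((centred i \<omega>)\<^sup>2 + exp (a * \<bar>X i \<omega>\<bar> / 32)))"
    by (simp add: sum.distrib sum_distrib_left[symmetric] distrib_left)
  also have "\<dots> \<le> 64 * real \<kappa> / a * (\<Sum>i\<in>J. (3 * \<psi> i + 2 * b))"
  proof (intro mult_left_mono sum_mono)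
    fix i assume i: "i \<in> J"
    have "3 * \<psi> i = 2 * (F i \<omega>)\<^sup>2 + exp (a * \<bar>X i \<omega>\<bar> / 32)" by (simp add: \<psi>_def)
    then show "(centred i \<omega>)\<^sup>2 + exp (a * \<bar>X i \<omega>\<bar> / 32) \<le> 3 * \<psi> i + 2 * b"
      using centred_sq_le[OF i, of \<omega>] by linarith
  qed (use a_pos in auto)
  also have "\<dots> = 64 * real \<kappa> / a * (3 * (\<Sum>i\<in>J. \<psi> i) + 2 * (b * real (card J)))"
    by (simp add: sum.distrib sum_distrib_left[symmetric])
  finally have "(\<Sum>i\<in>J. \<bar>centred i \<omega>\<bar> * (S i \<omega> * exp (\<tau> * S i \<omega>)))\<^sup>2
      \<le> (64 * real \<kappa> / a * (3 * (\<Sum>i\<in>J. \<psi> i) + 2 * (b * real (card J))))\<^sup>2"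
    by (intro power_mono sum_nonneg mult_nonneg_nonneg S_nonneg) auto
  also have "\<dots> = (64 * real \<kappa> / a)\<^sup>2 * (3 * (\<Sum>i\<in>J. \<psi> i) + 2 * (b * real (card J)))\<^sup>2"
    by (rule power_mult_distrib)
  also have "\<dots> \<le> (64 * real \<kappa> / a)\<^sup>2 * (18 * (\<Sum>i\<in>J. \<psi> i)\<^sup>2 + 8 * (b * real (card J))\<^sup>2)"
  proof (rule mult_left_mono)
    have "(3 * x + 2 * y)\<^sup>2 \<le> 18 * x\<^sup>2 + 8 * y\<^sup>2" for x y :: real
      using zero_le_power2[of "3 * x - 2 * y"] by (simp add: power2_sum power2_diff power_mult_distrib)
    then show "(3 * (\<Sum>i\<in>J. \<psi> i) + 2 * (b * real (card J)))\<^sup>2 \<le> 18 * (\<Sum>i\<in>J. \<psi> i)\<^sup>2 + 8 * (b * real (card J))\<^sup>2" .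
  qed simp
  finally show ?thesis unfolding majorant_def \<psi>_def .
qed

lemma majorant_tE:
  "integrable M (\<lambda>\<omega>. majorant \<omega> * exp (t * W \<omega>))"
  "tE t majorant \<le> 9 * 10 ^ 6 * (real \<kappa> * (b * real (card J)) / a)\<^sup>2 * \<phi> t"
proof -
  define \<psi> where "\<psi> j \<omega> = (2 * (F j \<omega>)\<^sup>2 + exp (a * \<bar>X j \<omega>\<bar> / 32)) / 3" for j \<omega>
  have loc\<psi>: "\<psi> j \<in> borel_measurable (loc (A j))" if "j \<in> J" for j
    unfolding \<psi>_def using loc[OF that] X_loc[OF self_in[OF that]] by measurable
  have \<psi>0: "0 \<le> \<psi> j \<omega>" for j \<omega> by (simp add: \<psi>_def)
  have \<psi>le: "\<psi> j \<omega> \<le> exp (a * S j \<omega> / 32)" if j: "j \<in> J" for j \<omega>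
  proof -
    have "exp (a * \<bar>X j \<omega>\<bar> / 32) \<le> exp (a * S j \<omega> / 32)"
      using abs_X_le_S[OF j self_in_B[OF j]] a_pos by simp
    then have "\<psi> j \<omega> \<le> (2 * exp (a * S j \<omega> / 32) + exp (a * S j \<omega> / 32)) / 3"
      unfolding \<psi>_def by (intro divide_right_mono add_mono mult_left_mono F_sq_le[OF j]) auto
    then show ?thesis by simp
  qed
  have \<psi>4: "\<bar>\<psi> j \<omega>\<bar> \<le> 1 * exp (a * S j \<omega> / 4)" if j: "j \<in> J" for j \<omega>
    using order_trans[OF \<psi>le[OF j, of \<omega>], of "exp (a * S j \<omega> / 4)"] aS_nonneg[of j \<omega>] \<psi>0 by simp
  have \<psi>m: "\<psi> j \<in> borel_measurable M" if "j \<in> J" for j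
    by (rule loc_meas[OF A_sub_J[OF that] loc\<psi>[OF that]])
  have int: "integrable M (\<lambda>\<omega>. (\<Sum>j\<in>J. \<psi> j \<omega>)\<^sup>2 * exp (t * W \<omega>))"
    using prod_sum_integrable[OF t W_meas abs_W_le_L subset_refl subset_refl \<psi>m \<psi>4 \<psi>m \<psi>4]
    by (simp add: power2_eq_square)
  define c where "c = (64 * real \<kappa> / a)\<^sup>2"
  define n where "n = (b * real (card J))\<^sup>2"
  have maj: "majorant \<omega> * exp (t * W \<omega>)
      = 18 * c * ((\<Sum>j\<in>J. \<psi> j \<omega>)\<^sup>2 * exp (t * W \<omega>)) + 8 * c * n * exp (t * W \<omega>)" for \<omega>
    unfolding majorant_def \<psi>_def c_def n_def by (simp add: ring_distribs)
  show "integrable M (\<lambda>\<omega>. majorant \<omega> * exp (t * W \<omega>))"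
    unfolding maj using int exp_tW_integrable[OF t] by simp
  have "tE t majorant = 18 * c * tE t (\<lambda>\<omega>. (\<Sum>j\<in>J. \<psi> j \<omega>)\<^sup>2) + 8 * c * n * \<phi> t"
    unfolding tE_def maj \<phi>_def using int exp_tW_integrable[OF t] by simp
  also have "\<dots> \<le> 18 * c * (121 * n * \<phi> t) + 8 * c * n * \<phi> t"
    unfolding n_def using tE_square_sum_le[OF t loc\<psi> \<psi>0 \<psi>le]
    by (intro add_right_mono mult_left_mono) (auto simp: c_def)
  also have "\<dots> = 2186 * (c * n * \<phi> t)" by simp
  also have "c * n = 4096 * (real \<kappa> * (b * real (card J)) / a)\<^sup>2"
    by (simp add: c_def n_def power_mult_distrib power_divide)
  also have "2186 * (4096 * (real \<kappa> * (b * real (card J)) / a)\<^sup>2 * \<phi> t)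
      \<le> 9 * 10 ^ 6 * (real \<kappa> * (b * real (card J)) / a)\<^sup>2 * \<phi> t"
    using phi_ge_1[OF t] by (simp add: mult.assoc[symmetric] mult_right_mono)
  finally show "tE t majorant \<le> 9 * 10 ^ 6 * (real \<kappa> * (b * real (card J)) / a)\<^sup>2 * \<phi> t" .
qed

lemma abs_exp_diff_le:
  "\<bar>exp (t * W \<omega>) - exp (t * (W \<omega> - Z i \<omega>))\<bar> \<le> \<tau> * (S i \<omega> * exp (\<tau> * S i \<omega>)) * exp (t * W \<omega>)"
proof -
  have tz: "\<bar>- (t * Z i \<omega>)\<bar> \<le> \<tau> * S i \<omega>"
    unfolding abs_minus_cancel abs_mult using t tau_ge_1 by (intro mult_mono abs_Z_le_S) auto
  have "\<bar>exp (t * W \<omega>) - exp (t * (W \<omega> - Z i \<omega>))\<bar> = \<bar>exp (- (t * Z i \<omega>)) - 1\<bar> * exp (t * W \<omega>)"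
  proof -
    have "exp (t * (W \<omega> - Z i \<omega>)) = exp (- (t * Z i \<omega>)) * exp (t * W \<omega>)"
      by (simp add: right_diff_distrib flip: exp_add)
    then have "exp (t * W \<omega>) - exp (t * (W \<omega> - Z i \<omega>)) = - ((exp (- (t * Z i \<omega>)) - 1) * exp (t * W \<omega>))"
      by (simp add: algebra_simps)
    then show ?thesis by (simp only: abs_minus_cancel abs_mult abs_exp_cancel)
  qed
  also have "\<dots> \<le> (\<bar>- (t * Z i \<omega>)\<bar> * exp \<bar>- (t * Z i \<omega>)\<bar>) * exp (t * W \<omega>)"
    by (intro mult_right_mono abs_exp_minus_one_le) auto
  also have "\<dots> \<le> (\<tau> * S i \<omega> * exp (\<tau> * S i \<omega>)) * exp (t * W \<omega>)"
    using tz by (intro mult_right_mono mult_mono) auto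
  finally show ?thesis by (simp add: mult.assoc)
qed

text \<open>Write the square as a sum over i of \<open>centred i\<close> times the full sum. Replacing the full sum by its part over \<open>J - D i\<close>
and \<open>exp (t * W)\<close> by \<open>exp (t * (W - Z i))\<close> gives the terms of the first sum on the right, which have mean zero. The
replacement errors contain the full sum at most linearly, so half of its square absorbs them; this half is moved to
the left, whence the factor 2.\<close>
lemma centred_sq_pointwise:
  "(\<Sum>i\<in>J. centred i \<omega>)\<^sup>2 * exp (t * W \<omega>)
     \<le> 2 * (\<Sum>i\<in>J. centred i \<omega> * (\<Sum>j\<in>J - D i. centred j \<omega>) * exp (t * (W \<omega> - Z i \<omega>)))
      + (2 * \<tau>\<^sup>2 * majorant \<omega> + 3 * (real \<kappa>)\<^sup>2 * (\<Sum>i\<in>J. (centred i \<omega>)\<^sup>2)) * exp (t * W \<omega>)"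
proof -
  define \<Xi> where "\<Xi> = (\<Sum>i\<in>J. centred i \<omega>)"
  \<comment> \<open>The full sum splits into \<open>De i\<close>, the part close to i, and the remainder \<open>Xr i\<close>.\<close>
  define De where "De i = (\<Sum>j\<in>D i. centred j \<omega>)" for i
  define Xr where "Xr i = (\<Sum>j\<in>J - D i. centred j \<omega>)" for i
  define U where "U i = \<bar>centred i \<omega>\<bar> * (S i \<omega> * exp (\<tau> * S i \<omega>))" for i
  define E where "E = exp (t * W \<omega>)"
  define e where "e i = exp (t * (W \<omega> - Z i \<omega>))" for i
  have E0: "0 \<le> E" by (simp add: E_def)
  have split: "\<Xi> = Xr i + De i" for i
    unfolding \<Xi>_def De_def Xr_def by (rule sum.subset_diff[OF D_sub finite_J])
  have U0: "0 \<le> U i" for i by (simp add: U_def S_nonneg)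
  have one: "centred i \<omega> * \<Xi> * E - centred i \<omega> * Xr i * e i
      \<le> ((centred i \<omega>)\<^sup>2 / 2 + (De i)\<^sup>2 + \<tau> * \<bar>\<Xi>\<bar> * U i + \<tau>\<^sup>2 / 2 * (U i)\<^sup>2) * E" for i
  proof -
    have "centred i \<omega> * \<Xi> * E - centred i \<omega> * Xr i * e i = centred i \<omega> * De i * E + centred i \<omega> * Xr i * (E - e i)"
      by (simp add: split[of i] algebra_simps)
    also have "\<dots> \<le> \<bar>centred i \<omega>\<bar> * \<bar>De i\<bar> * E + \<bar>centred i \<omega>\<bar> * \<bar>Xr i\<bar> * (\<tau> * (S i \<omega> * exp (\<tau> * S i \<omega>)) * E)"
    proof (rule add_mono)
      show "centred i \<omega> * De i * E \<le> \<bar>centred i \<omega>\<bar> * \<bar>De i\<bar> * E"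
        unfolding abs_mult[symmetric] by (intro mult_right_mono abs_ge_self E0)
      have "centred i \<omega> * Xr i * (E - e i) \<le> \<bar>centred i \<omega>\<bar> * \<bar>Xr i\<bar> * \<bar>E - e i\<bar>"
        unfolding abs_mult[symmetric] by (rule abs_ge_self)
      also have "\<dots> \<le> \<bar>centred i \<omega>\<bar> * \<bar>Xr i\<bar> * (\<tau> * (S i \<omega> * exp (\<tau> * S i \<omega>)) * E)"
        unfolding E_def e_def by (intro mult_left_mono abs_exp_diff_le) auto
      finally show "centred i \<omega> * Xr i * (E - e i) \<le> \<dots>" .
    qed
    also have "\<dots> = (\<bar>centred i \<omega>\<bar> * \<bar>De i\<bar> + \<tau> * U i * \<bar>Xr i\<bar>) * E"
      by (simp add: U_def algebra_simps)
    also have "\<dots> \<le> ((centred i \<omega>)\<^sup>2 / 2 + (De i)\<^sup>2 + \<tau> * \<bar>\<Xi>\<bar> * U i + \<tau>\<^sup>2 / 2 * (U i)\<^sup>2) * E"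
    proof (rule mult_right_mono[OF _ E0])
      have "\<bar>Xr i\<bar> \<le> \<bar>\<Xi>\<bar> + \<bar>De i\<bar>" using split[of i] by linarith
      then have "\<tau> * U i * \<bar>Xr i\<bar> \<le> \<tau> * U i * (\<bar>\<Xi>\<bar> + \<bar>De i\<bar>)"
        using U0[of i] tau_ge_1 by (intro mult_left_mono) auto
      moreover have "2 * (\<tau> * U i) * \<bar>De i\<bar> \<le> (\<tau> * U i)\<^sup>2 + \<bar>De i\<bar>\<^sup>2" by (rule sum_squares_bound)
      moreover have "2 * \<bar>centred i \<omega>\<bar> * \<bar>De i\<bar> \<le> \<bar>centred i \<omega>\<bar>\<^sup>2 + \<bar>De i\<bar>\<^sup>2" by (rule sum_squares_bound)
      ultimately show "\<bar>centred i \<omega>\<bar> * \<bar>De i\<bar> + \<tau> * U i * \<bar>Xr i\<bar>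
          \<le> (centred i \<omega>)\<^sup>2 / 2 + (De i)\<^sup>2 + \<tau> * \<bar>\<Xi>\<bar> * U i + \<tau>\<^sup>2 / 2 * (U i)\<^sup>2"
        by (simp add: power_mult_distrib algebra_simps)
    qed
    finally show ?thesis .
  qed
  have De2: "(\<Sum>i\<in>J. (De i)\<^sup>2) \<le> (real \<kappa>)\<^sup>2 * (\<Sum>i\<in>J. (centred i \<omega>)\<^sup>2)"
  proof -
    have "(De i)\<^sup>2 \<le> real \<kappa> * (\<Sum>j\<in>D i. (centred j \<omega>)\<^sup>2)" if i: "i \<in> J" for i
    proof -
      have "(De i)\<^sup>2 \<le> (\<Sum>j\<in>D i. (centred j \<omega>)\<^sup>2) * real (card (D i))"
        unfolding De_def by (rule sum_squared_le_sum_of_squares)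
      also have "\<dots> \<le> (\<Sum>j\<in>D i. (centred j \<omega>)\<^sup>2) * real \<kappa>"
        using card_D[OF i] by (intro mult_left_mono) (auto intro: sum_nonneg)
      finally show ?thesis by (simp add: mult.commute)
    qed
    then have "(\<Sum>i\<in>J. (De i)\<^sup>2) \<le> real \<kappa> * (\<Sum>i\<in>J. \<Sum>j\<in>D i. (centred j \<omega>)\<^sup>2)"
      by (simp add: sum_distrib_left sum_mono)
    also have "\<dots> \<le> real \<kappa> * (real \<kappa> * (\<Sum>j\<in>J. (centred j \<omega>)\<^sup>2))"
      by (intro mult_left_mono sum_overlap_le D_sub card_D_inv) auto
    finally show ?thesis by (simp add: power2_eq_square mult.assoc)
  qed
  have U2: "(\<Sum>i\<in>J. (U i)\<^sup>2) \<le> (\<Sum>i\<in>J. U i)\<^sup>2"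
  proof -
    have "(U i)\<^sup>2 \<le> U i * (\<Sum>i\<in>J. U i)" if "i \<in> J" for i
      unfolding power2_eq_square
      using that U0 finite_J by (intro mult_left_mono member_le_sum) auto
    then have "(\<Sum>i\<in>J. (U i)\<^sup>2) \<le> (\<Sum>i\<in>J. U i * (\<Sum>i\<in>J. U i))" by (rule sum_mono)
    then show ?thesis by (simp add: power2_eq_square sum_distrib_right)
  qed
  have maj: "(\<Sum>i\<in>J. U i)\<^sup>2 \<le> majorant \<omega>" unfolding U_def by (rule majorant_bound)
  have k1: "1 \<le> (real \<kappa>)\<^sup>2" using kappa_pos by simp
  have "\<Xi>\<^sup>2 * E - (\<Sum>i\<in>J. centred i \<omega> * Xr i * e i) = (\<Sum>i\<in>J. centred i \<omega> * \<Xi> * E - centred i \<omega> * Xr i * e i)"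
    by (simp add: \<Xi>_def power2_eq_square sum_subtractf sum_distrib_right)
  also have "\<dots> \<le> (\<Sum>i\<in>J. ((centred i \<omega>)\<^sup>2 / 2 + (De i)\<^sup>2 + \<tau> * \<bar>\<Xi>\<bar> * U i + \<tau>\<^sup>2 / 2 * (U i)\<^sup>2) * E)"
    by (intro sum_mono one)
  also have "\<dots> = ((\<Sum>i\<in>J. (centred i \<omega>)\<^sup>2) / 2 + (\<Sum>i\<in>J. (De i)\<^sup>2) + \<tau> * \<bar>\<Xi>\<bar> * (\<Sum>i\<in>J. U i) + \<tau>\<^sup>2 / 2 * (\<Sum>i\<in>J. (U i)\<^sup>2)) * E"
    by (simp only: sum_distrib_right[symmetric] sum.distrib sum_distrib_left sum_divide_distrib)
  also have "\<dots> \<le> (\<Xi>\<^sup>2 / 2 + \<tau>\<^sup>2 * majorant \<omega> + 3 / 2 * (real \<kappa>)\<^sup>2 * (\<Sum>i\<in>J. (centred i \<omega>)\<^sup>2)) * E"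
  proof (rule mult_right_mono[OF _ E0])
    have "2 * \<bar>\<Xi>\<bar> * (\<tau> * (\<Sum>i\<in>J. U i)) \<le> \<bar>\<Xi>\<bar>\<^sup>2 + (\<tau> * (\<Sum>i\<in>J. U i))\<^sup>2" by (rule sum_squares_bound)
    then have 1: "\<tau> * \<bar>\<Xi>\<bar> * (\<Sum>i\<in>J. U i) \<le> \<Xi>\<^sup>2 / 2 + \<tau>\<^sup>2 / 2 * (\<Sum>i\<in>J. U i)\<^sup>2"
      by (simp add: power_mult_distrib algebra_simps)
    have 2: "\<tau>\<^sup>2 / 2 * (\<Sum>i\<in>J. (U i)\<^sup>2) \<le> \<tau>\<^sup>2 / 2 * majorant \<omega>"
      using order_trans[OF U2 maj] by (intro mult_left_mono) auto
    have 3: "\<tau>\<^sup>2 / 2 * (\<Sum>i\<in>J. U i)\<^sup>2 \<le> \<tau>\<^sup>2 / 2 * majorant \<omega>"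
      using maj by (intro mult_left_mono) auto
    have 4: "(\<Sum>i\<in>J. (centred i \<omega>)\<^sup>2) \<le> (real \<kappa>)\<^sup>2 * (\<Sum>i\<in>J. (centred i \<omega>)\<^sup>2)"
      using mult_right_mono[OF k1, of "\<Sum>i\<in>J. (centred i \<omega>)\<^sup>2"] by (simp add: sum_nonneg)
    show "(\<Sum>i\<in>J. (centred i \<omega>)\<^sup>2) / 2 + (\<Sum>i\<in>J. (De i)\<^sup>2) + \<tau> * \<bar>\<Xi>\<bar> * (\<Sum>i\<in>J. U i) + \<tau>\<^sup>2 / 2 * (\<Sum>i\<in>J. (U i)\<^sup>2)
      \<le> \<Xi>\<^sup>2 / 2 + \<tau>\<^sup>2 * majorant \<omega> + 3 / 2 * (real \<kappa>)\<^sup>2 * (\<Sum>i\<in>J. (centred i \<omega>)\<^sup>2)"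
      using 1 2 3 4 De2 by linarith
  qed
  also have "\<dots> = \<Xi>\<^sup>2 * E / 2 + (\<tau>\<^sup>2 * majorant \<omega> + 3 / 2 * (real \<kappa>)\<^sup>2 * (\<Sum>i\<in>J. (centred i \<omega>)\<^sup>2)) * E"
    by (simp add: distrib_right)
  finally have "\<Xi>\<^sup>2 * E \<le> 2 * (\<Sum>i\<in>J. centred i \<omega> * Xr i * e i)
      + 2 * ((\<tau>\<^sup>2 * majorant \<omega> + 3 / 2 * (real \<kappa>)\<^sup>2 * (\<Sum>i\<in>J. (centred i \<omega>)\<^sup>2)) * E)"
    by linarith
  then show ?thesis unfolding \<Xi>_def Xr_def E_def e_def by (simp add: algebra_simps)
qed

text \<open>For \<open>j \<notin> D i\<close> the function \<open>centred j\<close> depends only on variables outside \<open>B i\<close>, as does \<open>W - Z i\<close>.\<close>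
lemma centred_product_mean_zero:
  assumes i: "i \<in> J"
  shows "integrable M (\<lambda>\<omega>. centred i \<omega> * (\<Sum>j\<in>J - D i. centred j \<omega>) * exp (t * (W \<omega> - Z i \<omega>)))"
    and "expectation (\<lambda>\<omega>. centred i \<omega> * (\<Sum>j\<in>J - D i. centred j \<omega>) * exp (t * (W \<omega> - Z i \<omega>))) = 0"
proof -
  have R: "(\<lambda>\<omega>. W \<omega> - Z i \<omega>) \<in> borel_measurable M" using Z_meas[OF i] by measurable
  show "integrable M (\<lambda>\<omega>. centred i \<omega> * (\<Sum>j\<in>J - D i. centred j \<omega>) * exp (t * (W \<omega> - Z i \<omega>)))"
    using centred_prod_integrable[OF R abs_W_minus_Z_le_L[OF i], of "{i}" "J - D i"] i by simp
  have int: "integrable M (\<lambda>\<omega>. (\<Sum>j\<in>J - D i. centred j \<omega>) * exp (t * (W \<omega> - Z i \<omega>)))"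
    using prod_sum_integrable[OF t R abs_W_minus_Z_le_L[OF i], of "{i}" "J - D i" "\<lambda>_ _. 1" 1 centred "1 + b"]
      i centred_meas centred_le' aS_nonneg by simp
  have m: "(\<lambda>\<omega>. (\<Sum>j\<in>J - D i. centred j \<omega>) * exp (t * (W \<omega> - Z i \<omega>))) \<in> borel_measurable (loc (J - B i))"
  proof (intro borel_measurable_times exp_W_minus_Z_loc[OF i] borel_measurable_sum)
    fix j assume j: "j \<in> J - D i"
    show "centred j \<in> borel_measurable (loc (J - B i))"
      by (rule loc_mono[OF _ centred_loc[of j]]) (use j A_sub_J[of j] in \<open>auto simp: D_def\<close>)
  qed
  show "expectation (\<lambda>\<omega>. centred i \<omega> * (\<Sum>j\<in>J - D i. centred j \<omega>) * exp (t * (W \<omega> - Z i \<omega>))) = 0"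
    using indep_nbhd[OF i centred_loc[OF i] centred_integrable[OF i] m int] centred_mean[OF i] by (simp add: mult.assoc)
qed

lemma tE_centred_sum_sq_le:
  "integrable M (\<lambda>\<omega>. (\<Sum>i\<in>J. centred i \<omega>)\<^sup>2 * exp (t * W \<omega>))"
  "tE t (\<lambda>\<omega>. (\<Sum>i\<in>J. centred i \<omega>)\<^sup>2) \<le> 2 * 10 ^ 7 * (a\<^sup>2 * \<tau> * rho)\<^sup>2 * \<phi> t"
proof -
  show int: "integrable M (\<lambda>\<omega>. (\<Sum>i\<in>J. centred i \<omega>)\<^sup>2 * exp (t * W \<omega>))"
    using centred_prod_integrable[OF W_meas abs_W_le_L, of J J] by (simp add: power2_eq_square)
  have isq: "integrable M (\<lambda>\<omega>. (centred i \<omega>)\<^sup>2 * exp (t * W \<omega>))" if "i \<in> J" for i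
    using centred_prod_integrable[OF W_meas abs_W_le_L, of "{i}" "{i}"] that by (simp add: power2_eq_square)
  define R where "R \<omega> = 2 * (\<Sum>i\<in>J. centred i \<omega> * (\<Sum>j\<in>J - D i. centred j \<omega>) * exp (t * (W \<omega> - Z i \<omega>)))
      + (2 * \<tau>\<^sup>2 * (majorant \<omega> * exp (t * W \<omega>)) + 3 * (real \<kappa>)\<^sup>2 * (\<Sum>i\<in>J. (centred i \<omega>)\<^sup>2 * exp (t * W \<omega>)))" for \<omega>
  have i1: "integrable M (\<lambda>\<omega>. \<Sum>i\<in>J. centred i \<omega> * (\<Sum>j\<in>J - D i. centred j \<omega>) * exp (t * (W \<omega> - Z i \<omega>)))"
    by (intro Bochner_Integration.integrable_sum centred_product_mean_zero(1))
  have i2: "integrable M (\<lambda>\<omega>. \<Sum>i\<in>J. (centred i \<omega>)\<^sup>2 * exp (t * W \<omega>))"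
    by (intro Bochner_Integration.integrable_sum isq)
  have Ri: "integrable M R" unfolding R_def using i1 i2 majorant_tE(1) by simp
  have "tE t (\<lambda>\<omega>. (\<Sum>i\<in>J. centred i \<omega>)\<^sup>2) \<le> expectation R"
    unfolding tE_def
  proof (intro integral_mono int Ri)
    fix \<omega>
    show "(\<Sum>i\<in>J. centred i \<omega>)\<^sup>2 * exp (t * W \<omega>) \<le> R \<omega>"
      using centred_sq_pointwise[of \<omega>] unfolding R_def by (simp only: distrib_right sum_distrib_right mult.assoc)
  qed
  also have "expectation R = 2 * \<tau>\<^sup>2 * tE t majorant + 3 * (real \<kappa>)\<^sup>2 * (\<Sum>i\<in>J. tE t (\<lambda>\<omega>. (centred i \<omega>)\<^sup>2))"
    unfolding R_def tE_def using i1 i2 isq majorant_tE(1) centred_product_mean_zero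
    by (simp add: Bochner_Integration.integral_sum)
  also have "\<dots> \<le> 2 * \<tau>\<^sup>2 * (9 * 10 ^ 6 * (real \<kappa> * (b * real (card J)) / a)\<^sup>2 * \<phi> t)
      + 3 * (real \<kappa>)\<^sup>2 * (\<Sum>i\<in>J. 28 * b * \<phi> t)"
    by (intro add_mono mult_left_mono majorant_tE sum_mono tE_centred_summand_sq_le) auto
  also have "\<dots> = (18 * 10 ^ 6 * (\<tau>\<^sup>2 * v\<^sup>2) + 84 * v) * ((real \<kappa> * a)\<^sup>2 * \<phi> t)"
  proof -
    have n: "b * real (card J) = v * a\<^sup>2" using a_pos by (simp add: v_def)
    then have 1: "(\<Sum>i\<in>J. 28 * b * \<phi> t) = 28 * (v * a\<^sup>2) * \<phi> t" by (simp add: mult_ac)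
    have 2: "real \<kappa> * (b * real (card J)) / a = real \<kappa> * v * a"
      unfolding n using a_pos by (simp add: power2_eq_square)
    show ?thesis unfolding 1 2 by (simp add: power_mult_distrib algebra_simps)
  qed
  also have "\<dots> \<le> (2 * 10 ^ 7 * (\<tau>\<^sup>2 * (1 + v)\<^sup>2)) * ((real \<kappa> * a)\<^sup>2 * \<phi> t)"
  proof (rule mult_right_mono)
    have t2: "1 \<le> \<tau>\<^sup>2" using tau_ge_1 by simp
    have "v * 1 \<le> (2 * v) * \<tau>\<^sup>2" using t2 v_nonneg by (intro mult_mono) auto
    moreover have "0 \<le> \<tau>\<^sup>2 * v\<^sup>2" "0 \<le> \<tau>\<^sup>2" "0 \<le> \<tau>\<^sup>2 * v" using v_nonneg by auto
    moreover have "\<tau>\<^sup>2 * (1 + v)\<^sup>2 = \<tau>\<^sup>2 + 2 * (\<tau>\<^sup>2 * v) + \<tau>\<^sup>2 * v\<^sup>2" by (simp add: power2_sum algebra_simps)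
    moreover have "v * 1 = v" "(2 * v) * \<tau>\<^sup>2 = 2 * (\<tau>\<^sup>2 * v)" by simp_all
    ultimately have "18000000 * (\<tau>\<^sup>2 * v\<^sup>2) + 84 * v \<le> 20000000 * (\<tau>\<^sup>2 * (1 + v)\<^sup>2)" by linarith
    then show "18 * 10 ^ 6 * (\<tau>\<^sup>2 * v\<^sup>2) + 84 * v \<le> 2 * 10 ^ 7 * (\<tau>\<^sup>2 * (1 + v)\<^sup>2)" by simp
  qed (use phi_ge_1[OF t] in auto)
  also have "\<dots> = 2 * 10 ^ 7 * (a\<^sup>2 * \<tau> * rho)\<^sup>2 * \<phi> t"
    using a_pos by (simp add: rho_def power2_eq_square)
  finally show "tE t (\<lambda>\<omega>. (\<Sum>i\<in>J. centred i \<omega>)\<^sup>2) \<le> 2 * 10 ^ 7 * (a\<^sup>2 * \<tau> * rho)\<^sup>2 * \<phi> t" .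
qed

text \<open>The first moment follows from the second one by \<open>\<bar>x\<bar> \<le> x\<^sup>2 / (2 * c) + c / 2\<close> with \<open>c = 4500 * a\<^sup>2 * \<tau> * rho\<close>, where
\<open>4500\<^sup>2\<close> slightly exceeds \<open>2 * 10 ^ 7\<close>.\<close>
lemma tE_abs_centred_le:
  "integrable M (\<lambda>\<omega>. (\<Sum>i\<in>J. F i \<omega> - expectation (F i)) * exp (t * W \<omega>))"
  "tE t (\<lambda>\<omega>. \<bar>\<Sum>i\<in>J. F i \<omega> - expectation (F i)\<bar>) \<le> 4500 * (a\<^sup>2 * \<tau> * rho) * \<phi> t"
proof -
  obtain i where i: "i \<in> J" by (rule J_elem)
  have int: "integrable M (\<lambda>\<omega>. (\<Sum>i\<in>J. centred i \<omega>) * exp (t * W \<omega>))"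
    using prod_sum_integrable[OF t W_meas abs_W_le_L, of "{i}" J "\<lambda>_ _. 1" 1 centred "1 + b"]
      i centred_meas centred_le' aS_nonneg by simp
  then show "integrable M (\<lambda>\<omega>. (\<Sum>i\<in>J. F i \<omega> - expectation (F i)) * exp (t * W \<omega>))"
    by (simp add: centred_def)
  have int': "integrable M (\<lambda>\<omega>. \<bar>\<Sum>i\<in>J. centred i \<omega>\<bar> * exp (t * W \<omega>))"
    using integrable_norm[OF int] by (simp add: abs_mult)
  define g where "g = a\<^sup>2 * \<tau> * rho"
  have g: "0 < g" using a_pos tau_ge_1 kappa_pos v_nonneg by (simp add: g_def rho_def add_pos_nonneg)
  have "tE t (\<lambda>\<omega>. \<bar>\<Sum>i\<in>J. centred i \<omega>\<bar>)
     \<le> expectation (\<lambda>\<omega>. 1 / (9000 * g) * ((\<Sum>i\<in>J. centred i \<omega>)\<^sup>2 * exp (t * W \<omega>)) + 2250 * g * exp (t * W \<omega>))"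
    unfolding tE_def
  proof (intro integral_mono int')
    show "integrable M (\<lambda>\<omega>. 1 / (9000 * g) * ((\<Sum>i\<in>J. centred i \<omega>)\<^sup>2 * exp (t * W \<omega>)) + 2250 * g * exp (t * W \<omega>))"
      using tE_centred_sum_sq_le(1) exp_tW_integrable[OF t] by simp
    fix \<omega>
    have "\<bar>x\<bar> \<le> 1 / (9000 * g) * x\<^sup>2 + 2250 * g" for x
    proof -
      have "2 * \<bar>x\<bar> * (4500 * g) \<le> \<bar>x\<bar>\<^sup>2 + (4500 * g)\<^sup>2" by (rule sum_squares_bound)
      then show ?thesis using g by (simp add: field_simps power2_eq_square)
    qed
    then have "\<bar>\<Sum>i\<in>J. centred i \<omega>\<bar> * exp (t * W \<omega>) \<le> (1 / (9000 * g) * (\<Sum>i\<in>J. centred i \<omega>)\<^sup>2 + 2250 * g) * exp (t * W \<omega>)"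
      by (rule mult_right_mono) auto
    then show "\<bar>\<Sum>i\<in>J. centred i \<omega>\<bar> * exp (t * W \<omega>) \<le> 1 / (9000 * g) * ((\<Sum>i\<in>J. centred i \<omega>)\<^sup>2 * exp (t * W \<omega>)) + 2250 * g * exp (t * W \<omega>)"
      by (simp only: distrib_right mult.assoc)
  qed
  also have "\<dots> = 1 / (9000 * g) * tE t (\<lambda>\<omega>. (\<Sum>i\<in>J. centred i \<omega>)\<^sup>2) + 2250 * g * \<phi> t"
    unfolding tE_def \<phi>_def using tE_centred_sum_sq_le(1) exp_tW_integrable[OF t] by simp
  also have "\<dots> \<le> 1 / (9000 * g) * (2 * 10 ^ 7 * g\<^sup>2 * \<phi> t) + 2250 * g * \<phi> t"
    using tE_centred_sum_sq_le(2) g by (intro add_right_mono mult_left_mono) (auto simp: g_def)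
  also have "\<dots> = (20000 / 9 + 2250) * (g * \<phi> t)" using g by (simp add: power2_eq_square field_simps)
  also have "\<dots> \<le> 4500 * (g * \<phi> t)" using g phi_ge_1[OF t] by (intro mult_right_mono) auto
  finally show "tE t (\<lambda>\<omega>. \<bar>\<Sum>i\<in>J. F i \<omega> - expectation (F i)\<bar>) \<le> 4500 * (a\<^sup>2 * \<tau> * rho) * \<phi> t"
    by (simp add: centred_def g_def mult.assoc)
qed

end

end

context tilted_field
begin

section \<open>Second- and third-order neighbourhood sums\<close>

definition "T \<omega> = (\<Sum>i\<in>J. X i \<omega> * Y i \<omega>)"
text \<open>The third-order error of expansions around \<open>W - Y i\<close>; the exponential factor accommodates tilts and the oscillation of
ramps.\<close>
definition "third \<beta> \<omega> = (\<Sum>i\<in>J. \<bar>X i \<omega>\<bar> * (Y i \<omega>)\<^sup>2 * exp (\<beta> * \<bar>Y i \<omega>\<bar>))"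

lemma abs_XY_le:
  assumes i: "i \<in> J"
  shows "\<bar>X i \<omega> * Y i \<omega>\<bar> \<le> 8192 / a\<^sup>2 * exp (a * S i \<omega> / 64)"
proof -
  have "\<bar>X i \<omega> * Y i \<omega>\<bar> \<le> S i \<omega> * S i \<omega>"
    unfolding abs_mult by (intro mult_mono abs_X_le_S abs_Y_le_S self_in_B i S_nonneg) auto
  also have "\<dots> = S i \<omega> ^ 2" by (simp add: power2_eq_square)
  also have "\<dots> \<le> fact 2 / (a / 64) ^ 2 * exp (a / 64 * S i \<omega>)"
    by (rule power_le_exp_scaled[OF S_nonneg]) (use a_pos in auto)
  finally show ?thesis by (simp add: power_divide fact_2 field_simps)
qed

lemma abs_XYY_le:
  assumes i: "i \<in> J" and l: "0 < l" "0 \<le> \<beta>"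
  shows "\<bar>X i \<omega>\<bar> * (Y i \<omega>)\<^sup>2 * exp (\<beta> * \<bar>Y i \<omega>\<bar>) \<le> 6 / l ^ 3 * exp ((l + \<beta>) * S i \<omega>)"
proof -
  have "\<bar>X i \<omega>\<bar> * \<bar>Y i \<omega>\<bar>\<^sup>2 * exp (\<beta> * \<bar>Y i \<omega>\<bar>) \<le> S i \<omega> * (S i \<omega>)\<^sup>2 * exp (\<beta> * S i \<omega>)"
    using abs_Y_le_S[OF i, of \<omega>] l S_nonneg[of i \<omega>] abs_X_le_S[OF i self_in_B[OF i], of \<omega>]
    by (intro mult_mono power_mono) (auto intro: mult_left_mono)
  also have "S i \<omega> * (S i \<omega>)\<^sup>2 = S i \<omega> ^ 3" by (simp add: power2_eq_square power3_eq_cube)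
  also have "\<dots> \<le> fact 3 / l ^ 3 * exp (l * S i \<omega>)"
    by (rule power_le_exp_scaled[OF S_nonneg]) (use l in auto)
  also have "fact 3 / l ^ 3 * exp (l * S i \<omega>) * exp (\<beta> * S i \<omega>) = 6 / l ^ 3 * exp ((l + \<beta>) * S i \<omega>)"
    by (simp add: distrib_right exp_add fact_numeral)
  finally show ?thesis by simp
qed

lemma XY_loc: "i \<in> J \<Longrightarrow> (\<lambda>\<omega>. X i \<omega> * Y i \<omega>) \<in> borel_measurable (loc (A i))"
  using X_loc[OF self_in] Y_loc by measurable

lemma XYY_loc: "i \<in> J \<Longrightarrow> (\<lambda>\<omega>. \<bar>X i \<omega>\<bar> * (Y i \<omega>)\<^sup>2 * exp (\<beta> * \<bar>Y i \<omega>\<bar>)) \<in> borel_measurable (loc (A i))"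
  using X_loc[OF self_in] Y_loc by measurable

lemma rho_bounds: "v / a \<le> rho" "1 / a \<le> rho" "0 < rho"
proof -
  have k: "1 * (1 + v) \<le> real \<kappa> * (1 + v)" using kappa_pos v_nonneg by (intro mult_right_mono) auto
  have k1: "v \<le> real \<kappa> * (1 + v)" by (rule order_trans[OF _ k]) simp
  have k2: "1 \<le> real \<kappa> * (1 + v)" by (rule order_trans[OF _ k]) (use v_nonneg in simp)
  show "v / a \<le> rho" "1 / a \<le> rho"
    unfolding rho_def using k1 k2 by (auto intro!: divide_right_mono less_imp_le[OF a_pos])
  have "0 < 1 / a" using a_pos by simp
  then show "0 < rho" using \<open>1 / a \<le> rho\<close> by linarith
qed

lemma XY_integrable: "i \<in> J \<Longrightarrow> integrable M (\<lambda>\<omega>. X i \<omega> * Y i \<omega>)"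
proof -
  assume i: "i \<in> J"
  show ?thesis
  proof (rule integrable_le_exp_S[OF i loc_meas[OF A_sub_J[OF i] XY_loc[OF i]]])
    fix \<omega>
    have "\<bar>X i \<omega> * Y i \<omega>\<bar> \<le> 8192 / a\<^sup>2 * exp (a * S i \<omega> / 64)" by (rule abs_XY_le[OF i])
    also have "\<dots> \<le> 8192 / a\<^sup>2 * exp (a * S i \<omega>)" using aS_nonneg[of i \<omega>] by (intro mult_left_mono) auto
    finally show "\<bar>X i \<omega> * Y i \<omega>\<bar> \<le> 8192 / a\<^sup>2 * exp (a * S i \<omega>)" .
  qed
qed

text \<open>By (LD1), \<open>X i\<close> is centred and independent of \<open>W - Y i\<close>.\<close>
lemma X_remainder_mean_zero:
  assumes i: "i \<in> J" and t: "\<bar>t\<bar> \<le> \<tau>" and g[measurable]: "g \<in> borel_measurable borel"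
    and bd: "\<And>x. \<bar>g x\<bar> \<le> C * exp (\<tau> * \<bar>x\<bar>)"
  shows "integrable M (\<lambda>\<omega>. X i \<omega> * g (W \<omega> - Y i \<omega>))"
    and "expectation (\<lambda>\<omega>. X i \<omega> * g (W \<omega> - Y i \<omega>)) = 0"
proof -
  have ind: "indep_subfamilies M X {i} (J - A i)" using LD1 i by (auto simp: LD1_def)
  have s: "(\<lambda>\<omega>. \<Sum>j\<in>J - A i. X j \<omega>) \<in> borel_measurable (loc (J - A i))"
    by (intro borel_measurable_sum X_loc)
  have m: "(\<lambda>\<omega>. g (W \<omega> - Y i \<omega>)) \<in> borel_measurable (loc (J - A i))"
    unfolding W_minus_Y[OF i] by (rule measurable_compose[OF s g])
  have "C * exp (\<tau> * \<bar>x\<bar>) \<ge> 0" for x using order_trans[OF abs_ge_zero bd] .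
  from this[of 0] have C: "C \<ge> 0" by simp
  have int: "integrable M (\<lambda>\<omega>. g (W \<omega> - Y i \<omega>))"
  proof (rule dom_integrable[OF loc_meas[OF _ m] i i, where C=C])
    fix \<omega>
    have "\<bar>W \<omega> - Y i \<omega>\<bar> \<le> L \<omega>" unfolding W_minus_Y[OF i] by (rule abs_sub_sum_le_L) auto
    then have "\<tau> * \<bar>W \<omega> - Y i \<omega>\<bar> \<le> \<tau> * L \<omega>" using tau_ge_1 by (intro mult_left_mono) auto
    then have "exp (\<tau> * \<bar>W \<omega> - Y i \<omega>\<bar>) \<le> exp (a * S i \<omega> / 4 + a * S i \<omega> / 4 + 2 * \<tau> * L \<omega>)"
      using aS_nonneg[of i \<omega>] tau_L_nonneg[of \<omega>] by simp
    then have "C * exp (\<tau> * \<bar>W \<omega> - Y i \<omega>\<bar>) \<le> C * exp (a * S i \<omega> / 4 + a * S i \<omega> / 4 + 2 * \<tau> * L \<omega>)"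
      using C by (rule mult_left_mono)
    then show "\<bar>g (W \<omega> - Y i \<omega>)\<bar> \<le> C * exp (a * S i \<omega> / 4 + a * S i \<omega> / 4 + 2 * \<tau> * L \<omega>)"
      using bd[of "W \<omega> - Y i \<omega>"] by linarith
  qed auto
  show "integrable M (\<lambda>\<omega>. X i \<omega> * g (W \<omega> - Y i \<omega>))"
    using indep_product(1)[OF ind X_loc X_integrable[OF i] m int] by simp
  show "expectation (\<lambda>\<omega>. X i \<omega> * g (W \<omega> - Y i \<omega>)) = 0"
    using indep_product(2)[OF ind X_loc X_integrable[OF i] m int] X_mean[OF i] by simp
qed

text \<open>Split \<open>W = Y i + (W - Y i)\<close> in \<open>1 = E (W\<^sup>2) = (\<Sum>i\<in>J. E (X i * W))\<close>.\<close>
lemma T_mean: "(\<Sum>i\<in>J. expectation (\<lambda>\<omega>. X i \<omega> * Y i \<omega>)) = 1"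
proof -
  have g: "\<bar>x\<bar> \<le> 1 * exp (\<tau> * \<bar>x\<bar>)" for x :: real
  proof -
    have "1 * \<bar>x\<bar> \<le> \<tau> * \<bar>x\<bar>" using tau_ge_1 by (intro mult_right_mono) auto
    then show ?thesis using exp_ge_add_one_self[of "\<tau> * \<bar>x\<bar>"] by linarith
  qed
  have rem: "integrable M (\<lambda>\<omega>. X i \<omega> * (W \<omega> - Y i \<omega>))" "expectation (\<lambda>\<omega>. X i \<omega> * (W \<omega> - Y i \<omega>)) = 0"
    if "i \<in> J" for i
    using X_remainder_mean_zero[OF that, of 0 "\<lambda>x. x" 1] g tau_ge_1 by auto
  have "1 = expectation (\<lambda>\<omega>. (W \<omega>)\<^sup>2)"
    using unit_variance W_mean(2) by (simp add: W_def[symmetric])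
  also have "\<dots> = expectation (\<lambda>\<omega>. \<Sum>i\<in>J. X i \<omega> * Y i \<omega> + X i \<omega> * (W \<omega> - Y i \<omega>))"
  proof (intro Bochner_Integration.integral_cong refl)
    fix \<omega>
    have "(\<Sum>i\<in>J. X i \<omega> * Y i \<omega> + X i \<omega> * (W \<omega> - Y i \<omega>)) = (\<Sum>i\<in>J. X i \<omega> * W \<omega>)"
      by (intro sum.cong refl) (simp add: algebra_simps)
    also have "\<dots> = (\<Sum>i\<in>J. X i \<omega>) * W \<omega>" by (rule sum_distrib_right[symmetric])
    finally show "(W \<omega>)\<^sup>2 = (\<Sum>i\<in>J. X i \<omega> * Y i \<omega> + X i \<omega> * (W \<omega> - Y i \<omega>))"
      by (simp add: W_def power2_eq_square)
  qed
  also have "\<dots> = (\<Sum>i\<in>J. expectation (\<lambda>\<omega>. X i \<omega> * Y i \<omega>) + expectation (\<lambda>\<omega>. X i \<omega> * (W \<omega> - Y i \<omega>)))"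
    using rem XY_integrable by (subst Bochner_Integration.integral_sum) auto
  also have "\<dots> = (\<Sum>i\<in>J. expectation (\<lambda>\<omega>. X i \<omega> * Y i \<omega>))" using rem by simp
  finally show ?thesis by simp
qed

lemma tE_T:
  assumes t: "\<bar>t\<bar> \<le> \<tau>"
  shows "integrable M (\<lambda>\<omega>. (T \<omega> - 1) * exp (t * W \<omega>))"
    and "tE t (\<lambda>\<omega>. \<bar>T \<omega> - 1\<bar>) \<le> 4 * 10 ^ 7 * \<tau> * rho * \<phi> t"
proof -
  \<comment> \<open>This normalisation brings \<open>X i * Y i\<close> below \<open>exp (a * S i / 64)\<close>.\<close>
  define c where "c = a\<^sup>2 / 8192"
  have c: "0 < c" using a_pos by (simp add: c_def)
  define F where "F i \<omega> = c * (X i \<omega> * Y i \<omega>)" for i \<omega>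
  have F1: "F i \<in> borel_measurable (loc (A i))" if "i \<in> J" for i
    unfolding F_def using XY_loc[OF that] by measurable
  have F2: "\<bar>F i \<omega>\<bar> \<le> exp (a * S i \<omega> / 64)" if "i \<in> J" for i \<omega>
  proof -
    have "\<bar>F i \<omega>\<bar> \<le> c * (8192 / a\<^sup>2 * exp (a * S i \<omega> / 64))"
      unfolding F_def abs_mult[of c] using c abs_XY_le[OF that] by (intro mult_mono) auto
    then show ?thesis using a_pos by (simp add: c_def)
  qed
  have sum: "(\<Sum>i\<in>J. F i \<omega> - expectation (F i)) = c * (T \<omega> - 1)" for \<omega>
  proof -
    have "(\<Sum>i\<in>J. F i \<omega> - expectation (F i)) = c * T \<omega> - c * (\<Sum>i\<in>J. expectation (\<lambda>\<omega>. X i \<omega> * Y i \<omega>))"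
      unfolding F_def T_def by (simp add: sum_subtractf sum_distrib_left)
    then show ?thesis by (simp add: T_mean right_diff_distrib)
  qed
  have "integrable M (\<lambda>\<omega>. c * ((T \<omega> - 1) * exp (t * W \<omega>)))"
    using tE_abs_centred_le(1)[OF t F1 F2] unfolding sum by (simp add: mult.assoc)
  then show "integrable M (\<lambda>\<omega>. (T \<omega> - 1) * exp (t * W \<omega>))" using c by simp
  have "tE t (\<lambda>\<omega>. \<bar>c * (T \<omega> - 1)\<bar>) \<le> 4500 * (a\<^sup>2 * \<tau> * rho) * \<phi> t"
    using tE_abs_centred_le(2)[OF t F1 F2] unfolding sum .
  moreover have "tE t (\<lambda>\<omega>. \<bar>c * (T \<omega> - 1)\<bar>) = c * tE t (\<lambda>\<omega>. \<bar>T \<omega> - 1\<bar>)"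
    unfolding tE_def abs_mult using c by (simp add: mult.assoc)
  ultimately have "c * tE t (\<lambda>\<omega>. \<bar>T \<omega> - 1\<bar>) \<le> 4500 * (a\<^sup>2 * \<tau> * rho) * \<phi> t" by (simp only:)
  also have "\<dots> = c * (36864000 * \<tau> * rho * \<phi> t)" by (simp add: c_def)
  finally have "c * tE t (\<lambda>\<omega>. \<bar>T \<omega> - 1\<bar>) \<le> c * (36864000 * \<tau> * rho * \<phi> t)" .
  then have "tE t (\<lambda>\<omega>. \<bar>T \<omega> - 1\<bar>) \<le> 36864000 * (\<tau> * rho * \<phi> t)" using c by simp
  also have "\<dots> \<le> 4 * 10 ^ 7 * (\<tau> * rho * \<phi> t)"
    using tau_ge_1 rho_bounds(3) phi_ge_1[OF t] by (intro mult_right_mono) auto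
  finally show "tE t (\<lambda>\<omega>. \<bar>T \<omega> - 1\<bar>) \<le> 4 * 10 ^ 7 * \<tau> * rho * \<phi> t" by simp
qed

lemma tE_XYY_le:
  assumes t: "\<bar>t\<bar> \<le> \<tau>" and \<beta>: "0 \<le> \<beta>" "\<beta> \<le> a / 32" and i: "i \<in> J"
  shows "integrable M (\<lambda>\<omega>. (\<bar>X i \<omega>\<bar> * (Y i \<omega>)\<^sup>2 * exp (\<beta> * \<bar>Y i \<omega>\<bar>)) * exp (t * W \<omega>))"
    and "tE t (\<lambda>\<omega>. \<bar>X i \<omega>\<bar> * (Y i \<omega>)\<^sup>2 * exp (\<beta> * \<bar>Y i \<omega>\<bar>)) \<le> 3 * 10 ^ 6 * b / a ^ 3 * \<phi> t"
proof -
  \<comment> \<open>Here \<open>196608 = 6 * 32 ^ 3\<close>.\<close>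
  define c where "c = a ^ 3 / 196608"
  have c: "0 < c" using a_pos by (simp add: c_def)
  define F where "F \<omega> = \<bar>X i \<omega>\<bar> * (Y i \<omega>)\<^sup>2 * exp (\<beta> * \<bar>Y i \<omega>\<bar>)" for \<omega>
  have le: "c * F \<omega> \<le> exp (a * S i \<omega> / 16)" for \<omega>
  proof -
    have "F \<omega> \<le> 6 / (a / 32) ^ 3 * exp ((a / 32 + \<beta>) * S i \<omega>)"
      unfolding F_def by (rule abs_XYY_le[OF i]) (use a_pos \<beta> in auto)
    then have "c * F \<omega> \<le> c * (6 / (a / 32) ^ 3 * exp ((a / 32 + \<beta>) * S i \<omega>))"
      using c by (intro mult_left_mono) auto
    also have "\<dots> = exp ((a / 32 + \<beta>) * S i \<omega>)" using a_pos by (simp add: c_def power_divide)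
    also have "\<dots> \<le> exp (a * S i \<omega> / 16)"
      using \<beta> mult_right_mono[of "a / 32 + \<beta>" "a / 16" "S i \<omega>"] S_nonneg by simp
    finally show ?thesis .
  qed
  have F0: "0 \<le> F \<omega>" for \<omega> by (simp add: F_def)
  have cF0: "0 \<le> c * F \<omega>" for \<omega> using c F0 by simp
  have loc: "(\<lambda>\<omega>. c * F \<omega>) \<in> borel_measurable (loc (A i))"
    unfolding F_def using XYY_loc[OF i] by measurable
  have m: "(\<lambda>\<omega>. c * F \<omega>) \<in> borel_measurable M" by (rule loc_meas[OF A_sub_J[OF i] loc])
  have "integrable M (\<lambda>\<omega>. (c * F \<omega>) * exp (t * W \<omega>))"
  proof (rule tilt_integrable[OF t m i i, where C=1])
    fix \<omega>
    have "exp (a * S i \<omega> / 16) \<le> exp (a * S i \<omega> / 4 + a * S i \<omega> / 4 + \<tau> * L \<omega>)"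
      using aS_nonneg[of i \<omega>] tau_L_nonneg[of \<omega>] by simp
    then show "\<bar>c * F \<omega>\<bar> \<le> 1 * exp (a * S i \<omega> / 4 + a * S i \<omega> / 4 + \<tau> * L \<omega>)"
      using le[of \<omega>] cF0[of \<omega>] by linarith
  qed
  then show "integrable M (\<lambda>\<omega>. (\<bar>X i \<omega>\<bar> * (Y i \<omega>)\<^sup>2 * exp (\<beta> * \<bar>Y i \<omega>\<bar>)) * exp (t * W \<omega>))"
    using c by (simp add: F_def mult.assoc)
  have "tE t (\<lambda>\<omega>. c * F \<omega>) \<le> 13 * b * \<phi> t"
    by (rule tE_local_le[OF i t loc cF0 le])
  then have "c * tE t F \<le> 13 * b * \<phi> t"
    unfolding tE_def by (simp add: mult.assoc)
  then have "tE t F \<le> 13 * b * \<phi> t / c" using c by (simp add: field_simps)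
  also have "\<dots> = 2555904 * (b / a ^ 3 * \<phi> t)" by (simp add: c_def)
  also have "\<dots> \<le> 3 * 10 ^ 6 * (b / a ^ 3 * \<phi> t)"
    using b_ge_1 a_pos phi_ge_1[OF t] by (intro mult_right_mono) auto
  finally show "tE t (\<lambda>\<omega>. \<bar>X i \<omega>\<bar> * (Y i \<omega>)\<^sup>2 * exp (\<beta> * \<bar>Y i \<omega>\<bar>)) \<le> 3 * 10 ^ 6 * b / a ^ 3 * \<phi> t"
    by (simp add: F_def[abs_def])
qed

lemma tE_third:
  assumes t: "\<bar>t\<bar> \<le> \<tau>" and \<beta>: "0 \<le> \<beta>" "\<beta> \<le> a / 32"
  shows "integrable M (\<lambda>\<omega>. third \<beta> \<omega> * exp (t * W \<omega>))"
    and "tE t (third \<beta>) \<le> 3 * 10 ^ 6 * rho * \<phi> t"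
proof -
  show "integrable M (\<lambda>\<omega>. third \<beta> \<omega> * exp (t * W \<omega>))"
    unfolding third_def sum_distrib_right
    by (intro Bochner_Integration.integrable_sum tE_XYY_le(1)[OF t \<beta>])
  have "tE t (third \<beta>) = (\<Sum>i\<in>J. tE t (\<lambda>\<omega>. \<bar>X i \<omega>\<bar> * (Y i \<omega>)\<^sup>2 * exp (\<beta> * \<bar>Y i \<omega>\<bar>)))"
    unfolding tE_def third_def sum_distrib_right
    by (intro Bochner_Integration.integral_sum tE_XYY_le(1)[OF t \<beta>])
  also have "\<dots> \<le> (\<Sum>i\<in>J. 3 * 10 ^ 6 * b / a ^ 3 * \<phi> t)" by (intro sum_mono tE_XYY_le(2)[OF t \<beta>])
  also have "\<dots> = 3 * 10 ^ 6 * (v / a) * \<phi> t"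
    by (simp add: v_def power2_eq_square power3_eq_cube)
  also have "\<dots> \<le> 3 * 10 ^ 6 * rho * \<phi> t"
    using rho_bounds(1) phi_ge_1[OF t] by (intro mult_right_mono mult_left_mono) auto
  finally show "tE t (third \<beta>) \<le> 3 * 10 ^ 6 * rho * \<phi> t" .
qed

text \<open>The number m is the untilted mean of \<open>third \<beta>\<close>.\<close>
lemma third_concentration:
  assumes t: "\<bar>t\<bar> \<le> \<tau>" and \<beta>: "0 \<le> \<beta>" "\<beta> \<le> a / 128"
  obtains m where "0 \<le> m" "m \<le> 13 * 10 ^ 6 * v / a"
    "tE t (\<lambda>\<omega>. \<bar>third \<beta> \<omega> - m\<bar>) \<le> 6 * 10 ^ 10 * \<tau> * rho / a * \<phi> t"
    "integrable M (\<lambda>\<omega>. (third \<beta> \<omega> - m) * exp (t * W \<omega>))"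
proof -
  \<comment> \<open>Since \<open>12582912 = 6 * 128 ^ 3\<close>, the cubic term is normalised to \<open>exp (a * S i / 64)\<close>.\<close>
  define c where "c = a ^ 3 / 12582912"
  have c: "0 < c" using a_pos by (simp add: c_def)
  define F where "F i \<omega> = c * (\<bar>X i \<omega>\<bar> * (Y i \<omega>)\<^sup>2 * exp (\<beta> * \<bar>Y i \<omega>\<bar>))" for i \<omega>
  have F1: "F i \<in> borel_measurable (loc (A i))" if "i \<in> J" for i
    unfolding F_def using XYY_loc[OF that] by measurable
  have F0: "0 \<le> F i \<omega>" for i \<omega> using c by (simp add: F_def)
  have F2': "F i \<omega> \<le> exp (a * S i \<omega> / 64)" if i: "i \<in> J" for i \<omega>
  proof -
    have "\<bar>X i \<omega>\<bar> * (Y i \<omega>)\<^sup>2 * exp (\<beta> * \<bar>Y i \<omega>\<bar>) \<le> 6 / (a / 128) ^ 3 * exp ((a / 128 + \<beta>) * S i \<omega>)"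
      by (rule abs_XYY_le[OF i]) (use a_pos \<beta> in auto)
    then have "F i \<omega> \<le> c * (6 / (a / 128) ^ 3 * exp ((a / 128 + \<beta>) * S i \<omega>))"
      unfolding F_def using c by (intro mult_left_mono) auto
    also have "\<dots> = exp ((a / 128 + \<beta>) * S i \<omega>)" using a_pos by (simp add: c_def power_divide)
    also have "\<dots> \<le> exp (a * S i \<omega> / 64)"
      using \<beta> mult_right_mono[of "a / 128 + \<beta>" "a / 64" "S i \<omega>"] S_nonneg by simp
    finally show ?thesis .
  qed
  have F2: "\<bar>F i \<omega>\<bar> \<le> exp (a * S i \<omega> / 64)" if "i \<in> J" for i \<omega> using F2'[OF that, of \<omega>] F0[of i \<omega>] by simp
  define m where "m = (\<Sum>i\<in>J. expectation (F i)) / c"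
  have sum: "(\<Sum>i\<in>J. F i \<omega> - expectation (F i)) = c * (third \<beta> \<omega> - m)" for \<omega>
  proof -
    have "c * m = (\<Sum>i\<in>J. expectation (F i))" using c by (simp add: m_def)
    moreover have "c * third \<beta> \<omega> = (\<Sum>i\<in>J. F i \<omega>)" by (simp add: third_def F_def sum_distrib_left)
    ultimately show ?thesis by (simp add: sum_subtractf right_diff_distrib)
  qed
  show thesis
  proof (rule that[of m])
    show "0 \<le> m" unfolding m_def using c F0 by (intro divide_nonneg_nonneg sum_nonneg integral_nonneg_AE) auto
    have "expectation (F i) \<le> b" if i: "i \<in> J" for i
    proof (rule local_expectation_le[OF i loc_meas[OF A_sub_J[OF i] F1[OF i]] _ F0])
      fix \<omega> show "F i \<omega> \<le> exp (a * S i \<omega>)"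
        by (rule order_trans[OF F2'[OF i]]) (use aS_nonneg[of i \<omega>] in simp)
    qed
    then have "m \<le> (\<Sum>i\<in>J. b) / c" unfolding m_def using c by (intro divide_right_mono sum_mono) auto
    also have "\<dots> = 12582912 * (v / a)" using a_pos by (simp add: c_def v_def power2_eq_square power3_eq_cube)
    also have "\<dots> \<le> 13 * 10 ^ 6 * (v / a)" using v_nonneg a_pos by (intro mult_right_mono) auto
    finally show "m \<le> 13 * 10 ^ 6 * v / a" by simp
    have "tE t (\<lambda>\<omega>. \<bar>c * (third \<beta> \<omega> - m)\<bar>) \<le> 4500 * (a\<^sup>2 * \<tau> * rho) * \<phi> t"
      using tE_abs_centred_le(2)[OF t F1 F2] unfolding sum .
    moreover have "tE t (\<lambda>\<omega>. \<bar>c * (third \<beta> \<omega> - m)\<bar>) = c * tE t (\<lambda>\<omega>. \<bar>third \<beta> \<omega> - m\<bar>)"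
      unfolding tE_def abs_mult using c by (simp add: mult.assoc)
    ultimately have "tE t (\<lambda>\<omega>. \<bar>third \<beta> \<omega> - m\<bar>) \<le> 4500 * (a\<^sup>2 * \<tau> * rho) * \<phi> t / c"
      using c by (simp add: field_simps)
    also have "\<dots> = 56623104000 * (\<tau> * rho / a * \<phi> t)"
      using a_pos by (simp add: c_def power2_eq_square power3_eq_cube)
    also have "\<dots> \<le> 6 * 10 ^ 10 * (\<tau> * rho / a * \<phi> t)"
      using tau_ge_1 rho_bounds(3) a_pos phi_ge_1[OF t] by (intro mult_right_mono) auto
    finally show "tE t (\<lambda>\<omega>. \<bar>third \<beta> \<omega> - m\<bar>) \<le> 6 * 10 ^ 10 * \<tau> * rho / a * \<phi> t" by simp
    have "integrable M (\<lambda>\<omega>. c * ((third \<beta> \<omega> - m) * exp (t * W \<omega>)))"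
      using tE_abs_centred_le(1)[OF t F1 F2] unfolding sum by (simp add: mult.assoc)
    then show "integrable M (\<lambda>\<omega>. (third \<beta> \<omega> - m) * exp (t * W \<omega>))" using c by simp
  qed
qed

section \<open>The logarithm of the moment generating function\<close>

text \<open>Differentiation under the expectation: the second-order Taylor remainder of \<open>exp (h * W)\<close> has an integrable majorant as long
as t stays away from the end points of the interval of admissible tilts.\<close>
lemma phi_derivative:
  assumes t: "\<bar>t\<bar> < \<tau>"
  shows "(\<phi> has_real_derivative tE t W) (at t)"
proof -
  obtain i where i: "i \<in> J" by (rule J_elem)
  define d where "d = \<tau> - \<bar>t\<bar>"
  have d: "0 < d" using t by (simp add: d_def)
  have Li: "integrable M (\<lambda>\<omega>. exp (2 * \<tau> * L \<omega>))"
    by (rule dom_integrable[OF _ i i, of _ 1]) (use aS_nonneg[of i] in auto)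
  have Wi: "integrable M (\<lambda>\<omega>. W \<omega> * exp (t * W \<omega>))"
  proof (rule tilt_integrable[OF _ W_meas i i, where C=1])
    fix \<omega>
    have "1 * L \<omega> \<le> \<tau> * L \<omega>" using tau_ge_1 L_nonneg by (intro mult_right_mono) auto
    then have "\<bar>W \<omega>\<bar> \<le> exp (\<tau> * L \<omega>)"
      using abs_W_le_L[of \<omega>] exp_ge_add_one_self[of "\<tau> * L \<omega>"] by linarith
    also have "\<dots> \<le> exp (a * S i \<omega> / 4 + a * S i \<omega> / 4 + \<tau> * L \<omega>)" using aS_nonneg[of i \<omega>] by simp
    finally show "\<bar>W \<omega>\<bar> \<le> 1 * exp (a * S i \<omega> / 4 + a * S i \<omega> / 4 + \<tau> * L \<omega>)" by simp
  qed (use t in auto)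
  define C where "C = 2 * expectation (\<lambda>\<omega>. exp (2 * \<tau> * L \<omega>))"
  have bound: "\<bar>(\<phi> (t + h) - \<phi> t) / h - tE t W\<bar> \<le> C * \<bar>h\<bar>" if h: "h \<noteq> 0" "\<bar>h\<bar> < d" for h
  proof -
    let ?r = "\<lambda>\<omega>. exp ((t + h) * W \<omega>) - exp (t * W \<omega>) - h * (W \<omega> * exp (t * W \<omega>))"
    have th: "\<bar>t + h\<bar> \<le> \<tau>" "\<bar>t\<bar> \<le> \<tau>" "\<bar>t\<bar> + \<bar>h\<bar> \<le> \<tau>" using h t by (auto simp: d_def)
    have pt: "\<bar>?r \<omega>\<bar> \<le> h\<^sup>2 * (2 * exp (2 * \<tau> * L \<omega>))" for \<omega>
    proof -
      have "?r \<omega> = (exp (h * W \<omega>) - 1 - h * W \<omega>) * exp (t * W \<omega>)"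
        by (simp add: algebra_simps exp_add)
      then have "\<bar>?r \<omega>\<bar> = \<bar>exp (h * W \<omega>) - 1 - h * W \<omega>\<bar> * exp (t * W \<omega>)"
        by (simp add: abs_mult)
      also have "\<dots> \<le> ((h * W \<omega>)\<^sup>2 * exp \<bar>h * W \<omega>\<bar>) * exp (\<bar>t * W \<omega>\<bar>)"
        by (intro mult_mono abs_exp_minus_affine_le) auto
      also have "\<dots> = h\<^sup>2 * ((W \<omega>)\<^sup>2 * exp ((\<bar>t\<bar> + \<bar>h\<bar>) * \<bar>W \<omega>\<bar>))"
        by (simp add: power_mult_distrib abs_mult distrib_right exp_add)
      also have "(W \<omega>)\<^sup>2 * exp ((\<bar>t\<bar> + \<bar>h\<bar>) * \<bar>W \<omega>\<bar>) \<le> (2 * exp (\<tau> * L \<omega>)) * exp (\<tau> * L \<omega>)"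
      proof (rule mult_mono)
        have "\<bar>W \<omega>\<bar> ^ 2 \<le> fact 2 * exp \<bar>W \<omega>\<bar>" by (rule power_le_exp) auto
        also have "\<dots> \<le> 2 * exp (\<tau> * L \<omega>)"
          using abs_W_le_L[of \<omega>] mult_right_mono[OF tau_ge_1 L_nonneg, of \<omega>] by (simp add: fact_2)
        finally show "(W \<omega>)\<^sup>2 \<le> 2 * exp (\<tau> * L \<omega>)" by simp
        have "(\<bar>t\<bar> + \<bar>h\<bar>) * \<bar>W \<omega>\<bar> \<le> \<tau> * L \<omega>" using th abs_W_le_L[of \<omega>] by (intro mult_mono) auto
        then show "exp ((\<bar>t\<bar> + \<bar>h\<bar>) * \<bar>W \<omega>\<bar>) \<le> exp (\<tau> * L \<omega>)" by simp
      qed auto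
      also have "(2 * exp (\<tau> * L \<omega>)) * exp (\<tau> * L \<omega>) = 2 * exp (2 * \<tau> * L \<omega>)"
        by (simp add: mult.assoc flip: exp_add)
      finally show ?thesis by (simp add: mult_left_mono)
    qed
    have "\<bar>\<phi> (t + h) - \<phi> t - h * tE t W\<bar>
       = \<bar>expectation ?r\<bar>"
      unfolding \<phi>_def tE_def using exp_tW_integrable th Wi by simp
    also have "\<dots> \<le> expectation (\<lambda>\<omega>. \<bar>?r \<omega>\<bar>)"
      by (rule integral_abs_bound)
    also have "\<dots> \<le> expectation (\<lambda>\<omega>. h\<^sup>2 * (2 * exp (2 * \<tau> * L \<omega>)))"
      by (intro integral_mono pt integrable_abs Bochner_Integration.integrable_diff integrable_mult_right Li Wi exp_tW_integrable th)
    also have "\<dots> = h\<^sup>2 * C" using Li by (simp add: C_def)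
    finally have "\<bar>\<phi> (t + h) - \<phi> t - h * tE t W\<bar> / \<bar>h\<bar> \<le> h\<^sup>2 * C / \<bar>h\<bar>"
      by (intro divide_right_mono) auto
    also have "h\<^sup>2 * C / \<bar>h\<bar> = C * \<bar>h\<bar>"
    using h by (simp add: power2_eq_square abs_if)
    finally have "\<bar>(\<phi> (t + h) - \<phi> t - h * tE t W) / h\<bar> \<le> C * \<bar>h\<bar>" by (simp add: abs_divide)
    moreover have "(\<phi> (t + h) - \<phi> t - h * tE t W) / h = (\<phi> (t + h) - \<phi> t) / h - tE t W"
      using h by (simp add: diff_divide_distrib)
    ultimately show ?thesis by simp
  qed
  have "((\<lambda>h. (\<phi> (t + h) - \<phi> t) / h - tE t W) \<longlongrightarrow> 0) (at 0)"
  proof (rule Lim_null_comparison)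
    show "\<forall>\<^sub>F h in at 0. norm ((\<phi> (t + h) - \<phi> t) / h - tE t W) \<le> C * \<bar>h\<bar>"
      unfolding eventually_at using d bound by (intro exI[of _ d]) (auto simp: dist_real_def)
    show "((\<lambda>h. C * \<bar>h\<bar>) \<longlongrightarrow> 0) (at 0)"
      by (rule tendsto_eq_intros refl | simp)+
  qed
  then show ?thesis unfolding DERIV_def by (rule LIM_zero_cancel)
qed

text \<open>Replace \<open>E (X i * exp (t * W))\<close> by \<open>E (X i * (exp (t * W) - exp (t * (W - Y i))))\<close>, which is the same number, and expand
to first order in \<open>Y i\<close>. The main term is \<open>t * tE t T\<close>, and T concentrates at 1.\<close>
lemma tE_W_close:
  assumes t: "\<bar>t\<bar> \<le> \<tau>"
  shows "\<bar>tE t W - t * \<phi> t\<bar> \<le> 5 * 10 ^ 7 * \<tau>\<^sup>2 * rho * \<phi> t"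
proof -
  have \<tau>a: "0 \<le> \<tau>" "\<tau> \<le> a / 32" using tau_ge_1 small_pieces(4) by auto
  have rem: "integrable M (\<lambda>\<omega>. X i \<omega> * exp (t * (W \<omega> - Y i \<omega>)))"
     "expectation (\<lambda>\<omega>. X i \<omega> * exp (t * (W \<omega> - Y i \<omega>))) = 0" if "i \<in> J" for i
  proof -
    have "exp (t * x) \<le> exp (\<tau> * \<bar>x\<bar>)" for x
    proof -
      have "t * x \<le> \<bar>t\<bar> * \<bar>x\<bar>" by (simp flip: abs_mult)
      also have "\<dots> \<le> \<tau> * \<bar>x\<bar>" using t by (intro mult_right_mono) auto
      finally show ?thesis by simp
    qed
    then show "integrable M (\<lambda>\<omega>. X i \<omega> * exp (t * (W \<omega> - Y i \<omega>)))"
     "expectation (\<lambda>\<omega>. X i \<omega> * exp (t * (W \<omega> - Y i \<omega>))) = 0"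
      using X_remainder_mean_zero[OF that t, of "\<lambda>x. exp (t * x)" 1] by auto
  qed
  have Xe: "integrable M (\<lambda>\<omega>. X i \<omega> * exp (t * W \<omega>))" if i: "i \<in> J" for i
  proof (rule tilt_integrable[OF t X_meas[OF i] i i, where C=1])
    fix \<omega>
    have "\<bar>X i \<omega>\<bar> \<le> a * S i \<omega> / 4 + 0" if "4 \<le> a"
      using abs_X_le_S[OF i self_in_B[OF i], of \<omega>] mult_right_mono[OF that S_nonneg, of i \<omega>] by simp
    moreover have "4 \<le> a" using small_pieces(4) tau_ge_1 by linarith
    ultimately have "\<bar>X i \<omega>\<bar> \<le> exp (a * S i \<omega> / 4)"
      using exp_ge_add_one_self[of "a * S i \<omega> / 4"] by linarith
    also have "\<dots> \<le> exp (a * S i \<omega> / 4 + a * S i \<omega> / 4 + \<tau> * L \<omega>)"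
      using aS_nonneg[of i \<omega>] tau_L_nonneg[of \<omega>] by simp
    finally show "\<bar>X i \<omega>\<bar> \<le> 1 * exp (a * S i \<omega> / 4 + a * S i \<omega> / 4 + \<tau> * L \<omega>)" by simp
  qed
  define R where "R \<omega> = (\<Sum>i\<in>J. X i \<omega> * exp (t * W \<omega>) - X i \<omega> * exp (t * (W \<omega> - Y i \<omega>)))" for \<omega>
  have Ri: "integrable M R"
    unfolding R_def by (intro Bochner_Integration.integrable_sum Bochner_Integration.integrable_diff Xe rem)
  have "tE t W = expectation R"
  proof -
    have "expectation R = (\<Sum>i\<in>J. expectation (\<lambda>\<omega>. X i \<omega> * exp (t * W \<omega>)))"
      unfolding R_def using Xe rem by (subst Bochner_Integration.integral_sum) auto
    also have "\<dots> = tE t W" unfolding tE_def W_def[abs_def] sum_distrib_right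
      using Xe by (subst Bochner_Integration.integral_sum) (auto simp: W_def)
    finally show ?thesis by simp
  qed
  have pt: "\<bar>R \<omega> - t * exp (t * W \<omega>)\<bar> \<le> \<tau> * (\<bar>T \<omega> - 1\<bar> * exp (t * W \<omega>)) + \<tau>\<^sup>2 * (third \<tau> \<omega> * exp (t * W \<omega>))" for \<omega>
  proof -
    define E where "E = exp (t * W \<omega>)"
    have E: "0 < E" by (simp add: E_def)
    let ?e = "\<lambda>i. \<tau>\<^sup>2 * (\<bar>X i \<omega>\<bar> * (Y i \<omega>)\<^sup>2 * exp (\<tau> * \<bar>Y i \<omega>\<bar>)) * E"
    let ?d = "\<lambda>i. X i \<omega> * E - X i \<omega> * exp (t * (W \<omega> - Y i \<omega>)) - t * (X i \<omega> * Y i \<omega>) * E"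
    have one: "\<bar>?d i\<bar>
        \<le> ?e i" for i
    proof -
      have e: "exp (t * (W \<omega> - Y i \<omega>)) = exp (- (t * Y i \<omega>)) * E"
        by (simp add: E_def right_diff_distrib flip: exp_add)
      have "?d i
          = - (X i \<omega> * (exp (- (t * Y i \<omega>)) - 1 - (- (t * Y i \<omega>))) * E)"
        unfolding e by (simp add: algebra_simps)
      then have "\<bar>?d i\<bar>
          = \<bar>X i \<omega>\<bar> * \<bar>exp (- (t * Y i \<omega>)) - 1 - (- (t * Y i \<omega>))\<bar> * E"
        using E by (simp only: abs_minus_cancel abs_mult abs_of_pos)
      also have "\<dots> \<le> \<bar>X i \<omega>\<bar> * ((- (t * Y i \<omega>))\<^sup>2 * exp \<bar>- (t * Y i \<omega>)\<bar>) * E"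
        using E by (intro mult_right_mono mult_left_mono abs_exp_minus_affine_le) auto
      also have "\<dots> \<le> \<bar>X i \<omega>\<bar> * ((\<tau>\<^sup>2 * (Y i \<omega>)\<^sup>2) * exp (\<tau> * \<bar>Y i \<omega>\<bar>)) * E"
      proof (intro mult_right_mono mult_left_mono mult_mono)
        have "t\<^sup>2 \<le> \<tau>\<^sup>2" using t tau_ge_1 by (simp add: abs_le_square_iff[symmetric])
        then show "(- (t * Y i \<omega>))\<^sup>2 \<le> \<tau>\<^sup>2 * (Y i \<omega>)\<^sup>2" by (simp add: power_mult_distrib mult_right_mono)
        show "exp \<bar>- (t * Y i \<omega>)\<bar> \<le> exp (\<tau> * \<bar>Y i \<omega>\<bar>)" using t by (simp add: abs_mult mult_right_mono)
      qed (use E in auto)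
      finally show ?thesis by (simp add: mult_ac)
    qed
    have "R \<omega> - t * E = (\<Sum>i\<in>J. ?d i) + t * (T \<omega> - 1) * E"
      by (simp add: R_def E_def[symmetric] T_def sum_subtractf sum.distrib sum_distrib_left sum_distrib_right algebra_simps)
    then have "\<bar>R \<omega> - t * E\<bar> \<le> \<bar>\<Sum>i\<in>J. ?d i\<bar> + \<bar>t * (T \<omega> - 1) * E\<bar>"
      by linarith
    also have "\<dots> \<le> (\<Sum>i\<in>J. ?e i) + \<tau> * (\<bar>T \<omega> - 1\<bar> * E)"
    proof (rule add_mono)
      show "\<bar>\<Sum>i\<in>J. ?d i\<bar>
         \<le> (\<Sum>i\<in>J. ?e i)"
        by (rule order_trans[OF sum_abs]) (intro sum_mono one)
      have "\<bar>t\<bar> * (\<bar>T \<omega> - 1\<bar> * E) \<le> \<tau> * (\<bar>T \<omega> - 1\<bar> * E)" using E t by (intro mult_right_mono) auto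
      then show "\<bar>t * (T \<omega> - 1) * E\<bar> \<le> \<tau> * (\<bar>T \<omega> - 1\<bar> * E)" using E by (simp add: abs_mult mult.assoc)
    qed
    finally show ?thesis
      by (simp add: E_def third_def sum_distrib_left sum_distrib_right mult.assoc)
  qed
  have Ti: "integrable M (\<lambda>\<omega>. \<bar>T \<omega> - 1\<bar> * exp (t * W \<omega>))"
    using integrable_norm[OF tE_T(1)[OF t]] by (simp add: abs_mult)
  have "\<bar>tE t W - t * \<phi> t\<bar> = \<bar>expectation (\<lambda>\<omega>. R \<omega> - t * exp (t * W \<omega>))\<bar>"
    unfolding \<open>tE t W = expectation R\<close> \<phi>_def using Ri exp_tW_integrable[OF t] by simp
  also have "\<dots> \<le> expectation (\<lambda>\<omega>. \<bar>R \<omega> - t * exp (t * W \<omega>)\<bar>)" by (rule integral_abs_bound)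
  also have "\<dots> \<le> expectation (\<lambda>\<omega>. \<tau> * (\<bar>T \<omega> - 1\<bar> * exp (t * W \<omega>)) + \<tau>\<^sup>2 * (third \<tau> \<omega> * exp (t * W \<omega>)))"
    by (intro integral_mono pt integrable_abs Bochner_Integration.integrable_diff Bochner_Integration.integrable_add
        integrable_mult_right Ri Ti tE_third(1)[OF t \<tau>a] exp_tW_integrable[OF t])
  also have "\<dots> = \<tau> * tE t (\<lambda>\<omega>. \<bar>T \<omega> - 1\<bar>) + \<tau>\<^sup>2 * tE t (third \<tau>)"
    unfolding tE_def using Ti tE_third(1)[OF t \<tau>a] by simp
  also have "\<dots> \<le> \<tau> * (4 * 10 ^ 7 * \<tau> * rho * \<phi> t) + \<tau>\<^sup>2 * (3 * 10 ^ 6 * rho * \<phi> t)"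
    using tau_ge_1 by (intro add_mono mult_left_mono tE_T(2)[OF t] tE_third(2)[OF t \<tau>a]) auto
  also have "\<dots> = 43000000 * (\<tau>\<^sup>2 * rho * \<phi> t)" by (simp add: power2_eq_square)
  also have "\<dots> \<le> 5 * 10 ^ 7 * (\<tau>\<^sup>2 * rho * \<phi> t)"
    using rho_bounds(3) phi_ge_1[OF t] by (intro mult_right_mono) auto
  finally show ?thesis by simp
qed

text \<open>The function \<open>ln (\<phi> t) - t\<^sup>2 / 2\<close> vanishes at 0 and has derivative \<open>tE t W / \<phi> t - t\<close>.\<close>
lemma ln_phi_close:
  assumes t: "\<bar>t\<bar> < \<tau>"
  shows "\<bar>ln (\<phi> t) - t\<^sup>2 / 2\<bar> \<le> 5 * 10 ^ 7 * rho * \<tau> ^ 3"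
    and "\<bar>ln (\<phi> t) - t\<^sup>2 / 2\<bar> \<le> 1 / 2"
proof -
  define K where "K = 5 * 10 ^ 7 * \<tau>\<^sup>2 * rho"
  have K0: "0 \<le> K" using rho_bounds(3) by (simp add: K_def)
  have phi_pos: "0 < \<phi> s" if "\<bar>s\<bar> < \<tau>" for s using phi_ge_1[of s] that by simp
  define g where "g s = ln (\<phi> s) - s\<^sup>2 / 2" for s
  have der: "(g has_field_derivative (tE s W / \<phi> s - s)) (at s within {-\<tau><..<\<tau>})" if "s \<in> {-\<tau><..<\<tau>}" for s
  proof -
    have s: "\<bar>s\<bar> < \<tau>" using that by auto
    show ?thesis unfolding g_def
      by (rule has_field_derivative_at_within)
         (rule derivative_eq_intros phi_derivative[OF s] phi_pos[OF s] refl | simp add: field_simps)+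
  qed
  have bd: "norm (tE s W / \<phi> s - s) \<le> K" if "s \<in> {-\<tau><..<\<tau>}" for s
  proof -
    have s: "\<bar>s\<bar> < \<tau>" using that by auto
    have "\<bar>tE s W - s * \<phi> s\<bar> \<le> K * \<phi> s" using tE_W_close[of s] s by (simp add: K_def)
    moreover have "tE s W / \<phi> s - s = (tE s W - s * \<phi> s) / \<phi> s" using phi_pos[OF s] by (simp add: field_simps)
    ultimately show ?thesis using phi_pos[OF s] by (simp add: abs_divide field_simps)
  qed
  have "norm (g t - g 0) \<le> K * norm (t - 0)"
    by (rule field_differentiable_bound[OF _ der bd]) (use t tau_ge_1 in auto)
  moreover have "g 0 = 0" using prob_space by (simp add: g_def \<phi>_def)
  ultimately have "\<bar>ln (\<phi> t) - t\<^sup>2 / 2\<bar> \<le> K * \<bar>t\<bar>" by (simp add: g_def)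
  also have "\<dots> \<le> K * \<tau>" using t K0 by (intro mult_left_mono) auto
  also have "\<dots> = 5 * 10 ^ 7 * (rho * \<tau> ^ 3)" by (simp add: K_def power2_eq_square power3_eq_cube)
  finally have *: "\<bar>ln (\<phi> t) - t\<^sup>2 / 2\<bar> \<le> 5 * 10 ^ 7 * (rho * \<tau> ^ 3)" .
  then show "\<bar>ln (\<phi> t) - t\<^sup>2 / 2\<bar> \<le> 5 * 10 ^ 7 * rho * \<tau> ^ 3" by simp
  show "\<bar>ln (\<phi> t) - t\<^sup>2 / 2\<bar> \<le> 1 / 2" using * small by simp
qed

end

section \<open>Stein expansion under the tilt\<close>

lemma mean_value_bound:
  fixes f f' :: "real \<Rightarrow> real"
  assumes der: "\<And>w. (f has_real_derivative f' w) (at w)"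
  obtains s where "\<bar>s\<bar> \<le> \<bar>y\<bar>" "f v - f (v - y) = y * f' (v + s)"
proof (cases "y = 0")
  case True
  then show ?thesis using that[of 0] by simp
next
  case False
  show ?thesis
  proof (cases "0 < y")
    case True
    obtain c where "v - y < c" "c < v" "f v - f (v - y) = (v - (v - y)) * f' c"
      using MVT2[of "v - y" v f f'] True der by auto
    then show ?thesis using that[of "c - v"] by simp
  next
    case neg: False
    then have "v < v - y" using False by simp
    then obtain c where "v < c" "c < v - y" "f (v - y) - f v = ((v - y) - v) * f' c"
      using MVT2[of v "v - y" f f'] der by auto
    then show ?thesis using that[of "c - v"] by (simp add: algebra_simps)
  qed
qed

context
  fixes f f' h q :: "real \<Rightarrow> real" and c k \<gamma> :: real
  assumes f_der: "\<And>w. (f has_real_derivative f' w) (at w)"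
    and f_eq: "\<And>w. f' w = w * f w + h w - c"
    and f_le: "\<And>w. \<bar>f w\<bar> \<le> 3" and f'_le: "\<And>w. \<bar>f' w\<bar> \<le> 2"
    and k: "0 \<le> k" and q: "\<And>w. 0 \<le> q w" and \<gamma>: "0 \<le> \<gamma>"
    and osc: "\<And>v u. \<bar>h (v + u) - h v\<bar> \<le> k * (\<bar>u\<bar> * exp (\<gamma> * \<bar>u\<bar>)) * q v"
begin

lemma stein_lipschitz: "\<bar>f v - f (v - y)\<bar> \<le> 2 * \<bar>y\<bar>"
proof -
  obtain s where "f v - f (v - y) = y * f' (v + s)" by (rule mean_value_bound[OF f_der])
  then have "\<bar>f v - f (v - y)\<bar> = \<bar>y\<bar> * \<bar>f' (v + s)\<bar>" by (simp add: abs_mult)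
  also have "\<dots> \<le> \<bar>y\<bar> * 2" by (intro mult_left_mono f'_le) auto
  finally show ?thesis by simp
qed

text \<open>By the Stein equation the increment of \<open>f'\<close> is the increment of \<open>w * f w\<close>, which is Lipschitz with a constant growing
linearly in the argument, plus the increment of h.\<close>
lemma stein_derivative_oscillation:
  assumes s: "\<bar>s\<bar> \<le> r"
  shows "\<bar>f' (v + s) - f' v\<bar> \<le> r * (2 * \<bar>v\<bar> + 3 + k * exp (\<gamma> * r) * q v)"
proof -
  have r: "0 \<le> r" using s by linarith
  have "f' (v + s) - f' v = v * (f (v + s) - f v) + s * f (v + s) + (h (v + s) - h v)"
    unfolding f_eq by (simp add: algebra_simps)
  then have "\<bar>f' (v + s) - f' v\<bar> \<le> \<bar>v * (f (v + s) - f v)\<bar> + \<bar>s * f (v + s)\<bar> + \<bar>h (v + s) - h v\<bar>"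
    by linarith
  also have "\<dots> \<le> \<bar>v\<bar> * (2 * r) + r * 3 + k * (r * exp (\<gamma> * r)) * q v"
  proof (intro add_mono)
    have "\<bar>f (v + s) - f v\<bar> \<le> 2 * r" using stein_lipschitz[of v "- s"] s by (simp add: abs_minus_commute)
    then show "\<bar>v * (f (v + s) - f v)\<bar> \<le> \<bar>v\<bar> * (2 * r)" unfolding abs_mult by (intro mult_left_mono) auto
    show "\<bar>s * f (v + s)\<bar> \<le> r * 3" unfolding abs_mult using s f_le r by (intro mult_mono) auto
    have "\<bar>s\<bar> * exp (\<gamma> * \<bar>s\<bar>) \<le> r * exp (\<gamma> * r)"
      using s r \<gamma> by (intro mult_mono) (auto intro: mult_left_mono)
    then have "k * (\<bar>s\<bar> * exp (\<gamma> * \<bar>s\<bar>)) * q v \<le> k * (r * exp (\<gamma> * r)) * q v"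
      using k q by (intro mult_right_mono mult_left_mono) auto
    then show "\<bar>h (v + s) - h v\<bar> \<le> k * (r * exp (\<gamma> * r)) * q v" using osc[of v s] by linarith
  qed
  finally show ?thesis by (simp add: algebra_simps)
qed

text \<open>One summand of \<open>W * f V\<close> under the tilt: with \<open>x = X i\<close>, \<open>y = Y i\<close> and \<open>v = V\<close>, the second term is the one whose
expectation vanishes and the third one is the contribution of i to \<open>T * (f' V + z * f V)\<close>.\<close>
lemma stein_local_expansion:
  assumes z: "0 \<le> z"
  shows "\<bar>x * f v - x * f (v - y) * exp (- (z * y)) - x * y * (f' v + z * f v)\<bar>
    \<le> \<bar>x\<bar> * y\<^sup>2 * (2 * \<bar>v\<bar> + 3 + k * exp (\<gamma> * \<bar>y\<bar>) * q v + (3 * z\<^sup>2 + 2 * z) * exp (z * \<bar>y\<bar>))"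
proof -
  let ?r = "(exp (- (z * y)) - 1 - (- (z * y)))"
  let ?K = "(2 * \<bar>v\<bar> + 3 + k * exp (\<gamma> * \<bar>y\<bar>) * q v)"
  have A: "\<bar>f v - f (v - y) - y * f' v\<bar> \<le> y\<^sup>2 * ?K"
  proof -
    obtain s where s: "\<bar>s\<bar> \<le> \<bar>y\<bar>" "f v - f (v - y) = y * f' (v + s)" by (rule mean_value_bound[OF f_der])
    have "f v - f (v - y) - y * f' v = y * (f' (v + s) - f' v)" unfolding s(2) by (simp add: right_diff_distrib)
    then have "\<bar>f v - f (v - y) - y * f' v\<bar> = \<bar>y\<bar> * \<bar>f' (v + s) - f' v\<bar>" by (simp add: abs_mult)
    also have "\<dots> \<le> \<bar>y\<bar> * (\<bar>y\<bar> * ?K)"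
      by (intro mult_left_mono stein_derivative_oscillation[OF s(1)]) auto
    also have "\<dots> = (\<bar>y\<bar> * \<bar>y\<bar>) * ?K" by (simp only: mult.assoc)
    finally show ?thesis by (simp add: power2_eq_square)
  qed
  have B: "\<bar>f (v - y) * ?r\<bar> \<le> 3 * (z\<^sup>2 * y\<^sup>2 * exp (z * \<bar>y\<bar>))"
  proof -
    have "\<bar>exp (- (z * y)) - 1 - (- (z * y))\<bar> \<le> (- (z * y))\<^sup>2 * exp \<bar>- (z * y)\<bar>" by (rule abs_exp_minus_affine_le)
    also have "\<dots> = z\<^sup>2 * y\<^sup>2 * exp (z * \<bar>y\<bar>)" using z by (simp add: power_mult_distrib abs_mult)
    finally show ?thesis unfolding abs_mult by (intro mult_mono f_le) auto
  qed
  have C: "\<bar>z * y * (f v - f (v - y))\<bar> \<le> 2 * z * y\<^sup>2 * exp (z * \<bar>y\<bar>)"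
  proof -
    have "\<bar>z * y * (f v - f (v - y))\<bar> = z * \<bar>y\<bar> * \<bar>f v - f (v - y)\<bar>" using z by (simp add: abs_mult)
    also have "\<dots> \<le> z * \<bar>y\<bar> * (2 * \<bar>y\<bar>)" using z by (intro mult_left_mono stein_lipschitz) auto
    also have "\<dots> = 2 * z * y\<^sup>2 * 1" by (simp add: power2_eq_square)
    also have "\<dots> \<le> 2 * z * y\<^sup>2 * exp (z * \<bar>y\<bar>)" by (rule mult_left_mono) (use z in auto)
    finally show ?thesis .
  qed
  have "x * f v - x * f (v - y) * exp (- (z * y)) - x * y * (f' v + z * f v)
    = x * ((f v - f (v - y) - y * f' v) - f (v - y) * ?r - z * y * (f v - f (v - y)))"
    by (simp add: algebra_simps)
  then have "\<bar>x * f v - x * f (v - y) * exp (- (z * y)) - x * y * (f' v + z * f v)\<bar>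
     = \<bar>x\<bar> * \<bar>(f v - f (v - y) - y * f' v) - f (v - y) * ?r - z * y * (f v - f (v - y))\<bar>"
    by (simp only: abs_mult)
  also have "\<dots> \<le> \<bar>x\<bar> * (y\<^sup>2 * ?K + 3 * (z\<^sup>2 * y\<^sup>2 * exp (z * \<bar>y\<bar>)) + 2 * z * y\<^sup>2 * exp (z * \<bar>y\<bar>))"
    using A B C by (intro mult_left_mono) linarith+
  finally show ?thesis by (simp add: algebra_simps)
qed

end

context tilted_field
begin

lemma bounded_tilt_integrable:
  assumes g[measurable]: "g \<in> borel_measurable borel" and C: "\<And>x. \<bar>g x\<bar> \<le> C" and t: "\<bar>t\<bar> \<le> \<tau>"
  shows "integrable M (\<lambda>\<omega>. g (W \<omega> - z) * exp (t * W \<omega>))"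
proof (rule Bochner_Integration.integrable_bound[OF integrable_mult_right[OF exp_tW_integrable[OF t], of C]])
  show "AE \<omega> in M. norm (g (W \<omega> - z) * exp (t * W \<omega>)) \<le> norm (C * exp (t * W \<omega>))"
    using C order_trans[OF C abs_ge_self] by (intro AE_I2) (simp add: abs_mult mult_right_mono)
qed measurable

context
  fixes z :: real
  assumes z: "0 \<le> z" and tau_z: "\<tau> = z + 2"
begin

lemma z_le: "\<bar>z\<bar> \<le> \<tau>" "\<bar>z\<bar> < \<tau>" "\<bar>z + 1\<bar> \<le> \<tau>" "\<bar>z + 1\<bar> < \<tau>" "\<bar>z - 1\<bar> \<le> \<tau>" "\<bar>z - 1\<bar> < \<tau>"
  using z tau_z by auto

lemma phi_bounds:
  assumes "\<bar>t\<bar> < \<tau>"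
  shows "\<phi> t \<le> exp (t\<^sup>2 / 2 + 1 / 2)" "exp (t\<^sup>2 / 2 - 1 / 2) \<le> \<phi> t"
proof -
  have p: "0 < \<phi> t" using phi_ge_1[of t] assms by simp
  have "\<bar>ln (\<phi> t) - t\<^sup>2 / 2\<bar> \<le> 1 / 2" by (rule ln_phi_close(2)[OF assms])
  then have "ln (\<phi> t) \<le> t\<^sup>2 / 2 + 1 / 2" "t\<^sup>2 / 2 - 1 / 2 \<le> ln (\<phi> t)" by linarith+
  then show "\<phi> t \<le> exp (t\<^sup>2 / 2 + 1 / 2)" "exp (t\<^sup>2 / 2 - 1 / 2) \<le> \<phi> t"
    using p by (metis exp_le_cancel_iff exp_ln)+
qed

lemma exp_two_le: "exp (2::real) \<le> 9"
proof -
  have "exp (2::real) = (exp 1)\<^sup>2" by (simp flip: exp_double)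
  also have "\<dots> \<le> 3\<^sup>2" by (intro power_mono Transcendental.exp_le) auto
  finally show ?thesis by simp
qed

text \<open>Up to constants \<open>\<phi> t\<close> is \<open>exp (t\<^sup>2 / 2)\<close>, and \<open>(z \<plusminus> 1)\<^sup>2 / 2 \<mp> z = z\<^sup>2 / 2 + 1 / 2\<close>.\<close>
lemma phi_shift: "exp (- z) * \<phi> (z + 1) \<le> 9 * \<phi> z" "exp z * \<phi> (z - 1) \<le> 9 * \<phi> z"
proof -
  have b: "9 * exp (z\<^sup>2 / 2 - 1 / 2) \<le> 9 * \<phi> z" using phi_bounds(2)[OF z_le(2)] by simp
  have e: "exp (z\<^sup>2 / 2 + 1) \<le> 9 * exp (z\<^sup>2 / 2 - 1 / 2)"
  proof -
    have "exp (z\<^sup>2 / 2 + 1) \<le> exp (2 + (z\<^sup>2 / 2 - 1 / 2))" by simp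
    also have "\<dots> \<le> 9 * exp (z\<^sup>2 / 2 - 1 / 2)" unfolding exp_add using exp_two_le by (rule mult_right_mono) simp
    finally show ?thesis .
  qed
  have "exp (- z) * \<phi> (z + 1) \<le> exp (- z) * exp ((z + 1)\<^sup>2 / 2 + 1 / 2)"
    by (intro mult_left_mono phi_bounds z_le) auto
  also have "\<dots> = exp (z\<^sup>2 / 2 + 1)" by (simp add: power2_sum add_divide_distrib flip: exp_add)
  finally show "exp (- z) * \<phi> (z + 1) \<le> 9 * \<phi> z" using e b by linarith
  have "exp z * \<phi> (z - 1) \<le> exp z * exp ((z - 1)\<^sup>2 / 2 + 1 / 2)"
    by (intro mult_left_mono phi_bounds z_le) auto
  also have "\<dots> = exp (z\<^sup>2 / 2 + 1)" by (simp add: power2_diff add_divide_distrib diff_divide_distrib flip: exp_add)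
  finally show "exp z * \<phi> (z - 1) \<le> 9 * \<phi> z" using e b by linarith
qed

text \<open>The linear growth in \<open>V = W - z\<close> is absorbed into tilts by \<open>z + 1\<close> and \<open>z - 1\<close>, since
\<open>1 + \<bar>V\<bar> \<le> exp V + exp (- V)\<close>.\<close>
lemma third_times_V:
  "integrable M (\<lambda>\<omega>. third 0 \<omega> * (\<bar>W \<omega> - z\<bar> + 1) * exp (z * W \<omega>))"
  "tE z (\<lambda>\<omega>. third 0 \<omega> * (\<bar>W \<omega> - z\<bar> + 1)) \<le> 6 * 10 ^ 7 * rho * \<phi> z"
proof -
  let ?g = "\<lambda>\<omega>. third 0 \<omega> * (\<bar>W \<omega> - z\<bar> + 1) * exp (z * W \<omega>)"
  have a32: "0 \<le> (0::real)" "0 \<le> a / 32" using a_pos by auto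
  define R where "R \<omega> = exp (- z) * (third 0 \<omega> * exp ((z + 1) * W \<omega>)) + exp z * (third 0 \<omega> * exp ((z - 1) * W \<omega>))" for \<omega>
  have Ri: "integrable M R"
    unfolding R_def by (intro Bochner_Integration.integrable_add integrable_mult_right tE_third(1) z_le a32)
  have third0: "0 \<le> third 0 \<omega>" for \<omega> unfolding third_def by (intro sum_nonneg) auto
  have pt: "?g \<omega> \<le> R \<omega>" for \<omega>
  proof -
    have "\<bar>W \<omega> - z\<bar> + 1 \<le> exp \<bar>W \<omega> - z\<bar>" using exp_ge_add_one_self[of "\<bar>W \<omega> - z\<bar>"] by linarith
    also have "\<dots> \<le> exp (W \<omega> - z) + exp (z - W \<omega>)" by (cases "W \<omega> \<ge> z") (auto simp: abs_if)
    finally have "?g \<omega> \<le> third 0 \<omega> * (exp (W \<omega> - z) + exp (z - W \<omega>)) * exp (z * W \<omega>)"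
      using third0 by (intro mult_right_mono mult_left_mono) auto
    also have "\<dots> = R \<omega>"
    proof -
      have "exp (W \<omega> - z) * exp (z * W \<omega>) = exp (- z) * exp ((z + 1) * W \<omega>)"
        "exp (z - W \<omega>) * exp (z * W \<omega>) = exp z * exp ((z - 1) * W \<omega>)"
        by (simp_all add: algebra_simps flip: exp_add)
      then show ?thesis unfolding R_def by (simp add: distrib_left distrib_right mult.assoc mult.left_commute)
    qed
    finally show ?thesis .
  qed
  have Tm: "third 0 \<in> borel_measurable M"
    unfolding third_def using X_meas Y_meas by measurable
  show int: "integrable M ?g"
  proof (rule Bochner_Integration.integrable_bound[OF Ri])
    show "?g \<in> borel_measurable M" using Tm by measurable
    show "AE \<omega> in M. norm (?g \<omega>) \<le> norm (R \<omega>)"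
    proof (rule AE_I2)
      fix \<omega>
      have "0 \<le> ?g \<omega>" using third0 by (intro mult_nonneg_nonneg) auto
      then show "norm (?g \<omega>) \<le> norm (R \<omega>)" using pt[of \<omega>] by simp
    qed
  qed
  have "tE z (\<lambda>\<omega>. third 0 \<omega> * (\<bar>W \<omega> - z\<bar> + 1)) \<le> expectation R"
    unfolding tE_def by (intro integral_mono int Ri pt)
  also have "\<dots> = exp (- z) * tE (z + 1) (third 0) + exp z * tE (z - 1) (third 0)"
    unfolding R_def tE_def using tE_third(1)[OF z_le(3) a32] tE_third(1)[OF z_le(5) a32] by simp
  also have "\<dots> \<le> exp (- z) * (3 * 10 ^ 6 * rho * \<phi> (z + 1)) + exp z * (3 * 10 ^ 6 * rho * \<phi> (z - 1))"
    by (intro add_mono mult_left_mono tE_third(2) z_le a32) auto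
  also have "\<dots> = (3 * 10 ^ 6 * rho) * (exp (- z) * \<phi> (z + 1) + exp z * \<phi> (z - 1))" by (simp add: algebra_simps)
  also have "\<dots> \<le> (3 * 10 ^ 6 * rho) * (18 * \<phi> z)"
    using phi_shift rho_bounds(3) by (intro mult_left_mono) auto
  also have "\<dots> \<le> 6 * 10 ^ 7 * rho * \<phi> z"
    using rho_bounds(3) phi_ge_1[OF z_le(1)] mult_pos_pos[of rho "\<phi> z"] by simp
  finally show "tE z (\<lambda>\<omega>. third 0 \<omega> * (\<bar>W \<omega> - z\<bar> + 1)) \<le> 6 * 10 ^ 7 * rho * \<phi> z" .
qed

text \<open>Under the tilt, \<open>h V - c = f' V + z * f V - W * f V\<close> by the Stein equation, and \<open>W * f V\<close> may be replaced by
\<open>T * (f' V + z * f V)\<close> up to third-order errors. The error that carries the oscillation of h contains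
\<open>q V * third \<gamma>\<close>, where \<open>third \<gamma>\<close> is replaced by its mean m; this produces the term with the expectation of q.\<close>
lemma stein_bound:
  fixes f f' h q :: "real \<Rightarrow> real" and c k \<gamma> :: real
  assumes f_der: "\<And>w. (f has_real_derivative f' w) (at w)"
    and f_eq: "\<And>w. f' w = w * f w + h w - c"
    and f_le: "\<And>w. \<bar>f w\<bar> \<le> 3" and f'_le: "\<And>w. \<bar>f' w\<bar> \<le> 2"
    and hm[measurable]: "h \<in> borel_measurable borel"
    and k: "0 \<le> k" and q: "\<And>w. 0 \<le> q w" "\<And>w. q w \<le> 1" and qm[measurable]: "q \<in> borel_measurable borel"
    and \<gamma>: "0 \<le> \<gamma>" "\<gamma> \<le> a / 128"
    and osc: "\<And>v u. \<bar>h (v + u) - h v\<bar> \<le> k * (\<bar>u\<bar> * exp (\<gamma> * \<bar>u\<bar>)) * q v"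
    and h01: "\<And>w. 0 \<le> h w" "\<And>w. h w \<le> 1"
  shows "\<bar>tE z (\<lambda>\<omega>. h (W \<omega> - z)) - c * \<phi> z\<bar> \<le> 3 * 10 ^ 8 * \<tau>\<^sup>2 * rho * \<phi> z
      + k * (13 * 10 ^ 6 * v / a * tE z (\<lambda>\<omega>. q (W \<omega> - z)) + 6 * 10 ^ 10 * \<tau> * rho / a * \<phi> z)"
proof -
  note zt = z_le(1)
  let ?x = "\<lambda>i \<omega>. X i \<omega> * f (W \<omega> - z) * exp (z * W \<omega>)"
  let ?rem = "\<lambda>i \<omega>. X i \<omega> * (f ((W \<omega> - Y i \<omega>) - z) * exp (z * (W \<omega> - Y i \<omega>)))"
  have fm[measurable]: "f \<in> borel_measurable borel"
    by (intro borel_measurable_continuous_onI continuous_at_imp_continuous_on ballI DERIV_isCont[OF f_der])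
  have f'm[measurable]: "f' \<in> borel_measurable borel"
    unfolding f_eq by measurable
  define G where "G w = f' w + z * f w" for w
  have Gm[measurable]: "G \<in> borel_measurable borel" unfolding G_def by measurable
  let ?G = "\<lambda>\<omega>. G (W \<omega> - z) * exp (z * W \<omega>)"
  have G_le: "\<bar>G w\<bar> \<le> 3 * \<tau>" for w
  proof -
    have "\<bar>G w\<bar> \<le> \<bar>f' w\<bar> + z * \<bar>f w\<bar>" unfolding G_def using z by (simp add: abs_mult order_trans[OF abs_triangle_ineq])
    also have "\<dots> \<le> 2 + z * 3" using z by (intro add_mono f'_le mult_left_mono f_le)
    finally show ?thesis using tau_z by simp
  qed
  obtain m where m: "0 \<le> m" "m \<le> 13 * 10 ^ 6 * v / a"
    "tE z (\<lambda>\<omega>. \<bar>third \<gamma> \<omega> - m\<bar>) \<le> 6 * 10 ^ 10 * \<tau> * rho / a * \<phi> z"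
    "integrable M (\<lambda>\<omega>. (third \<gamma> \<omega> - m) * exp (z * W \<omega>))"
    by (rule third_concentration[OF zt \<gamma>])
  define R where "R \<omega> = (\<Sum>i\<in>J. ?x i \<omega> - ?rem i \<omega>)" for \<omega>
  have rem: "integrable M (?rem i)"
     "expectation (?rem i) = 0" if i: "i \<in> J" for i
  proof -
    have g: "\<bar>f (x - z) * exp (z * x)\<bar> \<le> 3 * exp (\<tau> * \<bar>x\<bar>)" for x
    proof -
      have "z * x \<le> z * \<bar>x\<bar>" using z by (intro mult_left_mono) auto
      also have "\<dots> \<le> \<tau> * \<bar>x\<bar>" using tau_z by (intro mult_right_mono) auto
      finally show ?thesis unfolding abs_mult by (intro mult_mono f_le) auto
    qed
    show "integrable M (?rem i)"
     "expectation (?rem i) = 0"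
      using X_remainder_mean_zero[OF i zt, of "\<lambda>x. f (x - z) * exp (z * x)" 3] g by auto
  qed
  have Xf: "integrable M (?x i)" if i: "i \<in> J" for i
  proof (rule tilt_integrable[OF zt _ i i, where C=3])
    show "(\<lambda>\<omega>. X i \<omega> * f (W \<omega> - z)) \<in> borel_measurable M" using X_meas[OF i] by measurable
    fix \<omega>
    have "4 \<le> a" using small_pieces(4) tau_ge_1 by linarith
    then have "S i \<omega> \<le> a * S i \<omega> / 4" using mult_right_mono[of 4 a "S i \<omega>"] S_nonneg by simp
    then have "\<bar>X i \<omega>\<bar> \<le> exp (a * S i \<omega> / 4)"
      using abs_X_le_S[OF i self_in_B[OF i], of \<omega>] exp_ge_add_one_self[of "a * S i \<omega> / 4"] by linarith
    also have "\<dots> \<le> exp (a * S i \<omega> / 4 + a * S i \<omega> / 4 + \<tau> * L \<omega>)"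
      using aS_nonneg[of i \<omega>] tau_L_nonneg[of \<omega>] by simp
    finally have "\<bar>X i \<omega>\<bar> * \<bar>f (W \<omega> - z)\<bar> \<le> exp (a * S i \<omega> / 4 + a * S i \<omega> / 4 + \<tau> * L \<omega>) * 3"
      by (intro mult_mono f_le) auto
    then show "\<bar>X i \<omega> * f (W \<omega> - z)\<bar> \<le> 3 * exp (a * S i \<omega> / 4 + a * S i \<omega> / 4 + \<tau> * L \<omega>)"
      by (simp add: abs_mult)
  qed
  have Ri: "integrable M R"
    unfolding R_def by (intro Bochner_Integration.integrable_sum Bochner_Integration.integrable_diff Xf rem)
  have ER: "expectation R = expectation (\<lambda>\<omega>. W \<omega> * f (W \<omega> - z) * exp (z * W \<omega>))"
  proof -
    have "expectation R = (\<Sum>i\<in>J. expectation (?x i))"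
      unfolding R_def using Xf rem by (subst Bochner_Integration.integral_sum) auto
    also have "\<dots> = expectation (\<lambda>\<omega>. \<Sum>i\<in>J. ?x i \<omega>)"
      by (rule Bochner_Integration.integral_sum[symmetric]) (rule Xf)
    finally show ?thesis by (simp add: W_def sum_distrib_right)
  qed
  have Wf: "integrable M (\<lambda>\<omega>. W \<omega> * f (W \<omega> - z) * exp (z * W \<omega>))"
  proof -
    have "integrable M (\<lambda>\<omega>. \<Sum>i\<in>J. ?x i \<omega>)"
      by (intro Bochner_Integration.integrable_sum Xf)
    then show ?thesis by (simp add: W_def sum_distrib_right)
  qed
  have Gi: "integrable M ?G"
    by (rule bounded_tilt_integrable[OF Gm G_le zt])
  have hi: "integrable M (\<lambda>\<omega>. h (W \<omega> - z) * exp (z * W \<omega>))"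
    by (rule bounded_tilt_integrable[OF hm _ zt, of 1]) (use h01 in \<open>simp add: abs_of_nonneg\<close>)
  have qi: "integrable M (\<lambda>\<omega>. q (W \<omega> - z) * exp (z * W \<omega>))"
    by (rule bounded_tilt_integrable[OF qm _ zt, of 1]) (use q in auto)
  have main: "tE z (\<lambda>\<omega>. h (W \<omega> - z)) - c * \<phi> z = expectation (\<lambda>\<omega>. ?G \<omega> - R \<omega>)"
  proof -
    have "expectation (\<lambda>\<omega>. ?G \<omega> - R \<omega>)
        = expectation ?G - expectation (\<lambda>\<omega>. W \<omega> * f (W \<omega> - z) * exp (z * W \<omega>))"
      using Gi Ri ER by simp
    also have "\<dots> = expectation (\<lambda>\<omega>. ?G \<omega> - W \<omega> * f (W \<omega> - z) * exp (z * W \<omega>))"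
      using Gi Wf by simp
    also have "\<dots> = expectation (\<lambda>\<omega>. h (W \<omega> - z) * exp (z * W \<omega>) - c * exp (z * W \<omega>))"
      by (intro Bochner_Integration.integral_cong refl) (simp add: G_def f_eq algebra_simps)
    also have "\<dots> = tE z (\<lambda>\<omega>. h (W \<omega> - z)) - c * \<phi> z"
      unfolding tE_def \<phi>_def using hi exp_tW_integrable[OF zt] by simp
    finally show ?thesis by simp
  qed
  define D where "D \<omega> = 3 * \<tau> * (\<bar>T \<omega> - 1\<bar> * exp (z * W \<omega>)) + 3 * (third 0 \<omega> * (\<bar>W \<omega> - z\<bar> + 1) * exp (z * W \<omega>))
     + k * (m * (q (W \<omega> - z) * exp (z * W \<omega>)) + \<bar>third \<gamma> \<omega> - m\<bar> * exp (z * W \<omega>))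
     + 3 * \<tau>\<^sup>2 * (third z \<omega> * exp (z * W \<omega>))" for \<omega>
  have za: "0 \<le> z" "z \<le> a / 32" using z tau_z small_pieces(4) by auto
  have Ti: "integrable M (\<lambda>\<omega>. \<bar>T \<omega> - 1\<bar> * exp (z * W \<omega>))"
    using integrable_norm[OF tE_T(1)[OF zt]] by (simp add: abs_mult)
  have mi: "integrable M (\<lambda>\<omega>. \<bar>third \<gamma> \<omega> - m\<bar> * exp (z * W \<omega>))"
    using integrable_norm[OF m(4)] by (simp add: abs_mult)
  have Di: "integrable M D"
    unfolding D_def by (intro Bochner_Integration.integrable_add integrable_mult_right Ti mi qi third_times_V(1) tE_third(1)[OF zt za])
  have pt: "\<bar>?G \<omega> - R \<omega>\<bar> \<le> D \<omega>" for \<omega>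
  proof -
    define E where "E = exp (z * W \<omega>)"
    define V where "V = W \<omega> - z"
    have E: "0 < E" by (simp add: E_def)
    let ?e = "\<lambda>i. (\<bar>X i \<omega>\<bar> * (Y i \<omega>)\<^sup>2 * (2 * \<bar>V\<bar> + 3 + k * exp (\<gamma> * \<bar>Y i \<omega>\<bar>) * q V + (3 * z\<^sup>2 + 2 * z) * exp (z * \<bar>Y i \<omega>\<bar>))) * E"
    let ?d = "\<lambda>i. X i \<omega> * f V * E - ?rem i \<omega> - X i \<omega> * Y i \<omega> * G V * E"
    have one: "\<bar>?d i\<bar>
       \<le> ?e i" for i
    proof -
      have e: "exp (z * (W \<omega> - Y i \<omega>)) = exp (- (z * Y i \<omega>)) * E"
        by (simp add: E_def right_diff_distrib flip: exp_add)
      have vy: "(W \<omega> - Y i \<omega>) - z = V - Y i \<omega>" by (simp add: V_def)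
      have "?d i
         = (X i \<omega> * f V - X i \<omega> * f (V - Y i \<omega>) * exp (- (z * Y i \<omega>)) - X i \<omega> * Y i \<omega> * (f' V + z * f V)) * E"
        unfolding e vy by (simp add: G_def algebra_simps)
      then have "\<bar>?d i\<bar>
         = \<bar>X i \<omega> * f V - X i \<omega> * f (V - Y i \<omega>) * exp (- (z * Y i \<omega>)) - X i \<omega> * Y i \<omega> * (f' V + z * f V)\<bar> * E"
        using E by (simp only: abs_mult abs_of_pos)
      also have "\<dots> \<le> ?e i"
        using E by (intro mult_right_mono stein_local_expansion[where c=c and h=h] f_der f_eq f_le f'_le k q(1) \<gamma>(1) osc z) auto
      finally show ?thesis .
    qed
    have split: "R \<omega> - T \<omega> * G V * E = (\<Sum>i\<in>J. ?d i)"
      unfolding R_def T_def E_def[symmetric] V_def[symmetric] by (simp only: sum_subtractf sum_distrib_right)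
    have "\<bar>R \<omega> - T \<omega> * G V * E\<bar> \<le> (\<Sum>i\<in>J. ?e i)"
      unfolding split by (rule order_trans[OF sum_abs]) (intro sum_mono one)
    also have "\<dots> = (2 * \<bar>V\<bar> + 3) * (third 0 \<omega> * E) + k * (q V * third \<gamma> \<omega> * E) + (3 * z\<^sup>2 + 2 * z) * (third z \<omega> * E)"
      unfolding third_def by (simp add: sum_distrib_left sum_distrib_right sum.distrib[symmetric]) (simp add: algebra_simps)
    also have "\<dots> \<le> 3 * (third 0 \<omega> * (\<bar>V\<bar> + 1) * E) + k * (m * (q V * E) + \<bar>third \<gamma> \<omega> - m\<bar> * E) + 3 * \<tau>\<^sup>2 * (third z \<omega> * E)"
    proof (intro add_mono)
      have t0: "0 \<le> third \<beta> \<omega>" for \<beta> unfolding third_def by (intro sum_nonneg) auto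
      have "(2 * \<bar>V\<bar> + 3) * (third 0 \<omega> * E) \<le> (3 * (\<bar>V\<bar> + 1)) * (third 0 \<omega> * E)"
        using t0 E by (intro mult_right_mono) auto
      then show "(2 * \<bar>V\<bar> + 3) * (third 0 \<omega> * E) \<le> 3 * (third 0 \<omega> * (\<bar>V\<bar> + 1) * E)" by (simp only: mult_ac)
      have "q V * third \<gamma> \<omega> \<le> m * q V + \<bar>third \<gamma> \<omega> - m\<bar>"
      proof -
        have "q V * (third \<gamma> \<omega> - m) \<le> q V * \<bar>third \<gamma> \<omega> - m\<bar>" using q by (intro mult_left_mono) auto
        also have "\<dots> \<le> 1 * \<bar>third \<gamma> \<omega> - m\<bar>" using q by (intro mult_right_mono) auto
        finally show ?thesis by (simp add: algebra_simps)
      qed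
      then have "q V * third \<gamma> \<omega> * E \<le> (m * q V + \<bar>third \<gamma> \<omega> - m\<bar>) * E" using E by (intro mult_right_mono) auto
      then show "k * (q V * third \<gamma> \<omega> * E) \<le> k * (m * (q V * E) + \<bar>third \<gamma> \<omega> - m\<bar> * E)"
        using k by (intro mult_left_mono) (auto simp: distrib_right mult.assoc)
      have "3 * z\<^sup>2 + 2 * z \<le> 3 * \<tau>\<^sup>2" using z by (simp add: tau_z power2_sum)
      then show "(3 * z\<^sup>2 + 2 * z) * (third z \<omega> * E) \<le> 3 * \<tau>\<^sup>2 * (third z \<omega> * E)"
        using t0 E by (intro mult_right_mono) auto
    qed
    finally have 1: "\<bar>R \<omega> - T \<omega> * G V * E\<bar> \<le> 3 * (third 0 \<omega> * (\<bar>V\<bar> + 1) * E) + k * (m * (q V * E) + \<bar>third \<gamma> \<omega> - m\<bar> * E) + 3 * \<tau>\<^sup>2 * (third z \<omega> * E)" .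
    have "G V * E - R \<omega> = - ((T \<omega> - 1) * G V * E) - (R \<omega> - T \<omega> * G V * E)" by (simp add: algebra_simps)
    then have "\<bar>G V * E - R \<omega>\<bar> \<le> \<bar>(T \<omega> - 1) * G V * E\<bar> + \<bar>R \<omega> - T \<omega> * G V * E\<bar>" by linarith
    also have "\<bar>(T \<omega> - 1) * G V * E\<bar> \<le> 3 * \<tau> * (\<bar>T \<omega> - 1\<bar> * E)"
    proof -
      have "\<bar>(T \<omega> - 1) * G V * E\<bar> = \<bar>G V\<bar> * (\<bar>T \<omega> - 1\<bar> * E)" using E by (simp add: abs_mult)
      also have "\<dots> \<le> 3 * \<tau> * (\<bar>T \<omega> - 1\<bar> * E)" using E by (intro mult_right_mono G_le) auto
      finally show ?thesis .
    qed
    finally show ?thesis using 1 unfolding D_def E_def[symmetric] V_def[symmetric] by linarith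
  qed
  have "\<bar>tE z (\<lambda>\<omega>. h (W \<omega> - z)) - c * \<phi> z\<bar> \<le> expectation (\<lambda>\<omega>. \<bar>?G \<omega> - R \<omega>\<bar>)"
    unfolding main by (rule integral_abs_bound)
  also have "\<dots> \<le> expectation D"
    by (intro integral_mono pt integrable_abs Bochner_Integration.integrable_diff Gi Ri Di)
  also have "\<dots> = 3 * \<tau> * tE z (\<lambda>\<omega>. \<bar>T \<omega> - 1\<bar>) + 3 * tE z (\<lambda>\<omega>. third 0 \<omega> * (\<bar>W \<omega> - z\<bar> + 1))
     + k * (m * tE z (\<lambda>\<omega>. q (W \<omega> - z)) + tE z (\<lambda>\<omega>. \<bar>third \<gamma> \<omega> - m\<bar>)) + 3 * \<tau>\<^sup>2 * tE z (third z)"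
    unfolding D_def tE_def using Ti mi qi third_times_V(1) tE_third(1)[OF zt za] by simp
  also have "\<dots> \<le> 3 * \<tau> * (4 * 10 ^ 7 * \<tau> * rho * \<phi> z) + 3 * (6 * 10 ^ 7 * rho * \<phi> z)
     + k * (13 * 10 ^ 6 * v / a * tE z (\<lambda>\<omega>. q (W \<omega> - z)) + 6 * 10 ^ 10 * \<tau> * rho / a * \<phi> z) + 3 * \<tau>\<^sup>2 * (3 * 10 ^ 6 * rho * \<phi> z)"
  proof (intro add_mono mult_left_mono mult_right_mono m tE_T(2)[OF zt] tE_third(2)[OF zt za] third_times_V(2) k)
    show "0 \<le> tE z (\<lambda>\<omega>. q (W \<omega> - z))" unfolding tE_def using q by (intro integral_nonneg_AE AE_I2) auto
  qed (use tau_ge_1 in auto)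
  also have "\<dots> \<le> 3 * 10 ^ 8 * \<tau>\<^sup>2 * rho * \<phi> z
      + k * (13 * 10 ^ 6 * v / a * tE z (\<lambda>\<omega>. q (W \<omega> - z)) + 6 * 10 ^ 10 * \<tau> * rho / a * \<phi> z)"
  proof -
    define P where "P = rho * \<phi> z"
    have P: "0 \<le> P" using rho_bounds(3) phi_ge_1[OF zt] by (simp add: P_def)
    have t4: "4 \<le> \<tau>\<^sup>2" using z by (simp add: tau_z power2_sum)
    have "4 * P \<le> \<tau>\<^sup>2 * P" using t4 P by (rule mult_right_mono)
    moreover have "3 * \<tau> * (4 * 10 ^ 7 * \<tau> * rho * \<phi> z) = 120000000 * (\<tau>\<^sup>2 * P)"
      "3 * (6 * 10 ^ 7 * rho * \<phi> z) = 180000000 * P" "3 * \<tau>\<^sup>2 * (3 * 10 ^ 6 * rho * \<phi> z) = 9000000 * (\<tau>\<^sup>2 * P)"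
      "3 * 10 ^ 8 * \<tau>\<^sup>2 * rho * \<phi> z = 300000000 * (\<tau>\<^sup>2 * P)"
      by (simp_all add: P_def power2_eq_square)
    ultimately show ?thesis using P by linarith
  qed
  finally show ?thesis .
qed

end

end

context tilted_field
begin

context
  fixes z :: real
  assumes z: "0 \<le> z" and tau_z: "\<tau> = z + 2"
begin

section \<open>The tilted law and the tail ratio\<close>

lemmas zt = z_le[OF z tau_z]

text \<open>The law of \<open>W - z\<close> under the probability with density \<open>exp (z * W) / \<phi> z\<close>.\<close>
definition "tilted_law = distr (density M (\<lambda>\<omega>. ennreal (exp (z * W \<omega>) / \<phi> z))) borel (\<lambda>\<omega>. W \<omega> - z)"

lemma phi_z_pos: "0 < \<phi> z" using phi_ge_1[OF zt(1)] by simp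

lemma tilted_law_integral:
  assumes g[measurable]: "g \<in> borel_measurable borel"
  shows "integral\<^sup>L tilted_law g = tE z (\<lambda>\<omega>. g (W \<omega> - z)) / \<phi> z"
proof -
  have "integral\<^sup>L tilted_law g = integral\<^sup>L (density M (\<lambda>\<omega>. ennreal (exp (z * W \<omega>) / \<phi> z))) (\<lambda>\<omega>. g (W \<omega> - z))"
    unfolding tilted_law_def by (rule integral_distr) measurable
  also have "\<dots> = expectation (\<lambda>\<omega>. (exp (z * W \<omega>) / \<phi> z) * g (W \<omega> - z))"
    using phi_z_pos by (subst integral_density) auto
  also have "\<dots> = expectation (\<lambda>\<omega>. (g (W \<omega> - z) * exp (z * W \<omega>)) / \<phi> z)"
    by (intro Bochner_Integration.integral_cong refl) simp
  also have "\<dots> = tE z (\<lambda>\<omega>. g (W \<omega> - z)) / \<phi> z" unfolding tE_def by simp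
  finally show ?thesis .
qed

lemma tilted_law_real_distribution: "real_distribution tilted_law"
proof -
  have "(\<integral>\<^sup>+\<omega>. ennreal (exp (z * W \<omega>) / \<phi> z) \<partial>M) = ennreal (expectation (\<lambda>\<omega>. exp (z * W \<omega>) / \<phi> z))"
    by (rule nn_integral_eq_integral) (use exp_tW_integrable[OF zt(1)] phi_z_pos in auto)
  also have "expectation (\<lambda>\<omega>. exp (z * W \<omega>) / \<phi> z) = 1" using phi_z_pos by (simp add: \<phi>_def)
  finally have "prob_space (density M (\<lambda>\<omega>. ennreal (exp (z * W \<omega>) / \<phi> z)))"
    by (intro prob_spaceI) (simp add: emeasure_density)
  then have "prob_space tilted_law" unfolding tilted_law_def by (rule prob_space.prob_space_distr) measurable
  then show ?thesis by (intro real_distribution.intro real_distribution_axioms.intro) (simp_all add: tilted_law_def)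
qed

text \<open>The smoothing width \<alpha> is a multiple of \<open>(1 + v) / a\<close>, the order of the mean of \<open>third\<close>. The factor \<open>10 ^ 9\<close> makes the
coefficient of the kernel integral in \<open>stein_bound\<close> at most \<open>1 / 25\<close>.\<close>
lemma tilted_law_kolmogorov:
  "\<bar>cdf tilted_law x - cdf std_normal_distribution x\<bar> \<le> 2 * 10 ^ 9 * \<tau>\<^sup>2 * rho"
proof -
  define \<alpha> where "\<alpha> = 10 ^ 9 * (1 + v) / a"
  have \<alpha>: "0 < \<alpha>" using a_pos v_nonneg by (simp add: \<alpha>_def)
  have inv: "1 / \<alpha> = a / (10 ^ 9 * (1 + v))" by (simp add: \<alpha>_def)
  have inv_le: "1 / \<alpha> \<le> a / 10 ^ 9"
    unfolding inv using a_pos v_nonneg by (intro divide_left_mono) auto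
  define d where "d = 4 * 10 ^ 8 * \<tau>\<^sup>2 * rho"
  have t2: "\<tau> \<le> \<tau>\<^sup>2" "1 \<le> \<tau>\<^sup>2" using tau_ge_1 self_le_power[of \<tau> 2] by auto
  have d: "0 \<le> d" using rho_bounds(3) by (simp add: d_def)
  have "\<bar>cdf tilted_law x - cdf std_normal_distribution x\<bar> \<le> \<alpha> + 2 * d"
  proof (rule kolmogorov_by_smoothing[OF tilted_law_real_distribution \<alpha> d])
    fix x
    obtain f f' where ff:
      "\<And>w. (f has_real_derivative f' w) (at w)"
      "\<And>w. f' w = w * f w + ramp \<alpha> x w - integral\<^sup>L std_normal_distribution (ramp \<alpha> x)"
      "\<And>w. \<bar>f w\<bar> \<le> 3" "\<And>w. \<bar>f' w\<bar> \<le> 2"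
      by (rule stein_solution[OF ramp_continuous[OF \<alpha>, of x] ramp_bounds]) (rule that)
    define c where "c = integral\<^sup>L std_normal_distribution (ramp \<alpha> x)"
    define q where "q = (\<lambda>w. exp (- (\<bar>w - x\<bar> / \<alpha>)))"
    have qm: "q \<in> borel_measurable borel" unfolding q_def by measurable
    have q: "0 \<le> q w" "q w \<le> 1" for w using \<alpha> by (auto simp: q_def)
    define qq where "qq = tE z (\<lambda>\<omega>. q (W \<omega> - z))"
    have qq0: "0 \<le> qq" unfolding qq_def tE_def using q by (intro integral_nonneg_AE AE_I2) auto
    have "\<bar>tE z (\<lambda>\<omega>. ramp \<alpha> x (W \<omega> - z)) - c * \<phi> z\<bar> \<le> 3 * 10 ^ 8 * \<tau>\<^sup>2 * rho * \<phi> z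
      + 3 / \<alpha> * (13 * 10 ^ 6 * v / a * qq + 6 * 10 ^ 10 * \<tau> * rho / a * \<phi> z)"
      unfolding qq_def
    proof (rule stein_bound[OF z tau_z ff(1) _ ff(3,4) ramp_measurable _ q qm, where \<gamma>="1 / \<alpha>"])
      show "1 / \<alpha> \<le> a / 128" by (rule order_trans[OF inv_le]) (use a_pos in simp)
      show "\<bar>ramp \<alpha> x (v + u) - ramp \<alpha> x v\<bar> \<le> 3 / \<alpha> * (\<bar>u\<bar> * exp (1 / \<alpha> * \<bar>u\<bar>)) * q v" for v u
        unfolding q_def by (rule ramp_oscillation[OF \<alpha>])
    qed (use \<alpha> ff(2) ramp_bounds in \<open>auto simp: c_def\<close>)
    also have "\<dots> \<le> d * \<phi> z + qq / 25"
    proof -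
      have 1: "3 / \<alpha> * (13 * 10 ^ 6 * v / a * qq) \<le> qq / 25"
      proof -
        have "3 / \<alpha> * (13 * 10 ^ 6 * v / a) = 39 * 10 ^ 6 / 10 ^ 9 * (v / (1 + v))"
          using a_pos v_nonneg by (simp add: \<alpha>_def field_simps)
        also have "\<dots> \<le> 39 * 10 ^ 6 / 10 ^ 9 * 1" using v_nonneg by (intro mult_left_mono) auto
        also have "\<dots> \<le> 1 / 25" by simp
        finally have "3 / \<alpha> * (13 * 10 ^ 6 * v / a) * qq \<le> 1 / 25 * qq" using qq0 by (rule mult_right_mono)
        then show ?thesis by (simp add: mult.assoc)
      qed
      have 2: "3 / \<alpha> * (6 * 10 ^ 10 * \<tau> * rho / a * \<phi> z) \<le> 10 ^ 8 * \<tau>\<^sup>2 * rho * \<phi> z"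
      proof -
        define P where "P = rho * \<phi> z"
        have P: "0 \<le> P" using rho_bounds(3) phi_z_pos by (simp add: P_def)
        have "3 / \<alpha> * (6 * 10 ^ 10 * \<tau> * rho / a * \<phi> z) = 1 / \<alpha> * (18 * 10 ^ 10 / a * (\<tau> * P))" by (simp add: P_def)
        also have "\<dots> \<le> a / 10 ^ 9 * (18 * 10 ^ 10 / a * (\<tau> * P))"
          using inv_le a_pos tau_ge_1 P by (intro mult_right_mono) auto
        also have "\<dots> = 180 * (\<tau> * P)" using a_pos by simp
        also have "\<dots> \<le> 10 ^ 8 * (\<tau>\<^sup>2 * P)"
          using t2 P tau_ge_1 by (intro mult_mono mult_right_mono) auto
        finally show ?thesis by (simp add: P_def mult.assoc)
      qed
      have "3 / \<alpha> * (13 * 10 ^ 6 * v / a * qq + 6 * 10 ^ 10 * \<tau> * rho / a * \<phi> z) \<le> qq / 25 + 10 ^ 8 * \<tau>\<^sup>2 * rho * \<phi> z"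
        unfolding distrib_left by (intro add_mono 1 2)
      moreover have "d * \<phi> z = 3 * 10 ^ 8 * \<tau>\<^sup>2 * rho * \<phi> z + 10 ^ 8 * \<tau>\<^sup>2 * rho * \<phi> z" by (simp add: d_def)
      ultimately show ?thesis by linarith
    qed
    finally have fin: "\<bar>tE z (\<lambda>\<omega>. ramp \<alpha> x (W \<omega> - z)) - c * \<phi> z\<bar> \<le> d * \<phi> z + qq / 25" .
    have "integral\<^sup>L tilted_law (ramp \<alpha> x) - c = (tE z (\<lambda>\<omega>. ramp \<alpha> x (W \<omega> - z)) - c * \<phi> z) / \<phi> z"
      using phi_z_pos by (simp add: tilted_law_integral diff_divide_distrib)
    then have "\<bar>integral\<^sup>L tilted_law (ramp \<alpha> x) - c\<bar> = \<bar>tE z (\<lambda>\<omega>. ramp \<alpha> x (W \<omega> - z)) - c * \<phi> z\<bar> / \<phi> z"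
      using phi_z_pos by (simp add: abs_divide)
    also have "\<dots> \<le> (d * \<phi> z + qq / 25) / \<phi> z" using fin phi_z_pos by (intro divide_right_mono) auto
    also have "\<dots> = d + (qq / \<phi> z) / 25" using phi_z_pos by (simp add: add_divide_distrib)
    also have "qq / \<phi> z = (\<integral>v. exp (- (\<bar>v - x\<bar> / \<alpha>)) \<partial>tilted_law)"
      using tilted_law_integral[OF qm] unfolding qq_def by (simp add: q_def)
    finally show "\<bar>integral\<^sup>L tilted_law (ramp \<alpha> x) - integral\<^sup>L std_normal_distribution (ramp \<alpha> x)\<bar>
       \<le> d + (\<integral>v. exp (- (\<bar>v - x\<bar> / \<alpha>)) \<partial>tilted_law) / 25" unfolding c_def .
  qed
  also have "\<alpha> \<le> 10 ^ 9 * rho"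
  proof -
    have "1 * (1 + v) \<le> real \<kappa> * (1 + v)" using kappa_pos v_nonneg by (intro mult_right_mono) auto
    then have "10 ^ 9 * (1 * (1 + v)) / a \<le> 10 ^ 9 * (real \<kappa> * (1 + v)) / a"
      using a_pos by (intro divide_right_mono mult_left_mono) auto
    then show ?thesis by (simp add: \<alpha>_def rho_def)
  qed
  also have "10 ^ 9 * rho + 2 * d \<le> 2 * 10 ^ 9 * \<tau>\<^sup>2 * rho"
  proof -
    have "1 * rho \<le> \<tau>\<^sup>2 * rho" using t2 rho_bounds(3) by (intro mult_right_mono) auto
    then have "10 ^ 9 * (1 * rho) \<le> 12 * 10 ^ 8 * (\<tau>\<^sup>2 * rho)"
      by (rule mult_mono[rotated]) (use rho_bounds(3) in auto)
    then show ?thesis by (simp add: d_def)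
  qed
  finally show ?thesis by simp
qed

text \<open>Undo the tilt: the tail probability is \<open>\<phi> z * exp (- z\<^sup>2)\<close> times the expectation of \<open>exp (- z * v)\<close> over \<open>v > 0\<close> under the
tilted law. With \<open>\<delta> = ln (\<phi> z) - z\<^sup>2 / 2\<close> the relative error splits into \<open>exp \<delta> - 1\<close> and the distance of that
expectation from its normal value, which the lower Mills bound compares with the tail.\<close>
lemma tail_ratio:
  "\<bar>prob {\<omega> \<in> space M. (\<Sum>i\<in>J. X i \<omega>) > z} / upper_tail z - 1\<bar> \<le> 2 * 10 ^ 11 * rho * \<tau> ^ 3"
proof -
  define I where "I = (\<integral>v. exp (- (z * v)) * indicator {0<..} v \<partial>tilted_law)"
  define tail where "tail = upper_tail z"
  have tail: "0 < tail" unfolding tail_def by (rule upper_tail_pos[OF z])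
  have P: "prob {\<omega> \<in> space M. (\<Sum>i\<in>J. X i \<omega>) > z} = \<phi> z * exp (- z\<^sup>2) * I"
  proof -
    have set: "{\<omega> \<in> space M. (\<Sum>i\<in>J. X i \<omega>) > z} = {\<omega> \<in> space M. z < W \<omega>}" by (simp add: W_def)
    have "I = tE z (\<lambda>\<omega>. exp (- (z * (W \<omega> - z))) * indicator {0<..} (W \<omega> - z)) / \<phi> z"
      unfolding I_def by (rule tilted_law_integral) measurable
    then have "\<phi> z * I = tE z (\<lambda>\<omega>. exp (- (z * (W \<omega> - z))) * indicator {0<..} (W \<omega> - z))"
      using phi_z_pos by simp
    also have "\<dots> = expectation (\<lambda>\<omega>. exp (z\<^sup>2) * indicator {\<omega> \<in> space M. z < W \<omega>} \<omega>)"
      unfolding tE_def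
    proof (intro Bochner_Integration.integral_cong refl)
      fix \<omega> assume w: "\<omega> \<in> space M"
      have "exp (- (z * (W \<omega> - z))) * exp (z * W \<omega>) = exp (z\<^sup>2)"
        by (simp add: algebra_simps power2_eq_square flip: exp_add)
      then show "exp (- (z * (W \<omega> - z))) * indicator {0<..} (W \<omega> - z) * exp (z * W \<omega>)
         = exp (z\<^sup>2) * indicator {\<omega> \<in> space M. z < W \<omega>} \<omega>"
        using w by (cases "z < W \<omega>") (auto simp: indicator_def)
    qed
    also have "\<dots> = exp (z\<^sup>2) * prob {\<omega> \<in> space M. z < W \<omega>}" by simp
    finally have "\<phi> z * exp (- z\<^sup>2) * I = exp (- z\<^sup>2) * (exp (z\<^sup>2) * prob {\<omega> \<in> space M. z < W \<omega>})"
      by (simp add: mult_ac)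
    then show ?thesis unfolding set by (simp add: mult.assoc[symmetric] flip: exp_add)
  qed
  define e where "e = 4 * 10 ^ 9 * \<tau>\<^sup>2 * rho"
  have e0: "0 \<le> e" using rho_bounds(3) by (simp add: e_def)
  have close: "\<bar>I - exp (z\<^sup>2 / 2) * tail\<bar> \<le> e"
    using laplace_upper_half_close[OF tilted_law_real_distribution tilted_law_kolmogorov z] unfolding I_def tail_def e_def by simp
  define \<delta> where "\<delta> = ln (\<phi> z) - z\<^sup>2 / 2"
  have phi: "\<phi> z = exp \<delta> * exp (z\<^sup>2 / 2)"
    unfolding \<delta>_def using phi_z_pos by (simp flip: exp_add)
  have \<delta>: "\<bar>\<delta>\<bar> \<le> 5 * 10 ^ 7 * rho * \<tau> ^ 3" "\<bar>\<delta>\<bar> \<le> 1 / 2"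
    unfolding \<delta>_def by (rule ln_phi_close[OF zt(2)])+
  have e2: "exp \<bar>\<delta>\<bar> \<le> 3"
  proof -
    have "exp \<bar>\<delta>\<bar> \<le> exp 1" using \<delta>(2) by simp
    then show ?thesis using Transcendental.exp_le by (rule order_trans)
  qed
  have ed: "exp \<delta> \<le> 3" by (rule order_trans[OF _ e2]) simp
  have A: "\<bar>exp \<delta> - 1\<bar> \<le> 15 * 10 ^ 7 * rho * \<tau> ^ 3"
  proof -
    have "\<bar>exp \<delta> - 1\<bar> \<le> \<bar>\<delta>\<bar> * exp \<bar>\<delta>\<bar>" by (rule abs_exp_minus_one_le)
    also have "\<dots> \<le> (5 * 10 ^ 7 * rho * \<tau> ^ 3) * 3" by (rule mult_mono[OF \<delta>(1) e2]) (use rho_bounds(3) tau_ge_1 in auto)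
    finally show ?thesis by simp
  qed
  have split: "\<phi> z * exp (- z\<^sup>2) * I / tail - 1 = (exp \<delta> - 1) + exp \<delta> * exp (- z\<^sup>2 / 2) * (I - exp (z\<^sup>2 / 2) * tail) / tail"
  proof -
    have "exp (- z\<^sup>2 / 2) * exp (z\<^sup>2 / 2) = 1" by (simp flip: exp_add)
    then have "exp \<delta> * exp (- z\<^sup>2 / 2) * (I - exp (z\<^sup>2 / 2) * tail) / tail = exp \<delta> * exp (- z\<^sup>2 / 2) * I / tail - exp \<delta>"
      using tail by (simp add: right_diff_distrib diff_divide_distrib mult.assoc)
    moreover have "\<phi> z * exp (- z\<^sup>2) = exp \<delta> * exp (- z\<^sup>2 / 2)" unfolding phi by (simp flip: exp_add)
    ultimately show ?thesis by simp
  qed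
  have B: "\<bar>exp \<delta> * exp (- z\<^sup>2 / 2) * (I - exp (z\<^sup>2 / 2) * tail) / tail\<bar> \<le> 18 * 10 ^ 10 * rho * \<tau> ^ 3"
  proof -
    have "\<bar>exp \<delta> * exp (- z\<^sup>2 / 2) * (I - exp (z\<^sup>2 / 2) * tail) / tail\<bar> = exp \<delta> * exp (- z\<^sup>2 / 2) * \<bar>I - exp (z\<^sup>2 / 2) * tail\<bar> / tail"
      using tail by (simp add: abs_mult abs_divide)
    also have "\<dots> \<le> 3 * (15 * (1 + z) * tail) * e / tail"
    proof (intro divide_right_mono mult_mono close ed)
      show "exp (- z\<^sup>2 / 2) \<le> 15 * (1 + z) * tail" unfolding tail_def by (rule mills_lower[OF z])
    qed (use tail z e0 in auto)
    also have "\<dots> = 45 * ((1 + z) * e)" using tail by simp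
    also have "\<dots> \<le> 45 * (\<tau> * e)" using e0 by (intro mult_left_mono mult_right_mono) (auto simp: tau_z)
    also have "\<dots> = 18 * 10 ^ 10 * rho * \<tau> ^ 3" by (simp add: e_def power2_eq_square power3_eq_cube)
    finally show ?thesis .
  qed
  have "\<bar>\<phi> z * exp (- z\<^sup>2) * I / tail - 1\<bar> \<le> 15 * 10 ^ 7 * rho * \<tau> ^ 3 + 18 * 10 ^ 10 * rho * \<tau> ^ 3"
    unfolding split using A B by (intro order_trans[OF abs_triangle_ineq] add_mono)
  also have "\<dots> \<le> 2 * 10 ^ 11 * rho * \<tau> ^ 3"
    using rho_bounds(3) tau_ge_1 mult_nonneg_nonneg[of rho "\<tau> ^ 3"] by simp
  finally show ?thesis unfolding P tail_def .
qed

end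

end

section \<open>From the range of the theorem to the smallness condition\<close>

lemma indep_subfamilies_mono:
  assumes "prob_space M" and ind: "indep_subfamilies M X S T" and sub: "S' \<subseteq> S" "T' \<subseteq> T"
  shows "indep_subfamilies M X S' T'"
proof -
  interpret prob_space M by fact
  have "indep_var (PiM S' (\<lambda>_. borel)) ((\<lambda>y. restrict y S') \<circ> (\<lambda>\<omega>. \<lambda>i\<in>S. X i \<omega>))
      (PiM T' (\<lambda>_. borel)) ((\<lambda>y. restrict y T') \<circ> (\<lambda>\<omega>. \<lambda>i\<in>T. X i \<omega>))"
    using ind[unfolded indep_subfamilies_def]
    by (rule indep_var_compose) (use sub in \<open>auto intro: measurable_restrict_subset\<close>)
  moreover have "(\<lambda>y. restrict y S') \<circ> (\<lambda>\<omega>. \<lambda>i\<in>S. X i \<omega>) = (\<lambda>\<omega>. \<lambda>i\<in>S'. X i \<omega>)"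
    "(\<lambda>y. restrict y T') \<circ> (\<lambda>\<omega>. \<lambda>i\<in>T. X i \<omega>) = (\<lambda>\<omega>. \<lambda>i\<in>T'. X i \<omega>)"
    using sub by (auto simp: fun_eq_iff restrict_def)
  ultimately show ?thesis by (simp add: indep_subfamilies_def)
qed

text \<open>A centred variable that is independent of itself has \<open>E (X\<^sup>2) = (E X)\<^sup>2 = 0\<close>.\<close>
lemma self_independent_imp_AE_zero:
  assumes "prob_space M" and ind: "indep_subfamilies M X {i} T" and iT: "i \<in> T"
    and int: "integrable M (X i)" "integrable M (\<lambda>\<omega>. (X i \<omega>)\<^sup>2)" and mean: "prob_space.expectation M (X i) = 0"
  shows "AE \<omega> in M. X i \<omega> = 0"
proof -
  interpret prob_space M by fact
  have "indep_var borel ((\<lambda>y. y i) \<circ> (\<lambda>\<omega>. \<lambda>j\<in>{i}. X j \<omega>)) borel ((\<lambda>y. y i) \<circ> (\<lambda>\<omega>. \<lambda>j\<in>T. X j \<omega>))"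
    using ind[unfolded indep_subfamilies_def]
    by (rule indep_var_compose) (use iT in \<open>auto intro: measurable_component_singleton\<close>)
  moreover have "(\<lambda>y. y i) \<circ> (\<lambda>\<omega>. \<lambda>j\<in>{i}. X j \<omega>) = X i" "(\<lambda>y. y i) \<circ> (\<lambda>\<omega>. \<lambda>j\<in>T. X j \<omega>) = X i"
    using iT by (auto simp: fun_eq_iff)
  ultimately have "indep_var borel (X i) borel (X i)" by simp
  then have "expectation (\<lambda>\<omega>. X i \<omega> * X i \<omega>) = expectation (X i) * expectation (X i)"
    by (rule indep_var_lebesgue_integral) (use int in auto)
  then have "expectation (\<lambda>\<omega>. (X i \<omega>)\<^sup>2) = 0" using mean by (simp add: power2_eq_square)
  then have "AE \<omega> in M. (X i \<omega>)\<^sup>2 = 0"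
    using integral_nonneg_eq_0_iff_AE[OF int(2)] by simp
  then show ?thesis by simp
qed

lemma theta_sq: "0 < a \<Longrightarrow> 0 \<le> b \<Longrightarrow> (theta n a b)\<^sup>2 = b * real n / a\<^sup>2"
  by (simp add: theta_def power_divide power_mult_distrib powr_half_sqrt)

lemma theta_nonneg: "0 < a \<Longrightarrow> 0 \<le> theta n a b"
  by (simp add: theta_def)

text \<open>The upper bound for z, cubed and freed of real powers.\<close>
lemma range_cubed:
  fixes a k \<theta> c z :: real
  assumes a: "0 < a" and k: "0 < k" and \<theta>: "0 \<le> \<theta>" and c: "0 < c" and z: "0 \<le> z"
    and le: "z \<le> c * a powr (1/3) * min 1 (k powr (-1/3) * (1 + \<theta>) powr (-2/3))"
  shows "z ^ 3 * (k * (1 + \<theta>)\<^sup>2) \<le> c ^ 3 * a"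
proof -
  have cube: "(x powr p) ^ 3 = x powr (3 * p)" if "0 < x" for x p :: real
    using that by (simp add: powr_power mult.commute)
  have "z \<le> c * a powr (1/3) * (k powr (-1/3) * (1 + \<theta>) powr (-2/3))"
    by (rule order_trans[OF le]) (use c in \<open>auto intro!: mult_left_mono\<close>)
  then have "z ^ 3 \<le> (c * a powr (1/3) * (k powr (-1/3) * (1 + \<theta>) powr (-2/3))) ^ 3"
    using z by (rule power_mono)
  also have "\<dots> = c ^ 3 * a * (k powr (-1) * (1 + \<theta>) powr (-2))"
    using a k \<theta> by (simp add: power_mult_distrib cube)
  also have "k powr (-1) = 1 / k" using k by (simp add: powr_minus_divide)
  also have "(1 + \<theta>) powr (-2) = 1 / (1 + \<theta>)\<^sup>2" using \<theta> by (simp add: powr_minus_divide)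
  finally have "z ^ 3 * (k * (1 + \<theta>)\<^sup>2) \<le> c ^ 3 * a * (1 / k * (1 / (1 + \<theta>)\<^sup>2)) * (k * (1 + \<theta>)\<^sup>2)"
    using k by (intro mult_right_mono) auto
  also have "\<dots> = c ^ 3 * a" using k \<theta> by (simp add: field_simps)
  finally show ?thesis .
qed

lemma cube_shift_le: "0 \<le> z \<Longrightarrow> (z + 2) ^ 3 \<le> 27 * (1 + (z::real) ^ 3)"
proof (cases "z \<le> 1")
  case True
  assume z: "0 \<le> z"
  have "(z + 2) ^ 3 \<le> 3 ^ 3" by (intro power_mono) (use True z in auto)
  also have "\<dots> = 27 * 1" by simp
  also have "\<dots> \<le> 27 * (1 + z ^ 3)" by (rule mult_left_mono) (use z in auto)
  finally show ?thesis .
next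
  case False
  have "(z + 2) ^ 3 \<le> (3 * z) ^ 3" by (intro power_mono) (use False in auto)
  then show ?thesis by (simp add: power_mult_distrib)
qed

context dependent_field
begin

text \<open>If the smallness condition holds for \<open>\<tau> = z + 2\<close>, the estimate of the tail ratio applies. Otherwise the bound for z
forces \<open>z < 1\<close> while the error rate is bounded below; then the tail \<open>1 - \<Phi> z\<close> is bounded below and
the estimate is trivial for a large constant. Monotonicity in n and k permits the removal of variables
afterwards.\<close>
lemma moderate_deviation:
  assumes z: "0 \<le> z"
    and range: "z \<le> 1 / 10 ^ 4 * a powr (1/3) * min 1 (real k powr (-1/3) * (1 + theta n a b) powr (-2/3))"
    and k: "\<kappa> \<le> k" and n: "card J \<le> n"
  shows "\<bar>prob {\<omega> \<in> space M. (\<Sum>i\<in>J. X i \<omega>) > z} / upper_tail z - 1\<bar> \<le> 2 * 10 ^ 13 * delta n k a b * (1 + z ^ 3)"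
proof -
  have ap: "0 < a" using a_ge_1 by simp
  have k1: "1 \<le> real k" using kappa_pos k by simp
  define \<theta> where "\<theta> = theta n a b"
  have \<theta>0: "0 \<le> \<theta>" unfolding \<theta>_def by (rule theta_nonneg[OF ap])
  have \<theta>2: "\<theta>\<^sup>2 = b * real n / a\<^sup>2" unfolding \<theta>_def by (rule theta_sq) (use ap b_ge_1 in auto)
  have v_le: "v \<le> \<theta>\<^sup>2" unfolding \<theta>2 v_def using n b_ge_1 by (intro divide_right_mono mult_left_mono) auto
  have v0: "0 \<le> v" using b_ge_1 by (simp add: v_def)
  define r where "r = real k * (1 + \<theta>\<^sup>2) / a"
  have rho_r: "rho \<le> r"
    unfolding rho_def r_def using k v_le v0 ap by (intro divide_right_mono mult_mono) auto
  have rho0: "0 \<le> rho" unfolding rho_def using ap v0 by simp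
  have r_delta: "r \<le> 2 * delta n k a b"
  proof -
    define y where "y = \<theta> ^ 6"
    have y0: "0 \<le> y" using \<theta>0 by (simp add: y_def)
    have "\<theta>\<^sup>2 \<le> 1 + y"
    proof (cases "\<theta> \<le> 1")
      case True
      then have "\<theta>\<^sup>2 \<le> 1" using \<theta>0 by (simp add: power_le_one)
      then show ?thesis using y0 by linarith
    next
      case False
      then have "\<theta>\<^sup>2 \<le> y" unfolding y_def by (intro power_increasing) auto
      then show ?thesis by linarith
    qed
    then have "1 + \<theta>\<^sup>2 \<le> (1 + y) + (1 + y)" by (intro add_mono) (use y0 in auto)
    then have "1 + \<theta>\<^sup>2 \<le> 2 * (1 + y)" by simp
    then have "1 + \<theta>\<^sup>2 \<le> 2 * (1 + \<theta> ^ 6)" by (simp only: y_def)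
    moreover have "real k \<le> (real k)\<^sup>2" using k1 by (simp add: self_le_power)
    ultimately have "real k * (1 + \<theta>\<^sup>2) \<le> (real k)\<^sup>2 * (2 * (1 + \<theta> ^ 6))" by (intro mult_mono) auto
    then have "r \<le> (real k)\<^sup>2 * (2 * (1 + \<theta> ^ 6)) / a" unfolding r_def using ap by (intro divide_right_mono) auto
    also have "\<dots> = 2 * ((real k)\<^sup>2 / a * (1 + \<theta> ^ 6))"
      by (simp only: times_divide_eq_left times_divide_eq_right mult_ac)
    finally show ?thesis by (simp only: delta_def \<theta>_def)
  qed
  define \<tau> where "\<tau> = z + 2"
  have \<tau>3: "\<tau> ^ 3 \<le> 27 * (1 + z ^ 3)" unfolding \<tau>_def by (rule cube_shift_le[OF z])
  have z3: "0 \<le> z ^ 3" using z by simp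
  have r0: "0 \<le> r" using rho_r rho0 by simp
  show ?thesis
  proof (cases "rho * \<tau> ^ 3 \<le> 1 / 10 ^ 8")
    case True
    interpret tilted_field M J X A B a b \<kappa> \<tau>
      by unfold_locales (use True z in \<open>auto simp: \<tau>_def\<close>)
    have "\<bar>prob {\<omega> \<in> space M. (\<Sum>i\<in>J. X i \<omega>) > z} / upper_tail z - 1\<bar> \<le> 2 * 10 ^ 11 * rho * \<tau> ^ 3"
      by (rule tail_ratio[OF z \<tau>_def])
    also have "\<dots> = 2 * 10 ^ 11 * (rho * \<tau> ^ 3)" by simp
    also have "\<dots> \<le> 2 * 10 ^ 11 * ((2 * delta n k a b) * (27 * (1 + z ^ 3)))"
      using rho0 rho_r r_delta \<tau>3 r0 z by (intro mult_left_mono mult_mono) (auto simp: \<tau>_def)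
    also have "\<dots> = 108 * 10 ^ 11 * (delta n k a b * (1 + z ^ 3))" by simp
    also have "\<dots> \<le> 2 * 10 ^ 13 * (delta n k a b * (1 + z ^ 3))"
      using r0 r_delta z3 by (intro mult_right_mono) auto
    finally show ?thesis by simp
  next
    case False
    have rz: "z ^ 3 * r \<le> 1 / 10 ^ 12"
    proof -
      have "1 + \<theta>\<^sup>2 \<le> (1 + \<theta>)\<^sup>2" using \<theta>0 by (simp add: power2_sum)
      then have "z ^ 3 * (real k * (1 + \<theta>\<^sup>2)) \<le> z ^ 3 * (real k * (1 + \<theta>)\<^sup>2)"
        using z3 by (intro mult_left_mono) auto
      also have "\<dots> \<le> (1 / 10 ^ 4) ^ 3 * a"
        by (rule range_cubed[OF ap _ \<theta>0 _ z range[folded \<theta>_def]]) (use k1 in auto)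
      finally have "z ^ 3 * (real k * (1 + \<theta>\<^sup>2)) / a \<le> (1 / 10 ^ 4) ^ 3" using ap by (simp add: field_simps)
      then show ?thesis by (simp add: r_def power_divide)
    qed
    have big: "1 / 10 ^ 8 < r * \<tau> ^ 3"
    proof -
      have "rho * \<tau> ^ 3 \<le> r * \<tau> ^ 3" using rho_r z by (intro mult_right_mono) (auto simp: \<tau>_def)
      then show ?thesis using False by linarith
    qed
    have "r * \<tau> ^ 3 \<le> 27 * r + 27 * (z ^ 3 * r)"
      using mult_left_mono[OF \<tau>3 r0] by (simp add: algebra_simps)
    then have r_big: "1 / 10 ^ 8 - 27 / 10 ^ 12 < 27 * r" using big rz by linarith
    have z1: "z < 1"
    proof (rule ccontr)
      assume "\<not> z < 1"
      then have "1 \<le> z ^ 3" by (intro one_le_power) auto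
      then have "r \<le> z ^ 3 * r" using r0 mult_right_mono[of 1 "z ^ 3" r] by simp
      then show False using rz r_big by simp
    qed
    have tail: "1 / 60 \<le> upper_tail z"
    proof -
      have "z\<^sup>2 \<le> 1" using z z1 by (simp add: power_le_one)
      then have "1 / 2 \<le> 1 + (- z\<^sup>2 / 2)" by simp
      also have "\<dots> \<le> exp (- z\<^sup>2 / 2)" by (rule exp_ge_add_one_self)
      also have "\<dots> \<le> 15 * (1 + z) * upper_tail z" by (rule mills_lower[OF z])
      also have "\<dots> \<le> 30 * upper_tail z" using z1 upper_tail_pos[OF z] by (intro mult_right_mono) auto
      finally show ?thesis by simp
    qed
    define p where "p = prob {\<omega> \<in> space M. (\<Sum>i\<in>J. X i \<omega>) > z}"
    have p: "0 \<le> p" "p \<le> 1" by (auto simp: p_def)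
    have "p / upper_tail z \<le> 60" using tail p by (simp add: field_simps)
    moreover have "0 \<le> p / upper_tail z" using tail p by simp
    ultimately have "\<bar>p / upper_tail z - 1\<bar> \<le> 60" by linarith
    also have "\<dots> \<le> 2 * 10 ^ 13 * (delta n k a b * 1)" using r_big r_delta by simp
    also have "\<dots> \<le> 2 * 10 ^ 13 * (delta n k a b * (1 + z ^ 3))"
      using r_delta r0 z3 by (intro mult_left_mono) auto
    finally show ?thesis by (simp add: p_def)
  qed
qed

end

text \<open>Discard the variables that vanish almost surely. If \<open>i \<notin> A i\<close>, then (LD1) makes \<open>X i\<close> independent of itself, so every
remaining index lies in its own neighbourhood.\<close>
lemma moderate_deviation_bound_holds:
  "moderate_deviation_bound TYPE('a) TYPE('i) (2 * 10 ^ 13) (1 / 10 ^ 4)"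
  unfolding moderate_deviation_bound_def
proof (intro allI impI)
  fix M :: "'a measure" and J :: "'i set" and X A B and a b z :: real
  assume ps: "prob_space M" and fin: "finite J"
    and X: "\<forall>i\<in>J. X i \<in> borel_measurable M \<and> integrable M (X i) \<and> prob_space.expectation M (X i) = 0 \<and> integrable M (\<lambda>\<omega>. (X i \<omega>)\<^sup>2)"
    and var: "prob_space.variance M (\<lambda>\<omega>. \<Sum>i\<in>J. X i \<omega>) = 1"
    and L1: "LD1 M J X A" and L2: "LD2 M J X A B" and a: "a \<ge> 1" and b: "b \<ge> 1"
    and ex: "\<forall>i\<in>J. integrable M (\<lambda>\<omega>. exp (a * (\<Sum>j\<in>B i. \<bar>X j \<omega>\<bar>))) \<and>
             prob_space.expectation M (\<lambda>\<omega>. exp (a * (\<Sum>j\<in>B i. \<bar>X j \<omega>\<bar>))) \<le> b"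
    and z: "0 \<le> z"
    and range: "z \<le> 1 / 10 ^ 4 * a powr (1/3) * min 1 (real (kappa J B) powr (-1/3) * (1 + theta (card J) a b) powr (-2/3))"
  interpret prob_space M by fact
  define J' where "J' = {i \<in> J. \<not> (AE \<omega> in M. X i \<omega> = 0)}"
  have sub: "J' \<subseteq> J" by (auto simp: J'_def)
  have finB: "finite (B i)" if "i \<in> J" for i using L2 that fin by (auto simp: LD2_def intro: finite_subset)
  have "AE \<omega> in M. \<forall>i\<in>J - J'. X i \<omega> = 0"
    by (rule AE_finite_allI) (use fin in \<open>auto simp: J'_def\<close>)
  then have sum_eq: "AE \<omega> in M. (\<Sum>i\<in>J'. X i \<omega>) = (\<Sum>i\<in>J. X i \<omega>)"
  proof eventually_elim
    case (elim \<omega>)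
    show ?case by (rule sum.mono_neutral_left[OF fin sub elim])
  qed
  have m: "(\<lambda>\<omega>. \<Sum>i\<in>J. X i \<omega>) \<in> borel_measurable M" "(\<lambda>\<omega>. \<Sum>i\<in>J'. X i \<omega>) \<in> borel_measurable M"
    using X sub by (auto intro!: borel_measurable_sum)
  have mean_eq: "expectation (\<lambda>\<omega>. \<Sum>i\<in>J'. X i \<omega>) = expectation (\<lambda>\<omega>. \<Sum>i\<in>J. X i \<omega>)"
    by (rule integral_cong_AE[OF m(2) m(1) sum_eq])
  have le_sum: "(\<Sum>j\<in>B i \<inter> J'. \<bar>X j \<omega>\<bar>) \<le> (\<Sum>j\<in>B i. \<bar>X j \<omega>\<bar>)" if "i \<in> J" for i \<omega>
    by (rule sum_mono2) (use finB[OF that] in auto)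
  interpret dependent_field M J' X "\<lambda>i. A i \<inter> J'" "\<lambda>i. B i \<inter> J'" a b "kappa J B"
  proof unfold_locales
    show "finite J'" using sub fin by (rule finite_subset)
    fix i assume i': "i \<in> J'"
    then have i: "i \<in> J" using sub by auto
    show "X i \<in> borel_measurable M" "expectation (X i) = 0" using X i by auto
    have "i \<in> A i"
    proof (rule ccontr)
      assume "i \<notin> A i"
      then have "AE \<omega> in M. X i \<omega> = 0"
        using L1 i X by (intro self_independent_imp_AE_zero[OF ps, of X i "J - A i"]) (auto simp: LD1_def)
      then show False using i' by (simp add: J'_def)
    qed
    then show "i \<in> A i \<inter> J'" using i' by simp
    have e1: "exp (a * (\<Sum>j\<in>B i \<inter> J'. \<bar>X j \<omega>\<bar>)) \<le> exp (a * (\<Sum>j\<in>B i. \<bar>X j \<omega>\<bar>))" for \<omega>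
      using le_sum[OF i] a by (simp add: mult_left_mono)
    show int: "integrable M (\<lambda>\<omega>. exp (a * (\<Sum>j\<in>B i \<inter> J'. \<bar>X j \<omega>\<bar>)))"
    proof (rule Bochner_Integration.integrable_bound[of M "\<lambda>\<omega>. exp (a * (\<Sum>j\<in>B i. \<bar>X j \<omega>\<bar>))"])
      have "(\<lambda>\<omega>. \<Sum>j\<in>B i \<inter> J'. \<bar>X j \<omega>\<bar>) \<in> borel_measurable M"
        using X sub by (intro borel_measurable_sum borel_measurable_abs) auto
      then show "(\<lambda>\<omega>. exp (a * (\<Sum>j\<in>B i \<inter> J'. \<bar>X j \<omega>\<bar>))) \<in> borel_measurable M" by measurable
    qed (use ex i e1 in auto)
    have "expectation (\<lambda>\<omega>. exp (a * (\<Sum>j\<in>B i \<inter> J'. \<bar>X j \<omega>\<bar>))) \<le> expectation (\<lambda>\<omega>. exp (a * (\<Sum>j\<in>B i. \<bar>X j \<omega>\<bar>)))"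
      by (intro integral_mono int e1) (use ex i in auto)
    then show "expectation (\<lambda>\<omega>. exp (a * (\<Sum>j\<in>B i \<inter> J'. \<bar>X j \<omega>\<bar>))) \<le> b" using ex i by force
    have "card (nbhd J' (\<lambda>i. B i \<inter> J') i) \<le> card (nbhd J B i)"
      by (rule card_mono) (use fin sub in \<open>auto simp: nbhd_def\<close>)
    also have "\<dots> \<le> kappa J B" unfolding kappa_def by (rule Max_ge) (use fin i in auto)
    finally show "card (nbhd J' (\<lambda>i. B i \<inter> J') i) \<le> kappa J B" .
  next
    show "LD1 M J' X (\<lambda>i. A i \<inter> J')"
      unfolding LD1_def
    proof (intro ballI conjI)
      fix i assume "i \<in> J'"
      then have "indep_subfamilies M X {i} (J - A i)" using L1 sub by (auto simp: LD1_def)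
      then show "indep_subfamilies M X {i} (J' - A i \<inter> J')"
        by (rule indep_subfamilies_mono[OF ps]) (use sub in auto)
    qed auto
    show "LD2 M J' X (\<lambda>i. A i \<inter> J') (\<lambda>i. B i \<inter> J')"
      unfolding LD2_def
    proof (intro ballI conjI)
      fix i assume i: "i \<in> J'"
      then have "indep_subfamilies M X (A i) (J - B i)" using L2 sub by (auto simp: LD2_def)
      then show "indep_subfamilies M X (A i \<inter> J') (J' - B i \<inter> J')"
        by (rule indep_subfamilies_mono[OF ps]) (use sub in auto)
      show "A i \<inter> J' \<subseteq> B i \<inter> J'" using L2 sub i by (auto simp: LD2_def)
    qed auto
    have "variance (\<lambda>\<omega>. \<Sum>i\<in>J'. X i \<omega>) = variance (\<lambda>\<omega>. \<Sum>i\<in>J. X i \<omega>)"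
      unfolding mean_eq
    proof (rule integral_cong_AE)
      show "AE \<omega> in M. ((\<Sum>i\<in>J'. X i \<omega>) - expectation (\<lambda>\<omega>. \<Sum>i\<in>J. X i \<omega>))\<^sup>2 = ((\<Sum>i\<in>J. X i \<omega>) - expectation (\<lambda>\<omega>. \<Sum>i\<in>J. X i \<omega>))\<^sup>2"
        using sum_eq by eventually_elim simp
    qed (use m in measurable)
    then show "variance (\<lambda>\<omega>. \<Sum>i\<in>J'. X i \<omega>) = 1" using var by simp
  qed (use a b in auto)
  have "\<bar>prob {\<omega> \<in> space M. (\<Sum>i\<in>J'. X i \<omega>) > z} / upper_tail z - 1\<bar> \<le> 2 * 10 ^ 13 * delta (card J) (kappa J B) a b * (1 + z ^ 3)"
    by (rule moderate_deviation[OF z range order_refl card_mono[OF fin sub]])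
  moreover have "prob {\<omega> \<in> space M. (\<Sum>i\<in>J'. X i \<omega>) > z} = prob {\<omega> \<in> space M. (\<Sum>i\<in>J. X i \<omega>) > z}"
  proof (rule finite_measure_eq_AE)
    show "AE \<omega> in M. (\<omega> \<in> {\<omega> \<in> space M. (\<Sum>i\<in>J'. X i \<omega>) > z}) = (\<omega> \<in> {\<omega> \<in> space M. (\<Sum>i\<in>J. X i \<omega>) > z})"
      using sum_eq by eventually_elim simp
  qed (use m in measurable)
  ultimately show "\<bar>measure M {\<omega> \<in> space M. (\<Sum>i\<in>J. X i \<omega>) > z} / (1 - \<Phi> z) - 1\<bar>
        \<le> 2 * 10 ^ 13 * delta (card J) (kappa J B) a b * (1 + z ^ 3)"
    by (simp add: upper_tail_eq_cdf)
qed

section \<open>Transfer to the canonical space of real sequences\<close>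

context
  fixes M :: "'a measure" and J :: "'i set" and X :: "'i \<Rightarrow> 'a \<Rightarrow> real" and A B :: "'i \<Rightarrow> 'i set"
    and n :: nat and h :: "nat \<Rightarrow> 'i"
  assumes ps: "prob_space M" and h: "bij_betw h {..<n} J"
    and X: "\<forall>i\<in>J. X i \<in> borel_measurable M"
begin

definition "joint \<omega> = (\<lambda>k\<in>{..<n}. X (h k) \<omega>)"
definition "joint_law = distr M (PiM {..<n} (\<lambda>_. borel)) joint"
text \<open>The neighbourhood system Q, carried over to the index set \<open>{..<n}\<close> along the enumeration h.\<close>
definition "pull Q k = {l \<in> {..<n}. h l \<in> Q (h k)}"

lemma h_J: "k < n \<Longrightarrow> h k \<in> J" using h by (auto simp: bij_betw_def)

lemma inj_h: "S \<subseteq> {..<n} \<Longrightarrow> inj_on h S" using h by (auto simp: bij_betw_def intro: inj_on_subset)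

lemma joint_meas[measurable]: "joint \<in> measurable M (PiM {..<n} (\<lambda>_. borel))"
  unfolding joint_def by (intro measurable_restrict X[rule_format] h_J) auto

lemma joint_apply: "k < n \<Longrightarrow> joint \<omega> k = X (h k) \<omega>" by (simp add: joint_def)

lemma joint_law_prob: "prob_space joint_law"
  unfolding joint_law_def by (rule prob_space.prob_space_distr[OF ps joint_meas])

lemma coord_meas: "k < n \<Longrightarrow> (\<lambda>x. x k) \<in> borel_measurable (PiM {..<n} (\<lambda>_. borel :: real measure))"
  by (rule measurable_component_singleton) auto

lemma joint_integral:
  fixes g :: "(nat \<Rightarrow> real) \<Rightarrow> real"
  assumes "g \<in> borel_measurable (PiM {..<n} (\<lambda>_. borel))"
  shows "integral\<^sup>L joint_law g = (\<integral>\<omega>. g (joint \<omega>) \<partial>M)"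
    and "integrable joint_law g \<longleftrightarrow> integrable M (\<lambda>\<omega>. g (joint \<omega>))"
  unfolding joint_law_def
  by (rule integral_distr[OF joint_meas assms], rule integrable_distr_eq[OF joint_meas assms])

lemma image_pull: "k < n \<Longrightarrow> Q (h k) \<subseteq> J \<Longrightarrow> h ` pull Q k = Q (h k)"
  using h by (fastforce simp: pull_def bij_betw_def)

lemma image_pull_compl: "k < n \<Longrightarrow> Q (h k) \<subseteq> J \<Longrightarrow> h ` ({..<n} - pull Q k) = J - Q (h k)"
  using h by (fastforce simp: pull_def bij_betw_def)

lemma pull_sub: "pull Q k \<subseteq> {..<n}" by (auto simp: pull_def)

text \<open>Independence is an identity between joint and product laws, and the laws on both sides are the same for the field and
for the coordinates under \<open>joint_law\<close>.\<close>
lemma indep_transfer: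
  assumes S: "S \<subseteq> {..<n}" and T: "T \<subseteq> {..<n}"
    and ind: "indep_subfamilies M X (h ` S) (h ` T)"
  shows "indep_subfamilies joint_law (\<lambda>k x. x k) S T"
proof -
  interpret P: prob_space M by (rule ps)
  interpret R: prob_space joint_law by (rule joint_law_prob)
  define rs where "rs U = (\<lambda>y::'i \<Rightarrow> real. \<lambda>k\<in>U. y (h k))" for U :: "nat set"
  define p where "p U = (\<lambda>x::nat \<Rightarrow> real. \<lambda>k\<in>U. x k)" for U :: "nat set"
  have rs: "rs U \<in> measurable (PiM (h ` U) (\<lambda>_. borel)) (PiM U (\<lambda>_. borel))" for U
    unfolding rs_def by (intro measurable_restrict measurable_component_singleton) auto
  have comp: "rs U \<circ> (\<lambda>\<omega>. \<lambda>i\<in>h ` U. X i \<omega>) = p U \<circ> joint" if "U \<subseteq> {..<n}" for U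
    using that by (auto simp: rs_def p_def joint_def fun_eq_iff restrict_def)
  have pm: "p U \<in> measurable joint_law (PiM U (\<lambda>_. borel))" "p U \<in> measurable (PiM {..<n} (\<lambda>_. borel)) (PiM U (\<lambda>_. borel))"
    if "U \<subseteq> {..<n}" for U
    unfolding joint_law_def p_def using measurable_restrict_subset[OF that, of "\<lambda>_. borel :: real measure"]
    by (simp_all add: restrict_def)
  have "P.indep_var (PiM S (\<lambda>_. borel)) (rs S \<circ> (\<lambda>\<omega>. \<lambda>i\<in>h ` S. X i \<omega>)) (PiM T (\<lambda>_. borel)) (rs T \<circ> (\<lambda>\<omega>. \<lambda>i\<in>h ` T. X i \<omega>))"
    using ind[unfolded indep_subfamilies_def] rs rs by (rule P.indep_var_compose)
  then have "P.indep_var (PiM S (\<lambda>_. borel)) (p S \<circ> joint) (PiM T (\<lambda>_. borel)) (p T \<circ> joint)"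
    by (simp only: comp[OF S] comp[OF T])
  then have eq: "distr M (PiM S (\<lambda>_. borel)) (p S \<circ> joint) \<Otimes>\<^sub>M distr M (PiM T (\<lambda>_. borel)) (p T \<circ> joint)
     = distr M (PiM S (\<lambda>_. borel) \<Otimes>\<^sub>M PiM T (\<lambda>_. borel)) (\<lambda>\<omega>. ((p S \<circ> joint) \<omega>, (p T \<circ> joint) \<omega>))"
    by (simp only: P.indep_var_distribution_eq)
  have "R.indep_var (PiM S (\<lambda>_. borel)) (p S) (PiM T (\<lambda>_. borel)) (p T)"
    unfolding R.indep_var_distribution_eq
  proof (intro conjI pm S T)
    have 1: "distr joint_law (PiM U (\<lambda>_. borel)) (p U) = distr M (PiM U (\<lambda>_. borel)) (p U \<circ> joint)" if "U \<subseteq> {..<n}" for U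
      unfolding joint_law_def by (rule distr_distr[OF pm(2)[OF that] joint_meas])
    have pair: "(\<lambda>x. (p S x, p T x)) \<in> measurable (PiM {..<n} (\<lambda>_. borel)) (PiM S (\<lambda>_. borel) \<Otimes>\<^sub>M PiM T (\<lambda>_. borel))"
      by (rule measurable_Pair[OF pm(2)[OF S] pm(2)[OF T]])
    have 2: "distr joint_law (PiM S (\<lambda>_. borel) \<Otimes>\<^sub>M PiM T (\<lambda>_. borel)) (\<lambda>x. (p S x, p T x))
       = distr M (PiM S (\<lambda>_. borel) \<Otimes>\<^sub>M PiM T (\<lambda>_. borel)) ((\<lambda>x. (p S x, p T x)) \<circ> joint)"
      unfolding joint_law_def by (rule distr_distr[OF pair joint_meas])
    show "distr joint_law (PiM S (\<lambda>_. borel)) (p S) \<Otimes>\<^sub>M distr joint_law (PiM T (\<lambda>_. borel)) (p T)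
       = distr joint_law (PiM S (\<lambda>_. borel) \<Otimes>\<^sub>M PiM T (\<lambda>_. borel)) (\<lambda>x. (p S x, p T x))"
      unfolding 1[OF S] 1[OF T] 2 eq by (simp add: comp_def)
  qed
  then show ?thesis unfolding indep_subfamilies_def p_def .
qed

lemma kappa_transfer:
  assumes B: "\<And>i. i \<in> J \<Longrightarrow> B i \<subseteq> J"
  shows "kappa {..<n} (pull B) = kappa J B"
proof -
  have "card (nbhd {..<n} (pull B) k) = card (nbhd J B (h k))" if k: "k < n" for k
  proof -
    have nb: "nbhd {..<n} (pull B) k \<subseteq> {..<n}" by (auto simp: nbhd_def)
    have meet: "pull B k \<inter> pull B l \<noteq> {} \<longleftrightarrow> B (h k) \<inter> B (h l) \<noteq> {}" if l: "l < n" for l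
    proof -
      have "h ` (pull B k \<inter> pull B l) = h ` pull B k \<inter> h ` pull B l"
        by (rule inj_on_image_Int[OF inj_h[of "{..<n}"]]) (auto simp: pull_sub)
      also have "\<dots> = B (h k) \<inter> B (h l)" using image_pull[of k B] image_pull[of l B] k l B h_J by simp
      finally show ?thesis by auto
    qed
    have "h ` nbhd {..<n} (pull B) k = nbhd J B (h k)"
    proof (intro equalityI subsetI)
      fix i assume "i \<in> h ` nbhd {..<n} (pull B) k"
      then obtain l where "l < n" "i = h l" "pull B k \<inter> pull B l \<noteq> {}" by (auto simp: nbhd_def)
      then show "i \<in> nbhd J B (h k)" using meet[of l] h_J by (auto simp: nbhd_def)
    next
      fix i assume i: "i \<in> nbhd J B (h k)"
      then obtain l where l: "l < n" "i = h l" using h by (auto simp: nbhd_def bij_betw_def)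
      then have "pull B k \<inter> pull B l \<noteq> {}" using meet[of l] i by (auto simp: nbhd_def)
      then show "i \<in> h ` nbhd {..<n} (pull B) k" using l by (auto simp: nbhd_def)
    qed
    then show ?thesis using card_image[OF inj_h[OF nb]] by simp
  qed
  then have "(\<lambda>k. card (nbhd {..<n} (pull B) k)) ` {..<n} = (\<lambda>k. card (nbhd J B (h k))) ` {..<n}" by auto
  also have "\<dots> = (\<lambda>i. card (nbhd J B i)) ` (h ` {..<n})" by (simp add: image_image)
  also have "h ` {..<n} = J" using h by (simp add: bij_betw_def)
  finally show ?thesis by (simp add: kappa_def)
qed

end

text \<open>Enumerate J and apply the bound to the coordinate maps under the joint law: all hypotheses, \<open>kappa\<close> and the tail
probability are unchanged.\<close>
lemma moderate_deviation_bound_transfer: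
  assumes bound: "moderate_deviation_bound TYPE(nat \<Rightarrow> real) TYPE(nat) C c"
  shows "moderate_deviation_bound TYPE('a) TYPE('i) C c"
  unfolding moderate_deviation_bound_def
proof (intro allI impI)
  fix M :: "'a measure" and J :: "'i set" and X A B and a b z :: real
  assume ps: "prob_space M" and fin: "finite J"
    and X: "\<forall>i\<in>J. X i \<in> borel_measurable M \<and> integrable M (X i) \<and> prob_space.expectation M (X i) = 0 \<and> integrable M (\<lambda>\<omega>. (X i \<omega>)\<^sup>2)"
    and var: "prob_space.variance M (\<lambda>\<omega>. \<Sum>i\<in>J. X i \<omega>) = 1"
    and L1: "LD1 M J X A" and L2: "LD2 M J X A B" and a: "a \<ge> 1" and b: "b \<ge> 1"
    and ex: "\<forall>i\<in>J. integrable M (\<lambda>\<omega>. exp (a * (\<Sum>j\<in>B i. \<bar>X j \<omega>\<bar>))) \<and>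
             prob_space.expectation M (\<lambda>\<omega>. exp (a * (\<Sum>j\<in>B i. \<bar>X j \<omega>\<bar>))) \<le> b"
    and z: "0 \<le> z"
    and range: "z \<le> c * a powr (1/3) * min 1 (real (kappa J B) powr (-1/3) * (1 + theta (card J) a b) powr (-2/3))"
  define n where "n = card J"
  obtain h where h: "bij_betw h {..<n} J"
    using ex_bij_betw_nat_finite[OF fin] by (auto simp: n_def lessThan_atLeast0)
  have Xm: "\<forall>i\<in>J. X i \<in> borel_measurable M" using X by auto
  note ctx = ps h Xm
  define N where "N = joint_law M X n h"
  define G where "G = joint X n h"
  define A' where "A' = pull n h A"
  define B' where "B' = pull n h B"
  define Y where "Y = (\<lambda>(k::nat) (x :: nat \<Rightarrow> real). x k)"
  note int = joint_integral[OF ctx, folded N_def G_def]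
  have G: "G \<omega> k = X (h k) \<omega>" if "k < n" for k \<omega> unfolding G_def by (rule joint_apply[OF ctx that])
  have Ym: "Y k \<in> borel_measurable (PiM {..<n} (\<lambda>_. borel))" if "k < n" for k
    unfolding Y_def by (rule coord_meas[OF ctx that])
  have hJ: "h k \<in> J" if "k < n" for k by (rule h_J[OF ctx that])
  have sub: "A (h k) \<subseteq> J" "B (h k) \<subseteq> J" "A (h k) \<subseteq> B (h k)" if "k < n" for k
    using L2 hJ[OF that] by (auto simp: LD2_def)
  have imA: "h ` A' k = A (h k)" "h ` ({..<n} - A' k) = J - A (h k)" if "k < n" for k
    unfolding A'_def using image_pull[OF ctx that] image_pull_compl[OF ctx that] sub[OF that] by auto
  have imB: "h ` B' k = B (h k)" "h ` ({..<n} - B' k) = J - B (h k)" if "k < n" for k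
    unfolding B'_def using image_pull[OF ctx that] image_pull_compl[OF ctx that] sub[OF that] by auto
  have subA: "A' k \<subseteq> {..<n}" and subB: "B' k \<subseteq> {..<n}" for k
    unfolding A'_def B'_def using pull_sub[OF ctx] by auto
  have sums: "(\<Sum>k<n. Y k (G \<omega>)) = (\<Sum>i\<in>J. X i \<omega>)" for \<omega>
  proof -
    have "(\<Sum>k<n. Y k (G \<omega>)) = (\<Sum>k<n. X (h k) \<omega>)" by (intro sum.cong) (auto simp: Y_def G)
    also have "\<dots> = (\<Sum>i\<in>J. X i \<omega>)" by (rule sum.reindex_bij_betw[OF h])
    finally show ?thesis .
  qed
  have sumsB: "(\<Sum>l\<in>B' k. \<bar>Y l (G \<omega>)\<bar>) = (\<Sum>j\<in>B (h k). \<bar>X j \<omega>\<bar>)" if k: "k < n" for k \<omega>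
  proof -
    have "(\<Sum>l\<in>B' k. \<bar>Y l (G \<omega>)\<bar>) = (\<Sum>l\<in>B' k. \<bar>X (h l) \<omega>\<bar>)"
      by (intro sum.cong refl) (use subB[of k] in \<open>auto simp: Y_def G\<close>)
    also have "\<dots> = (\<Sum>j\<in>h ` B' k. \<bar>X j \<omega>\<bar>)"
    proof -
      have "inj_on h (B' k)" by (rule inj_h[OF ctx subB])
      then show ?thesis by (simp add: sum.reindex)
    qed
    finally show ?thesis by (simp add: imB[OF k])
  qed
  have sum_meas: "(\<lambda>x. \<Sum>k<n. Y k x) \<in> borel_measurable (PiM {..<n} (\<lambda>_. borel))"
    by (intro borel_measurable_sum Ym) auto
  have exp_meas: "(\<lambda>x. exp (a * (\<Sum>l\<in>B' k. \<bar>Y l x\<bar>))) \<in> borel_measurable (PiM {..<n} (\<lambda>_. borel))" for k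
  proof -
    have "(\<lambda>x. \<Sum>l\<in>B' k. \<bar>Y l x\<bar>) \<in> borel_measurable (PiM {..<n} (\<lambda>_. borel))"
      by (intro borel_measurable_sum borel_measurable_abs Ym) (use subB in auto)
    then show ?thesis by measurable
  qed
  have N: "prob_space N" unfolding N_def by (rule joint_law_prob[OF ctx])
  have kap: "kappa {..<n} B' = kappa J B"
    unfolding B'_def by (rule kappa_transfer[OF ctx]) (use L2 in \<open>auto simp: LD2_def\<close>)
  have setsN: "sets N = sets (PiM {..<n} (\<lambda>_. borel))" and spaceN: "space N = space (PiM {..<n} (\<lambda>_. borel :: real measure))"
    by (simp_all add: N_def joint_law_def[OF ctx])
  have measN: "g \<in> borel_measurable N" if "g \<in> borel_measurable (PiM {..<n} (\<lambda>_. borel))" for g :: "(nat \<Rightarrow> real) \<Rightarrow> real"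
    using that by (simp add: measurable_cong_sets[OF setsN refl])
  have main: "\<bar>measure N {x \<in> space N. (\<Sum>k<n. Y k x) > z} / (1 - \<Phi> z) - 1\<bar>
        \<le> C * delta (card {..<n}) (kappa {..<n} B') a b * (1 + z ^ 3)"
  proof (rule bound[unfolded moderate_deviation_bound_def, rule_format, of N "{..<n}" Y A' B'])
    show "prob_space N" by (rule N)
    show "finite {..<n}" by simp
    show "a \<ge> 1" "b \<ge> 1" "0 \<le> z" by fact+
    show "z \<le> c * a powr (1/3) * min 1 (real (kappa {..<n} B') powr (-1/3) * (1 + theta (card {..<n}) a b) powr (-2/3))"
      unfolding kap using range by (simp add: n_def)
    show "Y k \<in> borel_measurable N \<and> integrable N (Y k) \<and> prob_space.expectation N (Y k) = 0 \<and> integrable N (\<lambda>x. (Y k x)\<^sup>2)"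
      if "k \<in> {..<n}" for k
    proof -
      have k: "k < n" using that by simp
      have sq: "(\<lambda>x. (Y k x)\<^sup>2) \<in> borel_measurable (PiM {..<n} (\<lambda>_. borel))" using Ym[OF k] by measurable
      have "Y k (G \<omega>) = X (h k) \<omega>" for \<omega> by (simp add: Y_def G k)
      then show ?thesis using measN[OF Ym[OF k]] int[OF Ym[OF k]] int(2)[OF sq] X hJ[OF k] by simp
    qed
    show "prob_space.variance N (\<lambda>x. \<Sum>k<n. Y k x) = 1"
    proof -
      have sq: "(\<lambda>x. ((\<Sum>k<n. Y k x) - e)\<^sup>2) \<in> borel_measurable (PiM {..<n} (\<lambda>_. borel))" for e :: real
        using sum_meas by measurable
      show ?thesis using var by (simp only: int(1)[OF sum_meas] int(1)[OF sq] sums)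
    qed
    show "LD1 N {..<n} Y A'"
      unfolding LD1_def
    proof (intro ballI conjI subA)
      fix k assume "k \<in> {..<n}"
      then have k: "k < n" by simp
      have "indep_subfamilies M X (h ` {k}) (h ` ({..<n} - A' k))"
        using L1 hJ[OF k] by (simp add: LD1_def imA[OF k])
      then show "indep_subfamilies N Y {k} ({..<n} - A' k)"
        unfolding N_def Y_def by (intro indep_transfer[OF ctx]) (use k in auto)
    qed
    show "LD2 N {..<n} Y A' B'"
      unfolding LD2_def
    proof (intro ballI conjI subB)
      fix k assume "k \<in> {..<n}"
      then have k: "k < n" by simp
      have "indep_subfamilies M X (h ` A' k) (h ` ({..<n} - B' k))"
        using L2 hJ[OF k] by (simp add: LD2_def imA[OF k] imB[OF k])
      then show "indep_subfamilies N Y (A' k) ({..<n} - B' k)"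
        unfolding N_def Y_def by (intro indep_transfer[OF ctx] subA) auto
      show "A' k \<subseteq> B' k" using sub(3)[OF k] by (auto simp: A'_def B'_def pull_def[OF ctx])
    qed
    show "integrable N (\<lambda>x. exp (a * (\<Sum>l\<in>B' k. \<bar>Y l x\<bar>))) \<and>
        prob_space.expectation N (\<lambda>x. exp (a * (\<Sum>l\<in>B' k. \<bar>Y l x\<bar>))) \<le> b" if "k \<in> {..<n}" for k
    proof -
      have k: "k < n" using that by simp
      show ?thesis using ex hJ[OF k] by (simp add: int[OF exp_meas] sumsB[OF k])
    qed
  qed
  have "measure N {x \<in> space N. (\<Sum>k<n. Y k x) > z} = measure M {\<omega> \<in> space M. (\<Sum>i\<in>J. X i \<omega>) > z}"
  proof -
    have S: "{x \<in> space N. (\<Sum>k<n. Y k x) > z} \<in> sets (PiM {..<n} (\<lambda>_. borel))"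
      unfolding spaceN using sum_meas by measurable
    have Gm: "G \<in> measurable M (PiM {..<n} (\<lambda>_. borel))" unfolding G_def by (rule joint_meas[OF ctx])
    have "measure N {x \<in> space N. (\<Sum>k<n. Y k x) > z} = measure M (G -` {x \<in> space N. (\<Sum>k<n. Y k x) > z} \<inter> space M)"
      unfolding N_def joint_law_def[OF ctx] using S Gm by (subst measure_distr) (auto simp: N_def joint_law_def[OF ctx] G_def)
    also have "G -` {x \<in> space N. (\<Sum>k<n. Y k x) > z} \<inter> space M = {\<omega> \<in> space M. (\<Sum>i\<in>J. X i \<omega>) > z}"
      using measurable_space[OF Gm] by (auto simp: spaceN sums)
    finally show ?thesis .
  qed
  then show "\<bar>measure M {\<omega> \<in> space M. (\<Sum>i\<in>J. X i \<omega>) > z} / (1 - \<Phi> z) - 1\<bar>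
        \<le> C * delta (card J) (kappa J B) a b * (1 + z ^ 3)"
    using main[unfolded kap] by (simp add: n_def)
qed

theorem theorem2p1:
  "(\<exists>C>0. \<exists>c>0. moderate_deviation_bound TYPE(nat \<Rightarrow> real) TYPE(nat) C c) \<and>
   (\<forall>C>0. \<forall>c>0. moderate_deviation_bound TYPE(nat \<Rightarrow> real) TYPE(nat) C c \<longrightarrow>
        moderate_deviation_bound TYPE('a) TYPE('i) C c)"
proof (intro conjI allI impI)
  show "\<exists>C>0. \<exists>c>0. moderate_deviation_bound TYPE(nat \<Rightarrow> real) TYPE(nat) C c"
    using moderate_deviation_bound_holds by (intro exI[of _ "2 * 10 ^ 13"] exI[of _ "1 / 10 ^ 4"] conjI) auto
qed (rule moderate_deviation_bound_transfer)

end
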